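(* For every $3$-colorable pattern graph $H$ containing at most one triangle, there exists a $3$-colorable pattern graph $H^{+}$ containing the same number of triangles as $H$, such that Triangle Detection in induced $H$-free graphs reduces to Triangle Detection in $H^{+}$-free graphs in the following sense: if there is an algorithm for Triangle Detection in $H^{+}$-free graphs that runs in time $T(N)$ on $N$-vertex graphs and answers correctly with probability at least $2/3$, then there is an algorithm for Triangle Detection in induced $H$-free graphs running in time $\tilde O\left(n^{2.5}+n^{3/2}\cdot T(\sqrt{n})\right)$ on $n$-vertex graphs and answering correctly with probability at least $1-O(1/n)$.
   Context: Triangle Detection: given a graph, decide whether it contains a triangle (three pairwise adjacent vertices). A copy of $H$ in $G$ is an injective map $\phi:V(H)\to V(G)$ with $\phi(x)\phi(y)\in E(G)$ for every $xy\in E(H)$; $G$ is $H$-free if it has no copy of $H$. An induced copy of $H$ in $G$ is an injective map $\phi$ with $xy\in E(H)$ iff $\phi(x)\phi(y)\in E(G)$; $G$ is induced $H$-free if it has no induced copy. Triangle Detection in ($\ast$)-free graphs means the input is promised to be ($\ast$)-free (an algorithm for it may behave arbitrarily on inputs violating the promise). $\tilde O(\cdot)$ hides polylogarithmic factors in $n$. The model is the Word-RAM with $O(\log n)$-bit words. *)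

theory Defs
  imports "HOL-Probability.Probability" "HOL-Library.Landau_Symbols" "HOL-Library.Log_Nat"
begin

section \<open>Finite simple graphs\<close>

record 'a graph =
  verts :: "'a set"
  edges :: "'a set set"

definition simple_graph :: "'a graph \<Rightarrow> bool" where
  "simple_graph G \<longleftrightarrow> finite (verts G) \<and> (\<forall>e\<in>edges G. e \<subseteq> verts G \<and> card e = 2)"

definition k_colorable :: "nat \<Rightarrow> 'a graph \<Rightarrow> bool" where
  "k_colorable k G \<longleftrightarrow>
     (\<exists>col :: 'a \<Rightarrow> nat. (\<forall>v\<in>verts G. col v < k) \<and> (\<forall>x y. {x, y} \<in> edges G \<longrightarrow> col x \<noteq> col y))"

text \<open>In a simple graph edges have two elements, so \<open>x\<close>, \<open>y\<close>, \<open>z\<close> are distinct below and each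
  triangle is counted once, as a vertex set.\<close>

definition triangles :: "'a graph \<Rightarrow> 'a set set" where
  "triangles G = {{x, y, z} | x y z. {x, y} \<in> edges G \<and> {y, z} \<in> edges G \<and> {x, z} \<in> edges G}"

definition has_triangle :: "'a graph \<Rightarrow> bool" where
  "has_triangle G \<longleftrightarrow> triangles G \<noteq> {}"

definition is_copy :: "('a \<Rightarrow> 'b) \<Rightarrow> 'a graph \<Rightarrow> 'b graph \<Rightarrow> bool" where
  "is_copy \<phi> H G \<longleftrightarrow> inj_on \<phi> (verts H) \<and> \<phi> ` verts H \<subseteq> verts G \<and>
     (\<forall>x\<in>verts H. \<forall>y\<in>verts H. {x, y} \<in> edges H \<longrightarrow> {\<phi> x, \<phi> y} \<in> edges G)"

definition is_induced_copy :: "('a \<Rightarrow> 'b) \<Rightarrow> 'a graph \<Rightarrow> 'b graph \<Rightarrow> bool" where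
  "is_induced_copy \<phi> H G \<longleftrightarrow> inj_on \<phi> (verts H) \<and> \<phi> ` verts H \<subseteq> verts G \<and>
     (\<forall>x\<in>verts H. \<forall>y\<in>verts H. {x, y} \<in> edges H \<longleftrightarrow> {\<phi> x, \<phi> y} \<in> edges G)"

definition free_of :: "'a graph \<Rightarrow> 'b graph \<Rightarrow> bool" where
  "free_of H G \<longleftrightarrow> (\<nexists>\<phi>. is_copy \<phi> H G)"

definition induced_free_of :: "'a graph \<Rightarrow> 'b graph \<Rightarrow> bool" where
  "induced_free_of H G \<longleftrightarrow> (\<nexists>\<phi>. is_induced_copy \<phi> H G)"


section \<open>The randomized Word-RAM\<close>

text \<open>Words of \<open>w\<close> bits are the natural numbers below \<open>2 ^ w\<close>. A program is a list of instructions
  over word-sized registers (finitely many occur in any given program) and a memory of \<open>2 ^ w\<close>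
  words. The memory is modelled as a function on all naturals, but an address is always the content
  of a register, so cells from \<open>2 ^ w\<close> onwards are never accessed. Each instruction costs one step.\<close>

datatype binop = Add | Sub | Mul | Div | Mod | And | Or | Xor | Shl | Shr | Less | Equal

datatype instr =
    Const nat nat \<comment> \<open>\<open>Const r k\<close>: register \<open>r\<close> gets \<open>k\<close> (reduced to a word)\<close>
  | Op binop nat nat nat \<comment> \<open>\<open>Op f r s t\<close>: register \<open>r\<close> gets \<open>f\<close> of registers \<open>s\<close> and \<open>t\<close>\<close>
  | Load nat nat \<comment> \<open>\<open>Load r s\<close>: register \<open>r\<close> gets the memory word addressed by register \<open>s\<close>\<close>
  | Store nat nat \<comment> \<open>\<open>Store r s\<close>: the memory word addressed by register \<open>r\<close> gets register \<open>s\<close>\<close>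
  | Rand nat \<comment> \<open>\<open>Rand r\<close>: register \<open>r\<close> gets a fresh uniformly random word\<close>
  | Jump_Zero nat nat \<comment> \<open>\<open>Jump_Zero r l\<close>: go to position \<open>l\<close> if register \<open>r\<close> is zero\<close>

type_synonym program = "instr list"

record config =
  pc :: nat
  regs :: "nat \<Rightarrow> nat"
  mem :: "nat \<Rightarrow> nat"

text \<open>Arithmetic is modulo \<open>2 ^ w\<close>; both arguments are assumed to be words, so the subtraction
  under \<open>Sub\<close> does not truncate. As in the library, \<open>x div 0 = 0\<close> and \<open>x mod 0 = x\<close>.\<close>

fun eval_op :: "nat \<Rightarrow> binop \<Rightarrow> nat \<Rightarrow> nat \<Rightarrow> nat" where
  "eval_op w Add x y = take_bit w (x + y)"
| "eval_op w Sub x y = take_bit w (x + 2 ^ w - y)"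
| "eval_op w Mul x y = take_bit w (x * y)"
| "eval_op w Div x y = x div y"
| "eval_op w Mod x y = x mod y"
| "eval_op w And x y = semiring_bit_operations_class.and x y"
| "eval_op w Or x y = semiring_bit_operations_class.or x y"
| "eval_op w Xor x y = semiring_bit_operations_class.xor x y"
| "eval_op w Shl x y = take_bit w (push_bit y x)"
| "eval_op w Shr x y = drop_bit y x"
| "eval_op w Less x y = take_bit w (of_bool (x < y))"
| "eval_op w Equal x y = take_bit w (of_bool (x = y))"

definition set_reg :: "nat \<Rightarrow> nat \<Rightarrow> config \<Rightarrow> config" where
  "set_reg r v c = c\<lparr>pc := Suc (pc c), regs := (regs c)(r := v)\<rparr>"

fun exec :: "nat \<Rightarrow> instr \<Rightarrow> config \<Rightarrow> config pmf" where
  "exec w (Const r k) c = return_pmf (set_reg r (take_bit w k) c)"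
| "exec w (Op f r s t) c = return_pmf (set_reg r (eval_op w f (regs c s) (regs c t)) c)"
| "exec w (Load r s) c = return_pmf (set_reg r (mem c (regs c s)) c)"
| "exec w (Store r s) c =
     return_pmf (c\<lparr>pc := Suc (pc c), mem := (mem c)(regs c r := regs c s)\<rparr>)"
| "exec w (Rand r) c = map_pmf (\<lambda>v. set_reg r v c) (pmf_of_set {..<2 ^ w})"
| "exec w (Jump_Zero r l) c =
     return_pmf (c\<lparr>pc := (if regs c r = 0 then l else Suc (pc c))\<rparr>)"

text \<open>The machine halts when the program counter leaves the program; it then answers yes iff
  register \<open>0\<close> is nonzero.\<close>

definition halted :: "program \<Rightarrow> config \<Rightarrow> bool" where
  "halted P c \<longleftrightarrow> length P \<le> pc c"

definition answer :: "config \<Rightarrow> bool" where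
  "answer c \<longleftrightarrow> regs c 0 \<noteq> 0"

definition step :: "nat \<Rightarrow> program \<Rightarrow> config \<Rightarrow> config pmf" where
  "step w P c = (if halted P c then return_pmf c else exec w (P ! pc c) c)"

fun run :: "nat \<Rightarrow> program \<Rightarrow> nat \<Rightarrow> config \<Rightarrow> config pmf" where
  "run w P 0 c = return_pmf c"
| "run w P (Suc t) c = bind_pmf (step w P c) (run w P t)"


section \<open>Triangle Detection under a promise\<close>

text \<open>An \<open>n\<close>-vertex input graph has vertices \<open>0, \<dots>, n - 1\<close>. Register \<open>0\<close> initially contains \<open>n\<close>,
  and the memory contains the adjacency matrix in row-major order; everything else is zero.\<close>

definition input_config :: "nat \<Rightarrow> nat graph \<Rightarrow> config" where
  "input_config n G =
     \<lparr>pc = 0, regs = (\<lambda>_. 0)(0 := n),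
      mem = (\<lambda>a. if a < n * n \<and> {a div n, a mod n} \<in> edges G then 1 else 0)\<rparr>"

text \<open>Words of \<open>O(log n)\<close> bits; the offset keeps the logarithm positive for \<open>n \<le> 1\<close>.\<close>

definition word_size :: "nat \<Rightarrow> nat \<Rightarrow> nat" where
  "word_size c n = c * ceillog2 (n + 2)"

text \<open>There is a Word-RAM algorithm which, on every \<open>n\<close>-vertex graph satisfying the promise \<open>Q\<close>,
  halts within \<open>T n\<close> steps (for all outcomes of the random choices) and answers correctly with
  probability at least \<open>p n\<close>. Nothing is required if the promise is violated. The constant \<open>c\<close> in
  the word size belongs to the algorithm; \<open>c \<ge> 2\<close> makes the whole input addressable.\<close>

definition triangle_detection :: "(nat graph \<Rightarrow> bool) \<Rightarrow> (nat \<Rightarrow> nat) \<Rightarrow> (nat \<Rightarrow> real) \<Rightarrow> bool" where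
  "triangle_detection Q T p \<longleftrightarrow>
     (\<exists>P c. c \<ge> 2 \<and>
       (\<forall>n G. simple_graph G \<and> verts G = {..<n} \<and> Q G \<longrightarrow>
          (let D = run (word_size c n) P (T n) (input_config n G) in
             (\<forall>s\<in>set_pmf D. halted P s) \<and>
             measure_pmf.prob D {s. answer s \<longleftrightarrow> has_triangle G} \<ge> p n)))"

text \<open>The soft-O class of \<open>g\<close>: polylogarithmic factors in \<open>n\<close> are hidden.\<close>

definition soft_O :: "(nat \<Rightarrow> real) \<Rightarrow> (nat \<Rightarrow> real) set" where
  "soft_O g = {f. \<exists>k::nat. f \<in> O(\<lambda>n. g n * ln (real n) ^ k)}"

end

theory Submission
  imports Defs "HOL-Number_Theory.Cong"
begin

text \<open>\<open>H\<^sup>+\<close> arises from \<open>H\<close> by giving every non-adjacent pair two new common neighbours. If an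
  induced \<open>H\<close>-free graph contains a copy of \<open>H\<^sup>+\<close>, then the image of some non-adjacent pair is an
  edge and lies in two triangles. Hence every induced subgraph with at most one triangle is
  \<open>H\<^sup>+\<close>-free, and the given algorithm works on it.

  If the input has more than about \<open>\<surd>n\<close> triangles, sampling \<open>\<approx> n\<^sup>5\<^sup>/\<^sup>2\<close> random triples finds one.
  Otherwise cut a random permutation \<open>x \<mapsto> a * x mod 2\<^sup>k\<close>, \<open>a\<close> odd, into blocks of \<open>\<approx> \<surd>n\<close> vertices.
  This is a universal hash function, so a fixed triangle is likely to be the only one in the union
  of its three blocks. There are \<open>\<approx> n\<^sup>3\<^sup>/\<^sup>2\<close> unions of three blocks; the given algorithm is run on each
  of them \<open>O(log n)\<close> times and decides by majority.

  The bound \<open>T\<close> is not known to the reduction, and nothing is promised for a piece with several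
  triangles. So a run is stopped after a budget of steps, initially \<open>0\<close>. If it has not halted by
  then, the piece is searched by brute force in \<open>O(n\<^sup>3\<^sup>/\<^sup>2)\<close> steps: either this finds a triangle, or
  the piece is triangle-free, which shows that the budget is below \<open>T(\<surd>n)\<close>, and the budget grows by one.
  At most \<open>T(\<surd>n) + 1\<close> brute-force searches take place.\<close>

section \<open>The augmented pattern\<close>

text \<open>Three obstacles shape the development. First, \<open>T\<close> is an arbitrary function,
  not even monotone, and only its value at \<open>m\<close>, the floor of the square root of
  \<open>n\<close>, may enter the bound; so every piece is padded with isolated vertices to exactly
  \<open>m\<close> vertices. Second, the given algorithm runs on the shorter words that belong to
  \<open>m\<close> vertices and may scatter data over a memory whose size is a polynomial of
  arbitrary degree. That memory cannot be cleared between runs, so the simulation truncates its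
  words and places every run in a fresh, still zero region; word length is cheap, hence there is
  address space for all of them. Third, the trials are not identically distributed, because the step
  budget depends on the history. Error bounds are therefore never derived from independence: each
  loop carries a potential, a function of the remaining turns, the answer and the votes, that does
  not grow in expectation. The error probability comes out as the initial value of the
  potential.\<close>

definition non_edges :: "'a graph \<Rightarrow> 'a set set" where
  "non_edges H = {e. e \<subseteq> verts H \<and> card e = 2 \<and> e \<notin> edges H}"

text \<open>Every non-edge of the pattern gets two new common neighbours, so that filling it creates two
  triangles.\<close>

definition augment :: "'a graph \<Rightarrow> ('a + 'a set \<times> bool) graph" where
  "augment H = \<lparr>verts = Inl ` verts H \<union> Inr ` (non_edges H \<times> UNIV),
     edges = (\<lambda>e. Inl ` e) ` edges H \<union> {{Inl u, Inr (e, b)} | u e b. e \<in> non_edges H \<and> u \<in> e}\<rparr>"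

definition map_graph :: "('a \<Rightarrow> 'b) \<Rightarrow> 'a graph \<Rightarrow> 'b graph" where
  "map_graph f G = \<lparr>verts = f ` verts G, edges = (\<lambda>e. f ` e) ` edges G\<rparr>"

lemma edge_in_verts: "simple_graph G \<Longrightarrow> {x, y} \<in> edges G \<Longrightarrow> x \<in> verts G \<and> y \<in> verts G \<and> x \<noteq> y"
  by (fastforce simp: simple_graph_def)

lemma simple_augment:
  assumes "simple_graph H" shows "simple_graph (augment H)"
proof -
  have "finite (non_edges H)"
    using assms by (auto simp: non_edges_def simple_graph_def intro: finite_subset[of _ "Pow (verts H)"])
  then show ?thesis
    using assms by (auto simp: simple_graph_def augment_def card_image non_edges_def)
qed

lemma augment_edge_Inl: "{Inl x, Inl y} \<in> edges (augment H) \<longleftrightarrow> {x, y} \<in> edges H"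
proof -
  have "{Inl x, Inl y :: 'a + 'a set \<times> bool} = Inl ` e \<longleftrightarrow> e = {x, y}" for e
    by (metis image_empty image_insert inj_Inl inj_image_eq_iff)
  then show ?thesis by (auto simp: augment_def image_iff doubleton_eq_iff)
qed

lemma augment_edge_Inr: "{Inr z, y} \<in> edges (augment H) \<longleftrightarrow> (\<exists>u. y = Inl u \<and> fst z \<in> non_edges H \<and> u \<in> fst z)"
  by (cases z) (auto simp: augment_def doubleton_eq_iff)

lemma augment_edge_Inr': "{y, Inr z} \<in> edges (augment H) \<longleftrightarrow> (\<exists>u. y = Inl u \<and> fst z \<in> non_edges H \<and> u \<in> fst z)"
  using augment_edge_Inr[of z y H] by (simp only: insert_commute[of y])

text \<open>A new vertex is adjacent only to the two ends of one non-edge, and these stay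
  non-adjacent, so no triangle passes through it.\<close>

lemma triangles_augment:
  assumes "simple_graph H" shows "triangles (augment H) = (\<lambda>t. Inl ` t) ` triangles H"
proof -
  have *: False if "{Inr z, x} \<in> edges (augment H)" "{Inr z, y} \<in> edges (augment H)"
      "{x, y} \<in> edges (augment H)" for x y :: "'a + 'a set \<times> bool" and z
  proof -
    from that obtain u v where uv: "x = Inl u" "y = Inl v" "fst z \<in> non_edges H" "u \<in> fst z" "v \<in> fst z"
      by (auto simp: augment_edge_Inr)
    then have e: "{u, v} \<in> edges H" using that(3) by (simp add: augment_edge_Inl)
    have "fst z = {u, v}"
      using uv edge_in_verts[OF assms e] unfolding non_edges_def card_2_iff by auto
    then show False using uv e by (auto simp: non_edges_def)
  qed
  have r: "\<exists>x' y' z'. x = Inl x' \<and> y = Inl y' \<and> z = Inl z'"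
    if h: "{x, y} \<in> edges (augment H)" "{y, z} \<in> edges (augment H)" "{x, z} \<in> edges (augment H)"
    for x y z :: "'a + 'a set \<times> bool"
  proof (cases x)
    case (Inr c) then show ?thesis using *[of c y z] h by blast
  next
    case (Inl x')
    note x = this
    show ?thesis
    proof (cases y)
      case (Inr c) then show ?thesis using *[of c x z] h by (metis insert_commute)
    next
      case (Inl y')
      show ?thesis
      proof (cases z)
        case (Inr c) then show ?thesis using *[of c x y] h by (metis insert_commute)
      qed (use x Inl in blast)
    qed
  qed
  show ?thesis
  proof (intro set_eqI iffI)
    fix t assume "t \<in> triangles (augment H)"
    then obtain x y z where t: "t = {x, y, z}" "{x, y} \<in> edges (augment H)"
      "{y, z} \<in> edges (augment H)" "{x, z} \<in> edges (augment H)" unfolding triangles_def by blast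
    with r obtain x' y' z' where xyz: "x = Inl x'" "y = Inl y'" "z = Inl z'" by meson
    then have "{x', y', z'} \<in> triangles H"
      using t unfolding triangles_def by (auto simp: augment_edge_Inl)
    moreover have "t = Inl ` {x', y', z'}" using t xyz by simp
    ultimately show "t \<in> (\<lambda>t. Inl ` t) ` triangles H" by blast
  next
    fix t assume "t \<in> (\<lambda>t. Inl ` t :: ('a + 'a set \<times> bool) set) ` triangles H"
    then obtain x y z where "t = {Inl x, Inl y, Inl z}" "{x, y} \<in> edges H"
      "{y, z} \<in> edges H" "{x, z} \<in> edges H" unfolding triangles_def by auto
    then show "t \<in> triangles (augment H)"
      unfolding triangles_def mem_Collect_eq by (metis augment_edge_Inl)
  qed
qed

lemma card_triangles_augment:
  assumes "simple_graph H" shows "card (triangles (augment H)) = card (triangles H)"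
  unfolding triangles_augment[OF assms]
  by (rule card_image) (simp add: inj_on_def inj_image_eq_iff)

text \<open>A new vertex has just two neighbours, both old, so one of the three colours is free for
  it; new vertices are pairwise non-adjacent.\<close>

lemma k_colorable_augment:
  assumes "simple_graph H" "k_colorable 3 H" shows "k_colorable 3 (augment H)"
proof -
  obtain col where col: "\<And>v. v \<in> verts H \<Longrightarrow> col v < (3::nat)"
    "\<And>x y. {x, y} \<in> edges H \<Longrightarrow> col x \<noteq> col y"
    using assms(2) unfolding k_colorable_def by blast
  have "\<exists>c<3. c \<notin> col ` e" if "e \<in> non_edges H" for e
  proof -
    have "finite e" "card e = 2" using that by (auto simp: non_edges_def card_2_iff)
    then have "card (col ` e) < card {..<3::nat}" using card_image_le[of e col] by simp
    then have "\<not> {..<3} \<subseteq> col ` e" using \<open>finite e\<close> by (meson card_mono finite_imageI not_le)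
    then show ?thesis by auto
  qed
  then obtain fr where fr: "\<And>e. e \<in> non_edges H \<Longrightarrow> fr e < (3::nat) \<and> fr e \<notin> col ` e" by metis
  define c where "c z = (case z of Inl v \<Rightarrow> col v | Inr (e, b) \<Rightarrow> fr e)" for z :: "'a + 'a set \<times> bool"
  have "c x \<noteq> c y" if h: "{x, y} \<in> edges (augment H)" for x y
    using h fr col(2)
    by (cases x; cases y)
      (auto simp: c_def augment_edge_Inl augment_edge_Inr augment_edge_Inr' split: prod.splits, force+)
  moreover have "\<forall>v\<in>verts (augment H). c v < 3"
    using col(1) fr by (auto simp: c_def augment_def)
  ultimately show ?thesis unfolding k_colorable_def by blast
qed

section \<open>Injective relabelling, used to move the augmented pattern to natural-number
  vertices\<close>

lemma map_graph_edge:
  assumes "inj_on f (verts G)" "simple_graph G" "x \<in> verts G" "y \<in> verts G"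
  shows "{f x, f y} \<in> edges (map_graph f G) \<longleftrightarrow> {x, y} \<in> edges G"
proof
  assume "{f x, f y} \<in> edges (map_graph f G)"
  then obtain e where e: "e \<in> edges G" "f ` e = f ` {x, y}" by (auto simp: map_graph_def)
  then have "e \<subseteq> verts G" using assms(2) by (auto simp: simple_graph_def)
  then have "e = {x, y}" using e(2) inj_on_image_eq_iff[OF assms(1), of e "{x, y}"] assms(3,4) by blast
  then show "{x, y} \<in> edges G" using e by simp
next
  assume "{x, y} \<in> edges G"
  then have "f ` {x, y} \<in> edges (map_graph f G)" by (simp only: map_graph_def graph.simps) (rule imageI)
  then show "{f x, f y} \<in> edges (map_graph f G)" by simp
qed

lemma simple_map_graph:
  assumes "inj_on f (verts G)" "simple_graph G" shows "simple_graph (map_graph f G)"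
  unfolding simple_graph_def
proof (intro conjI ballI)
  fix e assume "e \<in> edges (map_graph f G)"
  then obtain e' where e: "e' \<in> edges G" "e = f ` e'" by (auto simp: map_graph_def)
  then have e': "e' \<subseteq> verts G" "card e' = 2" using assms(2) by (auto simp: simple_graph_def)
  show "e \<subseteq> verts (map_graph f G)" using e e' by (auto simp: map_graph_def)
  show "card e = 2" using e e' card_image inj_on_subset[OF assms(1)] by metis
qed (use assms(2) in \<open>simp add: simple_graph_def map_graph_def\<close>)

lemma triangles_map_graph:
  assumes "inj_on f (verts G)" "simple_graph G"
  shows "triangles (map_graph f G) = (\<lambda>t. f ` t) ` triangles G"
proof (intro set_eqI iffI)
  fix t assume "t \<in> triangles (map_graph f G)"
  then obtain x y z where t: "t = {x, y, z}" "{x, y} \<in> edges (map_graph f G)"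
    "{y, z} \<in> edges (map_graph f G)" "{x, z} \<in> edges (map_graph f G)" unfolding triangles_def by blast
  then have "x \<in> f ` verts G" "y \<in> f ` verts G" "z \<in> f ` verts G"
    using edge_in_verts[OF simple_map_graph[OF assms]] by (metis map_graph_def graph.select_convs(1))+
  then obtain x' y' z' where "x' \<in> verts G" "y' \<in> verts G" "z' \<in> verts G" "x = f x'" "y = f y'" "z = f z'"
    by blast
  then have "{x', y', z'} \<in> triangles G" "t = f ` {x', y', z'}"
    using t map_graph_edge[OF assms] unfolding triangles_def by auto
  then show "t \<in> (\<lambda>t. f ` t) ` triangles G" by blast
next
  fix t assume "t \<in> (\<lambda>t. f ` t) ` triangles G"
  then obtain x y z where "t = {f x, f y, f z}" "{x, y} \<in> edges G"
      "{y, z} \<in> edges G" "{x, z} \<in> edges G" unfolding triangles_def by auto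
  then show "t \<in> triangles (map_graph f G)"
    unfolding triangles_def mem_Collect_eq using edge_in_verts[OF assms(2)] map_graph_edge[OF assms]
    by metis
qed

lemma triangles_subset_Pow: "simple_graph G \<Longrightarrow> triangles G \<subseteq> Pow (verts G)"
proof
  fix t assume "simple_graph G" "t \<in> triangles G"
  then show "t \<in> Pow (verts G)" unfolding triangles_def using edge_in_verts[of G] by blast
qed

lemma card_triangles_map_graph:
  assumes "inj_on f (verts G)" "simple_graph G"
  shows "card (triangles (map_graph f G)) = card (triangles G)"
  unfolding triangles_map_graph[OF assms]
  by (rule card_image, rule inj_on_subset[OF inj_on_image_Pow[OF assms(1)]
        triangles_subset_Pow[OF assms(2)]])

lemma k_colorable_map_graph:
  assumes "inj_on f (verts G)" "simple_graph G" "k_colorable k G"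
  shows "k_colorable k (map_graph f G)"
proof -
  obtain col where col: "\<And>v. v \<in> verts G \<Longrightarrow> col v < k"
    "\<And>x y. {x, y} \<in> edges G \<Longrightarrow> col x \<noteq> col y"
    using assms(3) unfolding k_colorable_def by blast
  define c where "c = col \<circ> inv_into (verts G) f"
  have "c x \<noteq> c y" if h: "{x, y} \<in> edges (map_graph f G)" for x y
  proof -
    have "x \<in> f ` verts G" "y \<in> f ` verts G"
      using edge_in_verts[OF simple_map_graph[OF assms(1,2)] h] by (simp_all add: map_graph_def)
    then obtain x' y' where "x' \<in> verts G" "y' \<in> verts G" "x = f x'" "y = f y'" by blast
    then show ?thesis using h map_graph_edge[OF assms(1,2)] col(2) assms(1) by (simp add: c_def)
  qed
  moreover have "\<forall>v\<in>verts (map_graph f G). c v < k"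
    using col(1) assms(1) by (auto simp: c_def map_graph_def)
  ultimately show ?thesis unfolding k_colorable_def by blast
qed

text \<open>Vertices outside \<open>V\<close> are isolated padding. They are avoided by the image of \<open>H\<close>, since (if \<open>H\<close>
  has two vertices) every vertex of \<open>H\<close> has a neighbour in the augmented pattern.\<close>

lemma free_of_augment:
  fixes H :: "'a graph" and G :: "'c graph" and PG :: "'b graph" and f :: "'b \<Rightarrow> 'c"
  assumes H: "simple_graph H" and G: "simple_graph G" "induced_free_of H G" "verts G \<noteq> {}"
    and PG: "simple_graph PG" "card (triangles PG) \<le> 1"
    and V: "inj_on f V" "f ` V \<subseteq> verts G"
    and E: "\<And>x y. {x, y} \<in> edges PG \<Longrightarrow> x \<in> V \<and> y \<in> V"
           "\<And>x y. x \<in> V \<Longrightarrow> y \<in> V \<Longrightarrow> {x, y} \<in> edges PG \<longleftrightarrow> {f x, f y} \<in> edges G"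
    and inj: "inj_on g (verts (augment H))"
  shows "free_of (map_graph g (augment H)) PG"
  unfolding free_of_def
proof
  assume "\<exists>\<phi>. is_copy \<phi> (map_graph g (augment H)) PG"
  then obtain \<phi> where cp: "is_copy \<phi> (map_graph g (augment H)) PG" by blast
  define \<psi> where "\<psi> = \<phi> \<circ> g"
  have edge: "{\<psi> x, \<psi> y} \<in> edges PG" if "{x, y} \<in> edges (augment H)" for x y
  proof -
    have "x \<in> verts (augment H)" "y \<in> verts (augment H)"
      using edge_in_verts[OF simple_augment[OF H] that] by auto
    then show ?thesis
      using cp map_graph_edge[OF inj simple_augment[OF H]] that unfolding is_copy_def \<psi>_def
      by (auto simp: map_graph_def)
  qed
  have inj\<psi>: "inj_on \<psi> (verts (augment H))"
    using cp inj unfolding is_copy_def \<psi>_def by (simp add: comp_inj_on map_graph_def)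
  have ne: "{x, y} \<in> non_edges H" if "x \<in> verts H" "y \<in> verts H" "x \<noteq> y" "{x, y} \<notin> edges H" for x y
    using that by (auto simp: non_edges_def)
  have new: "{Inl x, Inr ({x, y}, b)} \<in> edges (augment H)" "{Inl y, Inr ({x, y}, b)} \<in> edges (augment H)"
    if "{x, y} \<in> non_edges H" for x y b
    using that by (auto simp: augment_edge_Inr')
  show False
  proof (cases "\<exists>x\<in>verts H. \<exists>y\<in>verts H. x \<noteq> y")
    \<comment> \<open>A pattern with at most one vertex has no edges, so a constant map is an
      induced copy of it in any nonempty graph, against the promise.\<close>
    case False
    have ed: "e \<notin> edges H" for e
    proof
      assume "e \<in> edges H"
      then obtain x y where "e = {x, y}" "x \<noteq> y" "e \<subseteq> verts H"
        using H unfolding simple_graph_def card_2_iff by metis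
      then show False using False by blast
    qed
    obtain v where "v \<in> verts G" using G by blast
    then have "is_induced_copy (\<lambda>_. v) H G"
      using False ed edge_in_verts[OF G(1), of v v] unfolding is_induced_copy_def inj_on_def by auto
    then show False using G unfolding induced_free_of_def by blast
  next
    case True
    have inV: "\<psi> (Inl x) \<in> V" if "x \<in> verts H" for x
    proof -
      obtain y where y: "y \<in> verts H" "x \<noteq> y" using True by metis
      show ?thesis
      proof (cases "{x, y} \<in> edges H")
        case True
        then show ?thesis using E(1) edge[of "Inl x" "Inl y"] by (simp add: augment_edge_Inl)
      next
        case False
        then show ?thesis using E(1) edge[OF new(1)] ne y that by blast
      qed
    qed
    \<comment> \<open>A non-edge sent to an edge would close two triangles with the images of its
      two new neighbours. Injectivity of the copy makes them different, against the bound on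
      \<open>triangles PG\<close>.\<close>
    have *: "{x, y} \<in> edges H" if "x \<in> verts H" "y \<in> verts H" "{\<psi> (Inl x), \<psi> (Inl y)} \<in> edges PG" for x y
    proof (rule ccontr)
      assume n: "{x, y} \<notin> edges H"
      have "x \<noteq> y" using that edge_in_verts[OF PG(1)] by blast
      then have e: "{x, y} \<in> non_edges H" using ne that n by blast
      have "{\<psi> (Inl x), \<psi> (Inl y), \<psi> (Inr ({x, y}, b))} \<in> triangles PG" for b
        using that(3) edge[OF new(1)[OF e]] edge[OF new(2)[OF e]] unfolding triangles_def by blast
      moreover have "finite (triangles PG)"
        using triangles_subset_Pow[OF PG(1)] PG(1) by (meson finite_Pow_iff finite_subset simple_graph_def)
      ultimately have eq: "{\<psi> (Inl x), \<psi> (Inl y), \<psi> (Inr ({x, y}, True))}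
          = {\<psi> (Inl x), \<psi> (Inl y), \<psi> (Inr ({x, y}, False))}"
        using PG(2) card_le_Suc0_iff_eq by (metis One_nat_def)
      have vs: "Inl x \<in> verts (augment H)" "Inl y \<in> verts (augment H)" "Inr ({x, y}, b) \<in> verts (augment H)" for b
        using that e by (auto simp: augment_def)
      have "\<psi> (Inr ({x, y}, True)) \<noteq> \<psi> (Inl x)" "\<psi> (Inr ({x, y}, True)) \<noteq> \<psi> (Inl y)"
        "\<psi> (Inr ({x, y}, True)) \<noteq> \<psi> (Inr ({x, y}, False))"
        using inj_onD[OF inj\<psi> _ vs(3) vs(1)] inj_onD[OF inj\<psi> _ vs(3) vs(2)] inj_onD[OF inj\<psi> _ vs(3) vs(3)]
        by blast+
      then show False using eq by blast
    qed
    have **: "{\<psi> (Inl x), \<psi> (Inl y)} \<in> edges PG" if "{x, y} \<in> edges H" for x y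
      using edge that by (simp add: augment_edge_Inl)
    have "is_induced_copy (\<lambda>x. f (\<psi> (Inl x))) H G"
      unfolding is_induced_copy_def
    proof (intro conjI)
      show "inj_on (\<lambda>x. f (\<psi> (Inl x))) (verts H)"
      proof (rule inj_onI)
        fix x y assume h: "x \<in> verts H" "y \<in> verts H" "f (\<psi> (Inl x)) = f (\<psi> (Inl y))"
        then have "\<psi> (Inl x) = \<psi> (Inl y)" using inj_onD[OF V(1)] inV by blast
        then have "Inl x = (Inl y :: 'a + 'a set \<times> bool)"
          using inj_onD[OF inj\<psi>] h by (auto simp: augment_def)
        then show "x = y" by simp
      qed
    next
      show "(\<lambda>x. f (\<psi> (Inl x))) ` verts H \<subseteq> verts G" using inV V(2) by blast
    next
      show "\<forall>x\<in>verts H. \<forall>y\<in>verts H. ({x, y} \<in> edges H) = ({f (\<psi> (Inl x)), f (\<psi> (Inl y))} \<in> edges G)"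
        using E(2)[OF inV inV] * ** by metis
    qed
    then show False using G unfolding induced_free_of_def by blast
  qed
qed

section \<open>A structured language and its compilation\<close>

datatype aexp = Vr nat | Nm nat | Bn binop aexp aexp | Ld aexp

datatype com = Skip | Asg nat aexp | Sto aexp aexp | Rnd nat | Seq com com (infixr ";;" 60)
  | Ite aexp com com | For nat aexp com

text \<open>\<open>tm\<close> is a clock counting machine steps. With the clock in the state, a
  running-time bound is an ordinary postcondition on the support.\<close>

record st =
  vr :: "nat \<Rightarrow> nat"
  mm :: "nat \<Rightarrow> nat"
  tm :: nat

primrec aval :: "nat \<Rightarrow> aexp \<Rightarrow> st \<Rightarrow> nat" where
  "aval w (Vr x) s = vr s x"
| "aval w (Nm k) s = take_bit w k"
| "aval w (Bn f a b) s = eval_op w f (aval w a s) (aval w b s)"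
| "aval w (Ld a) s = mm s (aval w a s)"

text \<open>Variable \<open>x\<close> lives in register \<open>2 * x\<close>; the odd registers hold intermediate values.\<close>

primrec ecode :: "nat \<Rightarrow> aexp \<Rightarrow> instr list" where
  "ecode d (Vr x) = [Op Or (2 * d + 1) (2 * x) (2 * x)]"
| "ecode d (Nm k) = [Const (2 * d + 1) k]"
| "ecode d (Bn f a b) = ecode d a @ ecode (Suc d) b @ [Op f (2 * d + 1) (2 * d + 1) (2 * d + 3)]"
| "ecode d (Ld a) = ecode d a @ [Load (2 * d + 1) (2 * d + 1)]"

primrec elen :: "aexp \<Rightarrow> nat" where
  "elen (Vr x) = 1"
| "elen (Nm k) = 1"
| "elen (Bn f a b) = elen a + elen b + 1"
| "elen (Ld a) = elen a + 1"

definition tick :: "nat \<Rightarrow> st \<Rightarrow> st" where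
  "tick k s = s\<lparr>tm := tm s + k\<rparr>"

definition asg :: "nat \<Rightarrow> nat \<Rightarrow> st \<Rightarrow> st" where
  "asg x v s = s\<lparr>vr := (vr s)(x := v)\<rparr>"

definition sto :: "nat \<Rightarrow> nat \<Rightarrow> st \<Rightarrow> st" where
  "sto a v s = s\<lparr>mm := (mm s)(a := v)\<rparr>"

lemma st_simps [simp]:
  "vr (tick k s) = vr s" "mm (tick k s) = mm s" "tm (tick k s) = tm s + k"
  "vr (asg x v s) = (vr s)(x := v)" "mm (asg x v s) = mm s" "tm (asg x v s) = tm s"
  "vr (sto a v s) = vr s" "mm (sto a v s) = (mm s)(a := v)" "tm (sto a v s) = tm s"
  by (simp_all add: tick_def asg_def sto_def)

text \<open>A loop counts its variable down: the body sees the values \<open>k - 1, \<dots>, 0\<close>.\<close>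

primrec loop :: "nat \<Rightarrow> (st \<Rightarrow> st pmf) \<Rightarrow> nat \<Rightarrow> st \<Rightarrow> st pmf" where
  "loop x f 0 s = return_pmf (tick 1 (asg x 0 s))"
| "loop x f (Suc k) s = bind_pmf (f (tick 3 (asg x k s))) (\<lambda>s'. loop x f k (tick 2 s'))"

text \<open>The ticks are the instruction counts of \<open>ccode\<close>. The 2 after a then-branch
  and after a loop body is an unconditional jump, coded as \<open>Const 1 0\<close> followed by
  \<open>Jump_Zero\<close>; the 3 before a body is the exit test and the two instructions of the
  decrement.\<close>

primrec sem :: "nat \<Rightarrow> com \<Rightarrow> st \<Rightarrow> st pmf" where
  "sem w Skip s = return_pmf s"
| "sem w (Asg x e) s = return_pmf (tick (elen e + 1) (asg x (aval w e s) s))"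
| "sem w (Sto a e) s = return_pmf (tick (elen a + elen e + 1) (sto (aval w a s) (aval w e s) s))"
| "sem w (Rnd x) s = map_pmf (\<lambda>v. tick 1 (asg x v s)) (pmf_of_set {..<2 ^ w})"
| "sem w (c ;; d) s = bind_pmf (sem w c s) (sem w d)"
| "sem w (Ite e c d) s =
     (if aval w e s \<noteq> 0 then map_pmf (tick 2) (sem w c (tick (elen e + 1) s))
      else sem w d (tick (elen e + 1) s))"
| "sem w (For x e c) s = loop x (sem w c) (aval w e s) (tick (elen e + 1) s)"

primrec writes :: "com \<Rightarrow> nat set" where
  "writes Skip = {}"
| "writes (Asg x e) = {x}"
| "writes (Sto a e) = {}"
| "writes (Rnd x) = {x}"
| "writes (c ;; d) = writes c \<union> writes d"
| "writes (Ite e c d) = writes c \<union> writes d"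
| "writes (For x e c) = insert x (writes c)"

text \<open>The compiled loop keeps its counter only in the register of the loop variable, whereas
  \<open>loop\<close> tracks it separately; they agree if the body leaves the variable
  alone.\<close>

primrec wfc :: "com \<Rightarrow> bool" where
  "wfc Skip = True"
| "wfc (Asg x e) = True"
| "wfc (Sto a e) = True"
| "wfc (Rnd x) = True"
| "wfc (c ;; d) = (wfc c \<and> wfc d)"
| "wfc (Ite e c d) = (wfc c \<and> wfc d)"
| "wfc (For x e c) = (wfc c \<and> x \<notin> writes c)"

primrec clen :: "com \<Rightarrow> nat" where
  "clen Skip = 0"
| "clen (Asg x e) = elen e + 1"
| "clen (Sto a e) = elen a + elen e + 1"
| "clen (Rnd x) = 1"
| "clen (c ;; d) = clen c + clen d"
| "clen (Ite e c d) = elen e + clen c + clen d + 3"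
| "clen (For x e c) = elen e + clen c + 6"

primrec ccode :: "nat \<Rightarrow> com \<Rightarrow> instr list" where
  "ccode off Skip = []"
| "ccode off (Asg x e) = ecode 0 e @ [Op Or (2 * x) 1 1]"
| "ccode off (Sto a e) = ecode 0 a @ ecode 1 e @ [Store 1 3]"
| "ccode off (Rnd x) = [Rand (2 * x)]"
| "ccode off (c ;; d) = ccode off c @ ccode (off + clen c) d"
| "ccode off (Ite e c d) =
     ecode 0 e @ [Jump_Zero 1 (off + elen e + clen c + 3)] @
     ccode (off + elen e + 1) c @
     [Const 1 0, Jump_Zero 1 (off + elen e + clen c + clen d + 3)] @
     ccode (off + elen e + clen c + 3) d"
| "ccode off (For x e c) =
     ecode 0 e @
     [Op Or (2 * x) 1 1, Jump_Zero (2 * x) (off + elen e + clen c + 6), Const 1 1,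
      Op Sub (2 * x) (2 * x) 1] @
     ccode (off + elen e + 4) c @ [Const 1 0, Jump_Zero 1 (off + elen e + 1)]"

lemma length_ecode [simp]: "length (ecode d e) = elen e"
  by (induction e arbitrary: d) auto

lemma length_ccode [simp]: "length (ccode off c) = clen c"
  by (induction c arbitrary: off) auto

lemma sem_tm_mono: "s' \<in> set_pmf (sem w c s) \<Longrightarrow> tm s \<le> tm s'"
proof (induction c arbitrary: s s')
  case (Ite e c d) then show ?case by (fastforce split: if_splits)
next
  case (For x e c)
  have "s' \<in> set_pmf (loop x (sem w c) k s) \<Longrightarrow> tm s \<le> tm s'" for k s
    by (induction k arbitrary: s) (fastforce dest: For.IH)+
  from this[of "aval w e s" "tick (elen e + 1) s"] For.prems show ?case by simp
qed fastforce+

lemma sem_frame: "s' \<in> set_pmf (sem w c s) \<Longrightarrow> x \<notin> writes c \<Longrightarrow> vr s' x = vr s x"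
proof (induction c arbitrary: s s')
  case (Ite e c d) then show ?case by (fastforce split: if_splits)
next
  case (For y e c)
  have "s' \<in> set_pmf (loop y (sem w c) k s) \<Longrightarrow> vr s' x = vr s x" for k s
    using For.prems(2) by (induction k arbitrary: s) (fastforce dest: For.IH)+
  from this[of "aval w e s" "tick (elen e + 1) s"] For.prems show ?case by simp
qed fastforce+

definition words :: "nat \<Rightarrow> st \<Rightarrow> bool" where
  "words w s \<longleftrightarrow> (\<forall>x. vr s x < 2 ^ w) \<and> (\<forall>a. mm s a < 2 ^ w)"

lemma eval_op_less:
  assumes "x < 2 ^ w" "y < 2 ^ w" shows "eval_op w f x y < 2 ^ w"
proof -
  have "take_bit w x = x" "take_bit w y = y" using assms by (simp_all add: take_bit_nat_eq_self_iff)
  then have b: "semiring_bit_operations_class.and x y < 2 ^ w" "semiring_bit_operations_class.or x y < 2 ^ w"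
    "semiring_bit_operations_class.xor x y < 2 ^ w"
    by (simp_all flip: take_bit_nat_eq_self_iff)
  have "drop_bit y x \<le> x" by (simp add: drop_bit_eq_div)
  with b show ?thesis
    using assms by (cases f) (auto intro: le_less_trans[OF div_le_dividend] le_less_trans[OF mod_less_eq_dividend])
qed

lemma aval_less: "words w s \<Longrightarrow> aval w e s < 2 ^ w"
  by (induction e) (auto simp: words_def eval_op_less)

lemma words_simps [simp]:
  "words w (tick k s) = words w s"
  "words w s \<Longrightarrow> v < 2 ^ w \<Longrightarrow> words w (asg x v s)"
  "words w s \<Longrightarrow> v < 2 ^ w \<Longrightarrow> words w (sto a v s)"
  by (auto simp: words_def)

lemma sem_words: "s' \<in> set_pmf (sem w c s) \<Longrightarrow> words w s \<Longrightarrow> words w s'"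
proof (induction c arbitrary: s s')
  case (Ite e c d) then show ?case by (fastforce split: if_splits)
next
  case (Rnd x)
  then show ?case by (auto simp: set_pmf_of_set lessThan_empty_iff)
next
  case (For x e c)
  have "s' \<in> set_pmf (loop x (sem w c) k s) \<Longrightarrow> words w s \<Longrightarrow> k < 2 ^ w \<Longrightarrow> words w s'" for k s
  proof (induction k arbitrary: s)
    case (Suc k)
    then obtain s1 where "s1 \<in> set_pmf (sem w c (tick 3 (asg x k s)))"
      "s' \<in> set_pmf (loop x (sem w c) k (tick 2 s1))" by auto
    with Suc For.IH show ?case by fastforce
  qed simp
  from this[of "aval w e s" "tick (elen e + 1) s"] For.prems show ?case by (simp add: aval_less)
qed (auto simp: aval_less)

section \<open>Correctness of the compilation\<close>

definition code_at :: "program \<Rightarrow> nat \<Rightarrow> instr list \<Rightarrow> bool" where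
  "code_at P off xs \<longleftrightarrow> (\<forall>i<length xs. off + i < length P \<and> P ! (off + i) = xs ! i)"

lemma code_at_simps [simp]:
  "code_at P off []"
  "code_at P off (x # xs) \<longleftrightarrow> off < length P \<and> P ! off = x \<and> code_at P (Suc off) xs"
  "code_at P off (xs @ ys) \<longleftrightarrow> code_at P off xs \<and> code_at P (off + length xs) ys"
proof -
  show "code_at P off (x # xs) \<longleftrightarrow> off < length P \<and> P ! off = x \<and> code_at P (Suc off) xs"
    unfolding code_at_def by (simp add: All_less_Suc2)
  show "code_at P off (xs @ ys) \<longleftrightarrow> code_at P off xs \<and> code_at P (off + length xs) ys"
  proof
    assume h: "code_at P off (xs @ ys)"
    show "code_at P off xs \<and> code_at P (off + length xs) ys"
      unfolding code_at_def
    proof (intro conjI allI impI)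
      fix i assume "i < length xs"
      with h[unfolded code_at_def, rule_format, of i] show "off + i < length P" "P ! (off + i) = xs ! i"
        by (simp_all add: nth_append)
    next
      fix i assume "i < length ys"
      with h[unfolded code_at_def, rule_format, of "length xs + i"]
      show "off + length xs + i < length P" "P ! (off + length xs + i) = ys ! i"
        by (simp_all add: nth_append add.assoc)
    qed
  next
    assume h: "code_at P off xs \<and> code_at P (off + length xs) ys"
    show "code_at P off (xs @ ys)"
      unfolding code_at_def
    proof (intro allI impI)
      fix i assume i: "i < length (xs @ ys)"
      show "off + i < length P \<and> P ! (off + i) = (xs @ ys) ! i"
      proof (cases "i < length xs")
        case True
        with h show ?thesis by (simp add: code_at_def nth_append)
      next
        case False
        with h[unfolded code_at_def, THEN conjunct2, rule_format, of "i - length xs"] i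
        show ?thesis by (simp add: nth_append)
      qed
    qed
  qed
qed (simp add: code_at_def)

lemma run_exec:
  assumes "pc cfg < length P" "P ! pc cfg = ins"
  shows "run w P (Suc t) cfg = bind_pmf (exec w ins cfg) (run w P t)"
  using assms by (simp add: step_def halted_def)

text \<open>The odd registers are scratch space and unconstrained. The clock is not compared here;
  it enters below through the number \<open>t - tm s\<close> of remaining machine steps.\<close>

definition matches :: "st \<Rightarrow> nat \<Rightarrow> config \<Rightarrow> bool" where
  "matches s off cfg \<longleftrightarrow> pc cfg = off \<and> (\<forall>x. regs cfg (2 * x) = vr s x) \<and> mem cfg = mm s"

lemma matches_tick [simp]: "matches (tick k s) off cfg = matches s off cfg"
  by (simp add: matches_def)

lemma even_neq_odd: "2 * (x::nat) \<noteq> Suc (2 * y)" "Suc (2 * y) \<noteq> 2 * x" "2 * x \<noteq> Suc (Suc (Suc (2 * y)))"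
  by presburger+

text \<open>At depth \<open>d\<close> the result lands in register \<open>2 * d + 1\<close> and the
  odd registers below survive, so a left operand outlives the evaluation of the right one.
  \<open>Or\<close> of a register with itself serves as the move instruction.\<close>

lemma run_ecode:
  assumes "code_at P off (ecode d e)" "matches s off cfg"
  shows "\<exists>cfg'. (\<forall>t. run w P (elen e + t) cfg = run w P t cfg') \<and> matches s (off + elen e) cfg' \<and>
     (\<forall>y<d. regs cfg' (2 * y + 1) = regs cfg (2 * y + 1)) \<and> regs cfg' (2 * d + 1) = aval w e s"
  using assms
proof (induction e arbitrary: d off cfg)
  case (Vr x)
  then show ?case
    by (intro exI[of _ "set_reg (2 * d + 1) (vr s x) cfg"])
      (auto simp: run_exec matches_def set_reg_def bind_return_pmf even_neq_odd simp del: run.simps(2))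
next
  case (Nm k)
  then show ?case
    by (intro exI[of _ "set_reg (2 * d + 1) (take_bit w k) cfg"])
      (auto simp: run_exec matches_def set_reg_def bind_return_pmf even_neq_odd simp del: run.simps(2))
next
  case (Bn f a b)
  from Bn.prems have c: "code_at P off (ecode d a)" "code_at P (off + elen a) (ecode (Suc d) b)"
    "off + elen a + elen b < length P"
    "P ! (off + elen a + elen b) = Op f (2 * d + 1) (2 * d + 1) (2 * d + 3)"
    by (simp_all add: add.assoc)
  obtain c1 where c1: "\<And>t. run w P (elen a + t) cfg = run w P t c1" "matches s (off + elen a) c1"
    "\<And>y. y < d \<Longrightarrow> regs c1 (2 * y + 1) = regs cfg (2 * y + 1)" "regs c1 (2 * d + 1) = aval w a s"
    using Bn.IH(1)[OF c(1) Bn.prems(2)] by metis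
  obtain c2 where c2: "\<And>t. run w P (elen b + t) c1 = run w P t c2" "matches s (off + elen a + elen b) c2"
    "\<And>y. y < Suc d \<Longrightarrow> regs c2 (2 * y + 1) = regs c1 (2 * y + 1)" "regs c2 (2 * Suc d + 1) = aval w b s"
    using Bn.IH(2)[OF c(2) c1(2)] by metis
  define v where "v = eval_op w f (aval w a s) (aval w b s)"
  have pc2: "pc c2 = off + elen a + elen b" using c2(2) by (simp add: matches_def)
  have r2: "regs c2 (2 * d + 1) = aval w a s" "regs c2 (2 * d + 3) = aval w b s"
    using c2(3)[of d] c1(4) c2(4) by (simp_all add: numeral_3_eq_3)
  have "run w P (elen (Bn f a b) + t) cfg = run w P t (set_reg (2 * d + 1) v c2)" for t
  proof -
    have "run w P (elen (Bn f a b) + t) cfg = run w P (elen a + (elen b + Suc t)) cfg" by (simp add: ac_simps)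
    also have "\<dots> = run w P (Suc t) c2" by (simp only: c1(1) c2(1))
    also have "\<dots> = run w P t (set_reg (2 * d + 1) v c2)"
      using run_exec[of c2 P _ w t] c(3,4) pc2 r2 by (simp add: bind_return_pmf v_def)
    finally show ?thesis .
  qed
  then show ?case
    using c2 c1 by (intro exI[of _ "set_reg (2 * d + 1) v c2"])
      (auto simp: matches_def set_reg_def even_neq_odd v_def)
next
  case (Ld a)
  from Ld.prems have c: "code_at P off (ecode d a)" "off + elen a < length P"
    "P ! (off + elen a) = Load (2 * d + 1) (2 * d + 1)"
    by simp_all
  obtain c1 where c1: "\<And>t. run w P (elen a + t) cfg = run w P t c1" "matches s (off + elen a) c1"
    "\<And>y. y < d \<Longrightarrow> regs c1 (2 * y + 1) = regs cfg (2 * y + 1)" "regs c1 (2 * d + 1) = aval w a s"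
    using Ld.IH[OF c(1) Ld.prems(2)] by metis
  define v where "v = mm s (aval w a s)"
  have pc1: "pc c1 = off + elen a" "mem c1 = mm s" using c1(2) by (simp_all add: matches_def)
  have "run w P (elen (Ld a) + t) cfg = run w P t (set_reg (2 * d + 1) v c1)" for t
  proof -
    have "run w P (elen (Ld a) + t) cfg = run w P (elen a + Suc t) cfg" by simp
    also have "\<dots> = run w P (Suc t) c1" by (simp only: c1(1))
    also have "\<dots> = run w P t (set_reg (2 * d + 1) v c1)"
      using run_exec[of c1 P _ w t] c(2,3) pc1 c1(4) by (simp add: bind_return_pmf v_def)
    finally show ?thesis .
  qed
  then show ?case
    using c1 by (intro exI[of _ "set_reg (2 * d + 1) v c1"])
      (auto simp: matches_def set_reg_def even_neq_odd v_def)
qed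

lemma run_eval:
  assumes "code_at P off (ecode d e)" "matches s off cfg" "tm s + elen e \<le> t"
  shows "\<exists>cfg'. run w P (t - tm s) cfg = run w P (t - (tm s + elen e)) cfg' \<and> matches s (off + elen e) cfg' \<and>
     (\<forall>y<d. regs cfg' (2 * y + 1) = regs cfg (2 * y + 1)) \<and> regs cfg' (2 * d + 1) = aval w e s"
proof -
  have "t - tm s = elen e + (t - (tm s + elen e))" using assms(3) by simp
  then show ?thesis using run_ecode[OF assms(1,2), of w] by metis
qed

lemma run_exec_det:
  assumes "pc cfg < length P" "exec w (P ! pc cfg) cfg = return_pmf cfg'" "u < t"
  shows "run w P (t - u) cfg = run w P (t - Suc u) cfg'"
proof -
  have "t - u = Suc (t - Suc u)" using assms(3) by simp
  then show ?thesis using run_exec[OF assms(1) refl, of w "t - Suc u"] assms(2)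
    by (simp add: bind_return_pmf del: run.simps)
qed

text \<open>The hypothesis \<open>body\<close> is the induction hypothesis of
  \<open>run_ccode\<close> for the loop body; isolating it here leaves a plain induction on the
  counter.\<close>

lemma run_loop:
  assumes body: "\<And>s cfg K. matches s (l + 3) cfg \<Longrightarrow> words w s \<Longrightarrow>
      (\<And>s'. s' \<in> set_pmf (sem w c s) \<Longrightarrow> tm s' \<le> t) \<Longrightarrow>
      (\<And>s' cfg'. s' \<in> set_pmf (sem w c s) \<Longrightarrow> matches s' (l + 3 + clen c) cfg' \<Longrightarrow>
        map_pmf obs (run w P (t - tm s') cfg') = K s') \<Longrightarrow>
      map_pmf obs (run w P (t - tm s) cfg) = bind_pmf (sem w c s) K"
    and P: "l + 4 + clen c < length P" "P ! l = Jump_Zero (2 * x) lend" "P ! (l + 1) = Const 1 1"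
      "P ! (l + 2) = Op Sub (2 * x) (2 * x) 1" "P ! (l + 3 + clen c) = Const 1 0"
      "P ! (l + 4 + clen c) = Jump_Zero 1 l"
    and x: "x \<notin> writes c"
    and "matches (asg x k s) l cfg" "words w s" "k < 2 ^ w"
    and "\<And>s'. s' \<in> set_pmf (loop x (sem w c) k s) \<Longrightarrow> tm s' \<le> t"
    and K: "\<And>s' cfg'. s' \<in> set_pmf (loop x (sem w c) k s) \<Longrightarrow> matches s' lend cfg' \<Longrightarrow>
        map_pmf obs (run w P (t - tm s') cfg') = K s'"
  shows "map_pmf obs (run w P (t - tm s) cfg) = bind_pmf (loop x (sem w c) k s) K"
  using assms(9-)
proof (induction k arbitrary: s cfg)
  case 0
  then have "pc cfg = l" "regs cfg (2 * x) = 0" by (auto simp: matches_def)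
  moreover have "matches (tick 1 (asg x 0 s)) lend (cfg\<lparr>pc := lend\<rparr>)"
    using 0(1) by (simp add: matches_def)
  moreover have "tm s < t" using 0(4) by force
  ultimately show ?case
    using run_exec_det[of cfg P w "cfg\<lparr>pc := lend\<rparr>" "tm s" t] P
      0(5)[of "tick 1 (asg x 0 s)" "cfg\<lparr>pc := lend\<rparr>"] by (simp add: bind_return_pmf)
next
  case (Suc k)
  note pre = Suc.prems
  have w: "w > 0" using pre(3) by (cases w) auto
  define s3 where "s3 = tick 3 (asg x k s)"
  obtain s1 where "s1 \<in> set_pmf (sem w c s3)" by (meson all_not_in_conv set_pmf_not_empty)
  \<comment> \<open>Even an exhausted loop takes one more step, so after the body there is time left
    for the two instructions of the back jump; \<open>run_exec_det\<close> needs a positive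
    remainder.\<close>
  have tm_body: "tm s1 + 2 < t" if "s1 \<in> set_pmf (sem w c s3)" for s1
  proof -
    obtain s' where s': "s' \<in> set_pmf (loop x (sem w c) k (tick 2 s1))"
      by (meson all_not_in_conv set_pmf_not_empty)
    have "s'' \<in> set_pmf (loop x (sem w c) k s) \<Longrightarrow> tm s < tm s''" for s s''
      by (induction k arbitrary: s) (fastforce dest: sem_tm_mono)+
    from this[OF s'] have "tm s1 + 2 < tm s'" by simp
    also have "tm s' \<le> t" using pre(4) that s' s3_def by auto
    finally show ?thesis .
  qed
  then have tms: "tm s + 3 < t"
    using sem_tm_mono[OF \<open>s1 \<in> _\<close>] \<open>s1 \<in> _\<close> unfolding s3_def by fastforce
  define c1 where "c1 = cfg\<lparr>pc := l + 1\<rparr>"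
  define c2 where "c2 = set_reg 1 1 c1"
  define c3 where "c3 = set_reg (2 * x) k c2"
  have cfg: "pc cfg = l" "regs cfg (2 * x) = Suc k" "mem cfg = mm s"
    "\<And>y. y \<noteq> x \<Longrightarrow> regs cfg (2 * y) = vr s y"
    using pre(1) by (auto simp: matches_def)
  have "run w P (t - tm s) cfg = run w P (t - Suc (tm s)) c1"
    by (rule run_exec_det) (use cfg P tms in \<open>auto simp: c1_def\<close>)
  also have "\<dots> = run w P (t - Suc (Suc (tm s))) c2"
  proof (rule run_exec_det)
    have "take_bit w (Suc 0) = Suc 0" using w by (simp add: take_bit_nat_eq_self_iff)
    then show "exec w (P ! pc c1) c1 = return_pmf c2"
      using P cfg by (simp add: c1_def c2_def)
  qed (use P tms in \<open>auto simp: c1_def\<close>)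
  also have "\<dots> = run w P (t - Suc (Suc (Suc (tm s)))) c3"
  proof (rule run_exec_det)
    have "take_bit w (k + 2 ^ w) = k" using pre(3) by (simp add: take_bit_eq_mod)
    moreover have "2 * x \<noteq> Suc 0" by presburger
    ultimately show "exec w (P ! pc c2) c2 = return_pmf c3"
      using P cfg by (simp add: c1_def c2_def c3_def set_reg_def numeral_2_eq_2)
  qed (use P tms in \<open>auto simp: c1_def c2_def set_reg_def\<close>)
  finally have r3: "run w P (t - tm s) cfg = run w P (t - tm s3) c3"
    by (simp add: s3_def numeral_3_eq_3)
  have m3: "matches s3 (l + 3) c3"
    using cfg even_neq_odd(1)[of _ 0] by (auto simp: matches_def c1_def c2_def c3_def set_reg_def s3_def)
  have "map_pmf obs (run w P (t - tm s3) c3)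
      = bind_pmf (sem w c s3) (\<lambda>s1. bind_pmf (loop x (sem w c) k (tick 2 s1)) K)"
  proof (rule body[OF m3])
    show "words w s3" using pre(2,3) by (simp add: s3_def)
  next
    show "tm s' \<le> t" if "s' \<in> set_pmf (sem w c s3)" for s' using tm_body[OF that] by simp
  next
    fix s1 cfg1 assume s1: "s1 \<in> set_pmf (sem w c s3)" and m1: "matches s1 (l + 3 + clen c) cfg1"
    have xk: "vr s1 x = k" using sem_frame[OF s1 x] by (simp add: s3_def)
    define c4 where "c4 = set_reg 1 0 cfg1"
    define c5 where "c5 = c4\<lparr>pc := l\<rparr>"
    have "run w P (t - tm s1) cfg1 = run w P (t - Suc (tm s1)) c4"
      by (rule run_exec_det) (use m1 P tm_body[OF s1] in \<open>auto simp: matches_def c4_def\<close>)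
    also have "\<dots> = run w P (t - Suc (Suc (tm s1))) c5"
      by (rule run_exec_det)
        (use m1 P tm_body[OF s1] in \<open>auto simp: matches_def c4_def c5_def set_reg_def add.assoc eval_nat_numeral\<close>)
    finally have r5: "run w P (t - tm s1) cfg1 = run w P (t - tm (tick 2 s1)) c5" by simp
    have m5: "matches (asg x k (tick 2 s1)) l c5"
      using m1 xk even_neq_odd(1)[of _ 0] by (auto simp: matches_def c4_def c5_def set_reg_def)
    show "map_pmf obs (run w P (t - tm s1) cfg1) = bind_pmf (loop x (sem w c) k (tick 2 s1)) K"
      unfolding r5
    proof (rule Suc.IH[OF m5])
      show "words w (tick 2 s1)" using sem_words[OF s1] pre(2,3) by (simp add: s3_def)
    qed (use pre s1 s3_def in auto)
  qed
  then show ?case unfolding r3 by (simp add: bind_assoc_pmf s3_def)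
qed

text \<open>Continuation form: the total number \<open>t\<close> of steps is fixed, and
  \<open>K s'\<close> is what the remaining \<open>t - tm s'\<close> steps yield once the code has
  ended in \<open>s'\<close>. Random runs use different amounts of time, and in this form they still
  compose directly.\<close>

lemma run_ccode:
  assumes "code_at P off (ccode off c)" "wfc c" "matches s off cfg" "words w s"
    and "\<And>s'. s' \<in> set_pmf (sem w c s) \<Longrightarrow> tm s' \<le> t"
    and "\<And>s' cfg'. s' \<in> set_pmf (sem w c s) \<Longrightarrow> matches s' (off + clen c) cfg' \<Longrightarrow>
        map_pmf obs (run w P (t - tm s') cfg') = K s'"
  shows "map_pmf obs (run w P (t - tm s) cfg) = bind_pmf (sem w c s) K"
  using assms
proof (induction c arbitrary: off s cfg K)
  case Skip
  then show ?case by (simp add: bind_return_pmf)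
next
  case (Asg x e)
  define s' where "s' = tick (elen e + 1) (asg x (aval w e s) s)"
  have t: "tm s + elen e < t" using Asg.prems(5)[of s'] by (simp add: s'_def)
  then obtain c1 where c1: "run w P (t - tm s) cfg = run w P (t - (tm s + elen e)) c1"
      "matches s (off + elen e) c1" "regs c1 1 = aval w e s"
    using run_eval[of P off 0 e s cfg t w] Asg.prems by auto
  have "run w P (t - (tm s + elen e)) c1 = run w P (t - Suc (tm s + elen e)) (set_reg (2 * x) (aval w e s) c1)"
    by (rule run_exec_det) (use c1 Asg.prems t in \<open>auto simp: matches_def\<close>)
  moreover have "matches s' (off + elen e + 1) (set_reg (2 * x) (aval w e s) c1)"
    using c1 by (auto simp: matches_def set_reg_def s'_def)
  ultimately show ?case
    using Asg.prems(6)[of s' "set_reg (2 * x) (aval w e s) c1"] c1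
    by (simp add: s'_def bind_return_pmf add.assoc)
next
  case (Sto a e)
  define s' where "s' = tick (elen a + elen e + 1) (sto (aval w a s) (aval w e s) s)"
  have t: "tm s + elen a + elen e < t" using Sto.prems(5)[of s'] by (simp add: s'_def)
  then obtain c1 where c1: "run w P (t - tm s) cfg = run w P (t - (tm s + elen a)) c1"
      "matches s (off + elen a) c1" "regs c1 1 = aval w a s"
    using run_eval[of P off 0 a s cfg t w] Sto.prems by auto
  define sa where "sa = tick (elen a) s"
  have av: "aval w e sa = aval w e s" by (induction e) (simp_all add: sa_def)
  have "code_at P (off + elen a) (ecode 1 e)" "matches sa (off + elen a) c1" "tm sa + elen e \<le> t"
    using Sto.prems(1) c1 t by (simp_all add: sa_def)
  from run_eval[OF this, of w] obtain c2 where "run w P (t - tm sa) c1 = run w P (t - (tm sa + elen e)) c2"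
      "matches sa (off + elen a + elen e) c2" "regs c2 1 = regs c1 1" "regs c2 3 = aval w e sa"
    by (auto simp: eval_nat_numeral)
  then have c2: "run w P (t - (tm s + elen a)) c1 = run w P (t - (tm s + elen a + elen e)) c2"
      "matches s (off + elen a + elen e) c2" "regs c2 1 = aval w a s" "regs c2 3 = aval w e s"
    using c1(3) av by (simp_all add: sa_def)
  have "run w P (t - (tm s + elen a + elen e)) c2 = run w P (t - Suc (tm s + elen a + elen e))
     (c2\<lparr>pc := Suc (pc c2), mem := (mem c2)(aval w a s := aval w e s)\<rparr>)" (is "_ = run w P _ ?c")
    by (rule run_exec_det) (use c2 Sto.prems t in \<open>auto simp: matches_def add.assoc\<close>)
  moreover have "matches s' (off + elen a + elen e + 1) ?c"
    using c2 by (auto simp: matches_def s'_def)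
  ultimately show ?case
    using Sto.prems(6)[of s' ?c] c1 c2
    by (simp add: s'_def bind_return_pmf add.assoc)
next
  case (Rnd x)
  have t: "tm s < t"
    using Rnd.prems(5)[of "tick 1 (asg x 0 s)"] by (auto simp: set_pmf_of_set lessThan_empty_iff)
  then have "t - tm s = Suc (t - Suc (tm s))" by simp
  then have r: "run w P (t - tm s) cfg
      = bind_pmf (exec w (Rand (2 * x)) cfg) (run w P (t - Suc (tm s)))"
    using run_exec[of cfg P "Rand (2 * x)" w "t - Suc (tm s)"] Rnd.prems(1,3) by (simp add: matches_def)
  have "map_pmf obs (run w P (t - Suc (tm s)) (set_reg (2 * x) v cfg)) = K (tick 1 (asg x v s))"
    if "v \<in> {..<2 ^ w}" for v
    using Rnd.prems(6)[of "tick 1 (asg x v s)" "set_reg (2 * x) v cfg"] Rnd.prems(3) that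
    by (auto simp: set_pmf_of_set lessThan_empty_iff matches_def set_reg_def)
  then show ?case unfolding r
    by (auto simp: map_bind_pmf bind_map_pmf set_pmf_of_set lessThan_empty_iff intro!: bind_pmf_cong)
next
  case (Seq c d)
  show ?case
    unfolding sem.simps bind_assoc_pmf
  proof (rule Seq.IH(1)[OF _ _ Seq.prems(3,4)])
    fix s1 cfg1 assume s1: "s1 \<in> set_pmf (sem w c s)" and m: "matches s1 (off + clen c) cfg1"
    show "map_pmf obs (run w P (t - tm s1) cfg1) = bind_pmf (sem w d s1) K"
      by (rule Seq.IH(2)[OF _ _ m]) (use Seq.prems s1 sem_words[OF s1] in \<open>auto simp: add.assoc\<close>)
  next
    fix s1 assume s1: "s1 \<in> set_pmf (sem w c s)"
    obtain s2 where "s2 \<in> set_pmf (sem w d s1)" by (meson all_not_in_conv set_pmf_not_empty)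
    then show "tm s1 \<le> t" using s1 Seq.prems(5)[of s2] sem_tm_mono[of s2 w d s1] by force
  qed (use Seq.prems in auto)
next
  case (Ite e c d)
  define s1 where "s1 = tick (elen e + 1) s"
  have t: "tm s + elen e < t"
  proof -
    obtain s' where s': "s' \<in> set_pmf (sem w (Ite e c d) s)" by (meson all_not_in_conv set_pmf_not_empty)
    then have "tm s1 \<le> tm s'" using sem_tm_mono[of _ w _ s1] by (fastforce simp: s1_def split: if_splits)
    then show ?thesis using Ite.prems(5)[OF s'] by (simp add: s1_def)
  qed
  then obtain c1 where c1: "run w P (t - tm s) cfg = run w P (t - (tm s + elen e)) c1"
      "matches s (off + elen e) c1" "regs c1 1 = aval w e s"
    using run_eval[of P off 0 e s cfg t w] Ite.prems by auto
  show ?case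
  proof (cases "aval w e s = 0")
    case True
    define c2 where "c2 = c1\<lparr>pc := off + elen e + clen c + 3\<rparr>"
    have r: "run w P (t - (tm s + elen e)) c1 = run w P (t - Suc (tm s + elen e)) c2"
      by (rule run_exec_det) (use c1 Ite.prems t True in \<open>auto simp: matches_def c2_def\<close>)
    have m: "matches s1 (off + elen e + clen c + 3) c2" using c1 by (simp add: matches_def s1_def c2_def)
    have "map_pmf obs (run w P (t - tm s1) c2) = bind_pmf (sem w d s1) K"
      by (rule Ite.IH(2)[OF _ _ m]) (use Ite.prems True in \<open>auto simp: s1_def ac_simps eval_nat_numeral\<close>)
    then show ?thesis using True c1 r by (simp add: s1_def)
  next
    case False
    define c2 where "c2 = c1\<lparr>pc := off + elen e + 1\<rparr>"
    have r: "run w P (t - (tm s + elen e)) c1 = run w P (t - Suc (tm s + elen e)) c2"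
      by (rule run_exec_det) (use c1 Ite.prems t False in \<open>auto simp: matches_def c2_def\<close>)
    have m: "matches s1 (off + elen e + 1) c2" using c1 by (simp add: matches_def s1_def c2_def)
    have ts: "tm s2 + 2 \<le> t" if "s2 \<in> set_pmf (sem w c s1)" for s2
      using Ite.prems(5)[of "tick 2 s2"] that False by (simp add: s1_def)
    have "map_pmf obs (run w P (t - tm s1) c2) = bind_pmf (sem w c s1) (\<lambda>s2. K (tick 2 s2))"
    proof (rule Ite.IH(1)[OF _ _ m])
      fix s2 cfg2 assume s2: "s2 \<in> set_pmf (sem w c s1)" and m2: "matches s2 (off + elen e + 1 + clen c) cfg2"
      define c4 where "c4 = set_reg 1 0 cfg2"
      define c5 where "c5 = c4\<lparr>pc := off + elen e + clen c + clen d + 3\<rparr>"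
      have "run w P (t - tm s2) cfg2 = run w P (t - Suc (tm s2)) c4"
        by (rule run_exec_det)
          (use m2 Ite.prems ts[OF s2] in \<open>auto simp: matches_def c4_def ac_simps\<close>)
      also have "\<dots> = run w P (t - Suc (Suc (tm s2))) c5"
        by (rule run_exec_det)
          (use m2 Ite.prems ts[OF s2] in \<open>auto simp: matches_def c4_def c5_def set_reg_def ac_simps\<close>)
      finally have r5: "run w P (t - tm s2) cfg2 = run w P (t - tm (tick 2 s2)) c5" by simp
      have m5: "matches (tick 2 s2) (off + clen (Ite e c d)) c5"
        using m2 even_neq_odd(1)[of _ 0] by (auto simp: matches_def c4_def c5_def set_reg_def)
      show "map_pmf obs (run w P (t - tm s2) cfg2) = K (tick 2 s2)"
        unfolding r5 by (rule Ite.prems(6)) (use m5 s2 False s1_def in auto)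
    next
      fix s2 assume "s2 \<in> set_pmf (sem w c s1)"
      from ts[OF this] show "tm s2 \<le> t" by simp
    qed (use Ite.prems in \<open>auto simp: s1_def\<close>)
    then show ?thesis using False c1 r by (simp add: s1_def bind_map_pmf)
  qed
next
  case (For x e c)
  define s1 where "s1 = tick (elen e + 1) s"
  have t: "tm s + elen e < t"
  proof -
    obtain s' where s': "s' \<in> set_pmf (sem w (For x e c) s)" by (meson all_not_in_conv set_pmf_not_empty)
    have "s'' \<in> set_pmf (loop x (sem w c) k s) \<Longrightarrow> tm s \<le> tm s''" for k s s''
      by (induction k arbitrary: s) (fastforce dest: sem_tm_mono)+
    from this[of s' "aval w e s" s1] s' have "tm s1 \<le> tm s'" by (simp add: s1_def)
    then show ?thesis using For.prems(5)[OF s'] by (simp add: s1_def)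
  qed
  then obtain c1 where c1: "run w P (t - tm s) cfg = run w P (t - (tm s + elen e)) c1"
      "matches s (off + elen e) c1" "regs c1 1 = aval w e s"
    using run_eval[of P off 0 e s cfg t w] For.prems by auto
  define c2 where "c2 = set_reg (2 * x) (aval w e s) c1"
  have r: "run w P (t - (tm s + elen e)) c1 = run w P (t - Suc (tm s + elen e)) c2"
    by (rule run_exec_det) (use c1 For.prems t in \<open>auto simp: matches_def c2_def\<close>)
  have m: "matches (asg x (aval w e s) s1) (off + elen e + 1) c2"
    using c1 by (auto simp: matches_def s1_def c2_def set_reg_def)
  have "map_pmf obs (run w P (t - tm s1) c2) = bind_pmf (loop x (sem w c) (aval w e s) s1) K"
  proof (rule run_loop[where l = "off + elen e + 1" and lend = "off + clen (For x e c)"])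
    fix s cfg K'
    assume "matches s (off + elen e + 1 + 3) cfg" "words w s" "\<And>s'. s' \<in> set_pmf (sem w c s) \<Longrightarrow> tm s' \<le> t"
      "\<And>s' cfg'. s' \<in> set_pmf (sem w c s) \<Longrightarrow> matches s' (off + elen e + 1 + 3 + clen c) cfg' \<Longrightarrow>
        map_pmf obs (run w P (t - tm s') cfg') = K' s'"
    then show "map_pmf obs (run w P (t - tm s) cfg) = bind_pmf (sem w c s) K'"
      by (intro For.IH[of "off + elen e + 4"]) (use For.prems in \<open>auto simp: ac_simps eval_nat_numeral\<close>)
  next
    show "words w s1" "aval w e s < 2 ^ w" using For.prems aval_less by (auto simp: s1_def)
  next
    show "matches (asg x (aval w e s) s1) (off + elen e + 1) c2" by fact
  qed (use For.prems in \<open>auto simp: s1_def ac_simps eval_nat_numeral\<close>)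
  then show ?case using c1 r by (simp add: s1_def)
qed

text \<open>A halted machine stays put, so \<open>t\<close> may be any bound on the clock and runs
  of different length are all observed at the same time.\<close>

theorem run_compiled:
  assumes "wfc c" "words w s" "tm s = 0" "pc cfg = 0" "\<And>x. regs cfg (2 * x) = vr s x" "mem cfg = mm s"
    and "\<And>s'. s' \<in> set_pmf (sem w c s) \<Longrightarrow> tm s' \<le> t"
  shows "map_pmf (\<lambda>cfg. (pc cfg, regs cfg 0)) (run w (ccode 0 c) t cfg)
       = map_pmf (\<lambda>s. (clen c, vr s 0)) (sem w c s)"
proof -
  have h: "run w (ccode 0 c) k cfg' = return_pmf cfg'" if "pc cfg' = clen c" for k cfg'
    using that by (induction k) (auto simp: step_def halted_def bind_return_pmf)
  have "map_pmf (\<lambda>cfg. (pc cfg, regs cfg 0)) (run w (ccode 0 c) (t - tm s) cfg)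
      = bind_pmf (sem w c s) (\<lambda>s. return_pmf (clen c, vr s 0))"
    by (rule run_ccode[where off = 0])
      (use assms in \<open>auto simp: code_at_def matches_def h\<close>, metis mult_0_right)
  then show ?thesis using assms(3) by (simp add: map_pmf_def)
qed

section \<open>Random splitting into blocks\<close>

text \<open>Every residue has exactly \<open>2 ^ (w - b)\<close> preimages. This is why all random
  choices of the reduction are made modulo powers of two: they are exactly uniform, without
  rejection.\<close>

lemma map_mod_pmf_of_set:
  assumes "b \<le> w"
  shows "map_pmf (\<lambda>v. v mod 2 ^ b) (pmf_of_set {..<2 ^ w}) = pmf_of_set {..<2 ^ b :: nat}"
proof (rule pmf_eqI)
  fix i :: nat
  have pw: "(2::nat) ^ w = 2 ^ (w - b) * 2 ^ b" using assms by (simp flip: power_add)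
  have "card ({..<2 ^ w} \<inter> (\<lambda>v. v mod 2 ^ b) -` {i}) = (if i < 2 ^ b then 2 ^ (w - b) else 0)"
  proof (cases "i < 2 ^ b")
    case True
    have "bij_betw (\<lambda>h. h * 2 ^ b + i) {..<2 ^ (w - b)} ({..<2 ^ w} \<inter> (\<lambda>v. v mod 2 ^ b) -` {i})"
    proof (rule bij_betw_byWitness[where f' = "\<lambda>v. v div 2 ^ b"])
      show "(\<lambda>h. h * 2 ^ b + i) ` {..<2 ^ (w - b)} \<subseteq> {..<2 ^ w} \<inter> (\<lambda>v. v mod 2 ^ b) -` {i}"
      proof
        fix v assume "v \<in> (\<lambda>h. h * 2 ^ b + i) ` {..<2 ^ (w - b)}"
        then obtain h where h: "h < 2 ^ (w - b)" "v = h * 2 ^ b + i" by auto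
        then have "Suc h \<le> 2 ^ (w - b)" by simp
        then have "Suc h * 2 ^ b \<le> 2 ^ w" unfolding pw by (rule mult_right_mono) simp
        then show "v \<in> {..<2 ^ w} \<inter> (\<lambda>v. v mod 2 ^ b) -` {i}" using True h by simp
      qed
    qed (use True in \<open>auto simp: pw less_mult_imp_div_less div_mult_mod_eq\<close>)
    then show ?thesis using True by (simp add: bij_betw_same_card[symmetric])
  next
    case False
    then have "v mod 2 ^ b \<noteq> i" for v by (meson mod_less_divisor pos2 zero_less_power)
    then have "{..<2 ^ w} \<inter> (\<lambda>v. v mod 2 ^ b) -` {i} = {}" by auto
    with False show ?thesis by simp
  qed
  then show "pmf (map_pmf (\<lambda>v. v mod 2 ^ b) (pmf_of_set {..<2 ^ w})) i = pmf (pmf_of_set {..<2 ^ b}) i"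
    by (simp add: pmf_map measure_pmf_of_set lessThan_empty_iff pmf_of_set pw indicator_def)
qed

text \<open>Two positions in the same block differ by some nonzero \<open>d\<close> with \<open>\<bar>d\<bar> < L\<close>, and
  \<open>a * d \<equiv> x - y\<close>. For odd \<open>a\<close> this forces \<open>d\<close> and \<open>x - y\<close> to have the same 2-adic valuation
  \<open>s\<close>: there are at most \<open>2 * L / 2 ^ s\<close> such \<open>d\<close>, each compatible with at most \<open>2 ^ s\<close>
  multipliers.\<close>

definition colliding :: "nat \<Rightarrow> nat \<Rightarrow> nat \<Rightarrow> nat \<Rightarrow> nat set" where
  "colliding p L x y = {a. a < p \<and> odd a \<and>
     (\<exists>P Q. P < p \<and> Q < p \<and> P div L = Q div L \<and> a * P mod p = x \<and> a * Q mod p = y)}"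

text \<open>Writing \<open>d = 2 ^ s * d'\<close> with \<open>d'\<close> odd, the congruence
  determines \<open>a\<close> modulo \<open>2 ^ (\<kappa> - s)\<close>; the quotient by that modulus
  takes at most \<open>2 ^ s\<close> values.\<close>

lemma card_solutions:
  fixes d :: int
  assumes "s \<le> \<kappa>" "2 ^ s dvd d" "\<not> 2 ^ Suc s dvd d"
  shows "card {a. a < 2 ^ \<kappa> \<and> [int a * d = \<delta>] (mod 2 ^ \<kappa>)} \<le> 2 ^ s" (is "card ?A \<le> _")
proof -
  define r where "r = (2::nat) ^ (\<kappa> - s)"
  have pk: "(2::nat) ^ \<kappa> = 2 ^ s * r" using assms(1) by (simp add: r_def flip: power_add)
  have "inj_on (\<lambda>a. a div r) ?A"
  proof (rule inj_onI)
    fix a b assume h: "a \<in> ?A" "b \<in> ?A" "a div r = b div r"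
    obtain d' where d': "d = 2 ^ s * d'" using assms(2) by blast
    then have odd: "coprime (2 ^ (\<kappa> - s)) d'" using assms(3) by (auto simp: mult.commute)
    have "[int a * d = int b * d] (mod 2 ^ \<kappa>)"
      using h by (auto intro: cong_trans cong_sym)
    then have "2 ^ \<kappa> dvd (int a - int b) * d" by (simp add: cong_iff_dvd_diff left_diff_distrib)
    moreover have "(2::int) ^ \<kappa> = 2 ^ s * 2 ^ (\<kappa> - s)" using assms(1) by (simp flip: power_add)
    ultimately have "2 ^ (\<kappa> - s) dvd (int a - int b) * d'" unfolding d' by (simp add: mult.left_commute)
    then have "2 ^ (\<kappa> - s) dvd int a - int b" using odd by (simp add: coprime_dvd_mult_left_iff)
    then have "[int a = int b] (mod int r)" by (simp add: cong_iff_dvd_diff r_def)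
    then have "[a = b] (mod r)" by (simp only: cong_int_iff)
    then have "a mod r = b mod r" by (simp add: cong_def)
    with h(3) show "a = b" by (metis div_mult_mod_eq)
  qed
  moreover have "(\<lambda>a. a div r) ` ?A \<subseteq> {..<2 ^ s}"
    using pk by (auto simp: less_mult_imp_div_less)
  ultimately have "card ?A \<le> card {..<2 ^ s :: nat}" by (rule card_inj_on_le) simp
  then show ?thesis by simp
qed

lemma card_multiples: "card {d::int. \<bar>d\<bar> < int L \<and> d \<noteq> 0 \<and> 2 ^ s dvd d} * 2 ^ s \<le> 2 * L"
proof -
  define N where "N = int L div 2 ^ s"
  have N: "N \<ge> 0" by (simp add: N_def pos_imp_zdiv_nonneg_iff)
  have "{d::int. \<bar>d\<bar> < int L \<and> d \<noteq> 0 \<and> 2 ^ s dvd d} \<subseteq> (\<lambda>e. 2 ^ s * e) ` ({-N..N} - {0})"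
  proof
    fix d assume "d \<in> {d::int. \<bar>d\<bar> < int L \<and> d \<noteq> 0 \<and> 2 ^ s dvd d}"
    then obtain e where e: "d = 2 ^ s * e" "\<bar>d\<bar> < int L" "d \<noteq> 0" by blast
    have "\<bar>e\<bar> * 2 ^ s \<le> int L" using e by (simp add: abs_mult mult.commute)
    then have "\<bar>e\<bar> \<le> N" unfolding N_def by (simp add: zdiv_mono1[of "\<bar>e\<bar> * 2 ^ s" "int L" "2 ^ s", simplified])
    then show "d \<in> (\<lambda>e. 2 ^ s * e) ` ({-N..N} - {0})" using e by (auto simp: image_iff)
  qed
  then have "card {d::int. \<bar>d\<bar> < int L \<and> d \<noteq> 0 \<and> 2 ^ s dvd d} \<le> card ({-N..N} - {0})"
    by (rule surj_card_le[rotated]) simp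
  also have "\<dots> = nat (2 * N)" using N by (simp add: card_Diff_singleton_if nat_diff_distrib')
  finally have "card {d::int. \<bar>d\<bar> < int L \<and> d \<noteq> 0 \<and> 2 ^ s dvd d} * 2 ^ s \<le> nat (2 * N) * 2 ^ s"
    by simp
  also have "\<dots> \<le> 2 * L"
  proof -
    have "2 * N * 2 ^ s \<le> 2 * int L"     proof -
      have "int L mod 2 ^ s \<ge> 0" by simp
      then have "int L div 2 ^ s * 2 ^ s \<le> int L" using minus_mod_eq_div_mult[of "int L" "2 ^ s"] by linarith
      then show ?thesis by (simp add: N_def)
    qed
    then have "int (nat (2 * N) * 2 ^ s) \<le> int (2 * L)" using N by simp
    then show ?thesis by linarith
  qed
  finally show ?thesis .
qed

lemma card_colliding:
  assumes "x < 2 ^ \<kappa>" "y < 2 ^ \<kappa>" "x \<noteq> y" and L: "L > 0"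
  shows "card (colliding (2 ^ \<kappa>) L x y) \<le> 2 * L"
proof -
  define \<delta> where "\<delta> = int x - int y"
  define s where "s = multiplicity 2 \<delta>"
  have "int x < 2 ^ \<kappa>" "int y < 2 ^ \<kappa>"
    using assms(1,2) of_nat_less_iff[of _ "2 ^ \<kappa>", where ?'a = int] by simp_all
  then have \<delta>: "\<delta> \<noteq> 0" "\<bar>\<delta>\<bar> < 2 ^ \<kappa>"
    using assms(3) unfolding \<delta>_def by linarith+
  have s: "2 ^ s dvd \<delta>" "\<not> 2 ^ Suc s dvd \<delta>"
    by (simp add: s_def multiplicity_dvd) (subst power_dvd_iff_le_multiplicity, use \<delta> in \<open>auto simp: s_def\<close>)
  \<comment> \<open>Since \<open>\<delta>\<close> is nonzero and smaller than the modulus, its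
    valuation is below \<open>\<kappa>\<close>, so a congruence modulo \<open>2 ^ \<kappa>\<close>
    can still test divisibility by \<open>2 ^ Suc s\<close>.\<close>
  have s\<kappa>: "Suc s \<le> \<kappa>"
  proof (rule ccontr)
    assume "\<not> Suc s \<le> \<kappa>"
    then have "2 ^ \<kappa> dvd \<delta>" using s(1) by (meson dvd_trans le_imp_power_dvd not_less_eq_eq)
    then show False using \<delta> zdvd_imp_le[of "2 ^ \<kappa>" "\<bar>\<delta>\<bar>"] by auto
  qed
  define Ds where "Ds = {d::int. \<bar>d\<bar> < int L \<and> d \<noteq> 0 \<and> 2 ^ s dvd d}"
  define Ds' where "Ds' = {d \<in> Ds. \<not> 2 ^ Suc s dvd d}"
  define As where "As d = {a. a < 2 ^ \<kappa> \<and> [int a * d = \<delta>] (mod 2 ^ \<kappa>)}" for d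
  have finD: "finite Ds" by (rule finite_subset[of _ "{-int L..int L}"]) (auto simp: Ds_def)
  then have finD': "finite Ds'" by (simp add: Ds'_def)
  have "colliding (2 ^ \<kappa>) L x y \<subseteq> (\<Union>d\<in>Ds'. As d)"
  proof
    fix a assume "a \<in> colliding (2 ^ \<kappa>) L x y"
    then obtain P Q where a: "a < 2 ^ \<kappa>" "odd a" and PQ: "P div L = Q div L"
      "a * P mod 2 ^ \<kappa> = x" "a * Q mod 2 ^ \<kappa> = y" by (auto simp: colliding_def)
    define d where "d = int P - int Q"
    have "[int (a * P) = int x] (mod 2 ^ \<kappa>)" "[int (a * Q) = int y] (mod 2 ^ \<kappa>)"
      using PQ(2,3) by (auto simp: cong_def zmod_int)
    then have c: "[int a * d = \<delta>] (mod 2 ^ \<kappa>)"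
      unfolding d_def \<delta>_def right_diff_distrib by (simp add: cong_diff)
    \<comment> \<open>An odd \<open>a\<close> is a unit modulo \<open>2 ^ j\<close>, so multiplying
      by it does not change divisibility by \<open>2 ^ j\<close>.\<close>
    have dv: "2 ^ j dvd d \<longleftrightarrow> 2 ^ j dvd \<delta>" if "j \<le> \<kappa>" for j
    proof -
      have "[int a * d = \<delta>] (mod 2 ^ j)" using c that by (meson cong_dvd_modulus le_imp_power_dvd)
      then have "2 ^ j dvd int a * d \<longleftrightarrow> 2 ^ j dvd \<delta>" by (rule cong_dvd_iff)
      moreover have "coprime (2 ^ j) (int a)" using a(2) by simp
      ultimately show ?thesis by (simp add: coprime_dvd_mult_right_iff)
    qed
    have "\<bar>d\<bar> < int L"
    proof -
      have "P div L * L + P mod L = P" by (rule div_mult_mod_eq)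
      moreover have "P div L * L + Q mod L = Q" unfolding PQ(1) by (rule div_mult_mod_eq)
      moreover have "P mod L < L" "Q mod L < L" using L by simp_all
      ultimately show ?thesis unfolding d_def by linarith
    qed
    then have "d \<in> Ds'"
      using dv[of s] dv[of "Suc s"] s s\<kappa> by (auto simp: Ds_def Ds'_def)
    then show "a \<in> (\<Union>d\<in>Ds'. As d)" using a c by (auto simp: As_def)
  qed
  then have "card (colliding (2 ^ \<kappa>) L x y) \<le> card (\<Union>d\<in>Ds'. As d)"
    by (rule card_mono[rotated]) (auto simp: finD' As_def)
  also have "\<dots> \<le> (\<Sum>d\<in>Ds'. card (As d))" by (rule card_UN_le[OF finD'])
  also have "\<dots> \<le> (\<Sum>d\<in>Ds'. 2 ^ s)"
    by (rule sum_mono) (use s\<kappa> card_solutions[of s \<kappa>] in \<open>auto simp: As_def Ds'_def Ds_def\<close>)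
  also have "\<dots> \<le> card Ds * 2 ^ s"
    using card_mono[OF finD, of Ds'] by (auto simp: Ds'_def)
  also have "\<dots> \<le> 2 * L" unfolding Ds_def by (rule card_multiples)
  finally show ?thesis .
qed

lemma inj_mult_mod:
  assumes "odd (a::nat)" shows "inj_on (\<lambda>P. a * P mod 2 ^ \<kappa>) {..<2 ^ \<kappa>}"
proof (rule inj_onI)
  fix P Q assume h: "P \<in> {..<2 ^ \<kappa>}" "Q \<in> {..<2 ^ \<kappa>}" "a * P mod 2 ^ \<kappa> = a * Q mod 2 ^ \<kappa>"
  then have "[a * P = a * Q] (mod 2 ^ \<kappa>)" by (simp add: cong_def)
  then have "[P = Q] (mod 2 ^ \<kappa>)" using assms by (simp add: cong_mult_lcancel_nat coprime_commute)
  then show "P = Q" using h by (simp add: cong_def)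
qed

lemma ex_position:
  assumes "odd (a::nat)" "x < 2 ^ \<kappa>" shows "\<exists>P<2 ^ \<kappa>. a * P mod 2 ^ \<kappa> = x"
proof -
  have "(\<lambda>P. a * P mod 2 ^ \<kappa>) ` {..<2 ^ \<kappa>} = {..<2 ^ \<kappa>}"
    by (rule card_subset_eq) (auto simp: card_image[OF inj_mult_mod[OF assms(1)]])
  then show ?thesis using assms(2) by (metis (no_types, lifting) image_iff lessThan_iff)
qed

section \<open>Pieces\<close>

text \<open>\<open>pvert\<close> is the vertex with index \<open>u\<close> in the piece made of the blocks \<open>i\<close>, \<open>j\<close>, \<open>k\<close>; indices
  that name no vertex of the graph are isolated in the piece.\<close>

definition pvert :: "nat \<Rightarrow> nat \<Rightarrow> nat \<Rightarrow> nat \<times> nat \<times> nat \<Rightarrow> nat \<Rightarrow> nat" where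
  "pvert p L a = (\<lambda>(i, j, k) u.
     a * ((if u div L = 0 then i else if u div L = 1 then j else if u div L = 2 then k else 0) * L
       + u mod L) mod p)"

definition pvalid :: "nat \<Rightarrow> nat \<Rightarrow> nat \<Rightarrow> nat \<Rightarrow> nat \<times> nat \<times> nat \<Rightarrow> nat \<Rightarrow> bool" where
  "pvalid n p L a b u \<longleftrightarrow> u < 3 * L \<and> pvert p L a b u < n"

text \<open>The vertex set has size \<open>m\<close>, not \<open>3 * L\<close>: the given algorithm
  is to be run on inputs for which its time bound is \<open>T m\<close>, and nothing relates this to
  other values of \<open>T\<close>.\<close>

definition piece :: "nat graph \<Rightarrow> nat \<Rightarrow> nat \<Rightarrow> nat \<Rightarrow> nat \<Rightarrow> nat \<Rightarrow> nat \<times> nat \<times> nat \<Rightarrow> nat graph" where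
  "piece G n m p L a b = \<lparr>verts = {..<m}, edges = {{u, v} | u v. pvalid n p L a b u \<and> pvalid n p L a b v \<and>
     {pvert p L a b u, pvert p L a b v} \<in> edges G}\<rparr>"

lemma verts_piece [simp]: "verts (piece G n m p L a b) = {..<m}"
  by (simp add: piece_def)

lemma piece_edge:
  "{u, v} \<in> edges (piece G n m p L a b) \<longleftrightarrow> pvalid n p L a b u \<and> pvalid n p L a b v \<and>
     {pvert p L a b u, pvert p L a b v} \<in> edges G"
  by (auto simp: piece_def doubleton_eq_iff insert_commute)

lemma simple_piece:
  assumes "simple_graph G" "3 * L \<le> m" shows "simple_graph (piece G n m p L a b)"
  unfolding simple_graph_def
proof (intro conjI ballI)
  fix e assume "e \<in> edges (piece G n m p L a b)"
  then obtain u v where e: "e = {u, v}" "pvalid n p L a b u" "pvalid n p L a b v"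
    "{pvert p L a b u, pvert p L a b v} \<in> edges G" by (auto simp: piece_def)
  then have "u \<noteq> v" using edge_in_verts[OF assms(1) e(4)] by auto
  then show "card e = 2" using e by simp
  show "e \<subseteq> verts (piece G n m p L a b)" using e assms(2) by (auto simp: pvalid_def)
qed simp

lemma has_triangle_iff: "has_triangle G \<longleftrightarrow>
    (\<exists>x y z. {x, y} \<in> edges G \<and> {y, z} \<in> edges G \<and> {x, z} \<in> edges G)"
  by (auto simp: has_triangle_def triangles_def)

text \<open>The index map is a homomorphism into \<open>G\<close>, injective or not, so a
  triangle-free graph has only triangle-free pieces, whatever the blocks.\<close>

lemma has_triangle_piece: "has_triangle (piece G n m p L a b) \<Longrightarrow> has_triangle G"
  unfolding has_triangle_iff piece_edge by blast

text \<open>Different blocks occupy disjoint ranges of positions, and multiplication by an odd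
  number permutes the positions.\<close>

lemma inj_on_pvert:
  assumes "odd a" "i < g" "j < g" "k < g" "i \<noteq> j" "j \<noteq> k" "i \<noteq> k" "g * L = 2 ^ \<kappa>"
  shows "inj_on (pvert (2 ^ \<kappa>) L a (i, j, k)) {..<3 * L}"
proof (rule inj_onI)
  define f where "f u = (if u div L = 0 then i else if u div L = 1 then j else if u div L = 2 then k else 0)"
    for u
  fix u v assume h: "u \<in> {..<3 * L}" "v \<in> {..<3 * L}"
    and e: "pvert (2 ^ \<kappa>) L a (i, j, k) u = pvert (2 ^ \<kappa>) L a (i, j, k) v"
  have L: "L > 0" using h by (cases L) auto
  have d: "u div L < 3" "v div L < 3" using h by (auto simp: less_mult_imp_div_less)
  have less: "f u * L + u mod L < 2 ^ \<kappa>" for u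
  proof -
    have "f u < g" using assms by (auto simp: f_def)
    then have "Suc (f u) * L \<le> 2 ^ \<kappa>" unfolding assms(8)[symmetric] by (intro mult_right_mono) auto
    moreover have "u mod L < L" using L by simp
    ultimately show ?thesis by simp
  qed
  have "a * (f u * L + u mod L) mod 2 ^ \<kappa> = a * (f v * L + v mod L) mod 2 ^ \<kappa>"
    using e by (simp add: pvert_def f_def)
  then have eq: "f u * L + u mod L = f v * L + v mod L"
    using inj_onD[OF inj_mult_mod[OF assms(1)]] less by (metis lessThan_iff)
  have m: "u mod L = v mod L"
    using arg_cong[OF eq, of "\<lambda>t. t mod L"] by simp
  have fe: "f u = f v" using eq m L by simp
  have "u div L \<in> {0, 1, 2}" "v div L \<in> {0, 1, 2}" using d by auto
  then have "u div L = v div L" using fe assms(5-7) unfolding f_def by auto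
  with m show "u = v" by (metis div_mult_mod_eq)
qed

text \<open>\<open>P\<close> is the position of \<open>x\<close> in the permutation. For odd
  \<open>a\<close>, \<open>p\<close> a power of two and \<open>x < p\<close> it exists and is unique
  (\<open>ex_position\<close>, \<open>block_eq\<close>).\<close>

definition block :: "nat \<Rightarrow> nat \<Rightarrow> nat \<Rightarrow> nat \<Rightarrow> nat" where
  "block p L a x = (SOME P. P < p \<and> a * P mod p = x) div L"

lemma block_eq:
  assumes "odd a" "P < 2 ^ \<kappa>" shows "block (2 ^ \<kappa>) L a (a * P mod 2 ^ \<kappa>) = P div L"
proof -
  have "(SOME P'. P' < 2 ^ \<kappa> \<and> a * P' mod 2 ^ \<kappa> = a * P mod 2 ^ \<kappa>) = P"
    using assms(2) inj_onD[OF inj_mult_mod[OF assms(1), of \<kappa>], of _ P]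
    by (intro some_equality) simp_all
  then show ?thesis by (simp add: block_def)
qed

lemma block_eq_imp_colliding:
  assumes "odd a" "a < 2 ^ \<kappa>" "x < 2 ^ \<kappa>" "y < 2 ^ \<kappa>"
    "block (2 ^ \<kappa>) L a x = block (2 ^ \<kappa>) L a y"
  shows "a \<in> colliding (2 ^ \<kappa>) L x y"
proof -
  obtain P Q where "P < 2 ^ \<kappa>" "Q < 2 ^ \<kappa>" "a * P mod 2 ^ \<kappa> = x" "a * Q mod 2 ^ \<kappa> = y"
    using ex_position assms by meson
  then show ?thesis using assms block_eq[OF assms(1)] by (fastforce simp: colliding_def)
qed

lemma card_triangle:
  assumes "simple_graph G" "t \<in> triangles G" shows "card t = 3" "finite t"
proof -
  obtain x y z where t: "t = {x, y, z}" and "{x, y} \<in> edges G" "{y, z} \<in> edges G" "{x, z} \<in> edges G"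
    using assms(2) by (auto simp: triangles_def)
  then have "x \<noteq> y" "y \<noteq> z" "x \<noteq> z" using edge_in_verts[OF assms(1)] by blast+
  then show "card t = 3" "finite t" using t by simp_all
qed

text \<open>Every other triangle has a vertex \<open>wit t\<close> outside \<open>{x, y, z}\<close>.
  If that vertex shares no block with \<open>x\<close>, \<open>y\<close> or \<open>z\<close>, the
  triangle is not contained in their blocks. Together with the three pairs inside
  \<open>{x, y, z}\<close> this forbids at most \<open>3 * card (triangles G)\<close> collisions,
  each caused by at most \<open>2 * L\<close> multipliers.\<close>

lemma isolating_multipliers:
  assumes G: "simple_graph G" "verts G = {..<n}" "n \<le> 2 ^ \<kappa>" "L > 0"
    and xyz: "{x, y} \<in> edges G" "{y, z} \<in> edges G" "{x, z} \<in> edges G"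
  shows "\<exists>Bad. finite Bad \<and> card Bad \<le> 3 * card (triangles G) * (2 * L) \<and>
    (\<forall>a<2 ^ \<kappa>. odd a \<and> a \<notin> Bad \<longrightarrow>
      (let b = block (2 ^ \<kappa>) L a in b x \<noteq> b y \<and> b y \<noteq> b z \<and> b x \<noteq> b z \<and>
        (\<forall>t\<in>triangles G. b ` t \<subseteq> b ` {x, y, z} \<longrightarrow> t = {x, y, z})))"
proof -
  define t0 where "t0 = {x, y, z}"
  have t0: "t0 \<in> triangles G" using xyz by (auto simp: t0_def triangles_def)
  have fin: "finite (triangles G)"
    using triangles_subset_Pow[OF G(1)] G(2) by (simp add: finite_subset)
  have less: "v < 2 ^ \<kappa>" if "t \<in> triangles G" "v \<in> t" for t v
    using triangles_subset_Pow[OF G(1)] G(2,3) that by fastforce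
  have "\<exists>w. w \<in> t \<and> w \<notin> t0" if "t \<in> triangles G - {t0}" for t
  proof (rule ccontr)
    assume "\<nexists>w. w \<in> t \<and> w \<notin> t0"
    then have "t \<subseteq> t0" by blast
    then have "t = t0"
      using card_subset_eq[of t0 t] card_triangle[OF G(1) t0] card_triangle[OF G(1), of t] that by simp
    then show False using that by simp
  qed
  then obtain wit where wit: "\<And>t. t \<in> triangles G - {t0} \<Longrightarrow> wit t \<in> t \<and> wit t \<notin> t0" by metis
  define Pr where "Pr = {(x, y), (y, z), (x, z)} \<union> (\<Union>t\<in>triangles G - {t0}. Pair (wit t) ` t0)"
  define Bad where "Bad = (\<Union>(u, v)\<in>Pr. colliding (2 ^ \<kappa>) L u v)"
  have finC: "finite (colliding (2 ^ \<kappa>) L u v)" for u v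
    by (rule finite_subset[of _ "{..<2 ^ \<kappa>}"]) (auto simp: colliding_def)
  have finP: "finite Pr" using fin by (simp add: Pr_def t0_def)
  have neq: "u < 2 ^ \<kappa> \<and> v < 2 ^ \<kappa> \<and> u \<noteq> v" if "(u, v) \<in> Pr" for u v
  proof -
    have "x \<noteq> y" "y \<noteq> z" "x \<noteq> z" using xyz edge_in_verts[OF G(1)] by blast+
    moreover have "x \<in> t0" "y \<in> t0" "z \<in> t0" by (auto simp: t0_def)
    ultimately have 1: ?thesis if "(u, v) \<in> {(x, y), (y, z), (x, z)}"
      using that less[OF t0] by auto
    have 2: ?thesis if h: "t \<in> triangles G - {t0}" "u = wit t" "v \<in> t0" for t
      using less[OF t0 h(3)] less[of t u] wit[OF h(1)] h by auto
    show ?thesis using that 1 2 unfolding Pr_def by blast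
  qed
  have "card Pr \<le> card {(x, y), (y, z), (x, z)} + card (\<Union>t\<in>triangles G - {t0}. Pair (wit t) ` t0)"
    unfolding Pr_def by (rule card_Un_le)
  also have "\<dots> \<le> 3 + (\<Sum>t\<in>triangles G - {t0}. card (Pair (wit t) ` t0))"
    using card_UN_le[of "triangles G - {t0}" "\<lambda>t. Pair (wit t) ` t0"] fin
    by (intro add_mono) (simp_all add: card_insert_if)
  also have "\<dots> \<le> 3 + (\<Sum>t\<in>triangles G - {t0}. 3)"
  proof (intro add_left_mono sum_mono)
    fix t show "card (Pair (wit t) ` t0) \<le> 3"
      using card_triangle[OF G(1) t0] card_image_le[of t0 "Pair (wit t)"] by simp
  qed
  also have "\<dots> = 3 * card (triangles G)"
    using fin t0 by (simp add: card_Diff_singleton) (metis One_nat_def Suc_pred add.commute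
      card_gt_0_iff empty_iff mult_Suc_right mult.commute)
  finally have cP: "card Pr \<le> 3 * card (triangles G)" .
  have "card Bad \<le> (\<Sum>e\<in>Pr. card (case e of (u, v) \<Rightarrow> colliding (2 ^ \<kappa>) L u v))"
    unfolding Bad_def by (rule card_UN_le[OF finP])
  also have "\<dots> \<le> (\<Sum>e\<in>Pr. 2 * L)"
    using neq card_colliding G(4) by (intro sum_mono) auto
  also have "\<dots> \<le> 3 * card (triangles G) * (2 * L)" using cP by simp
  finally have "card Bad \<le> 3 * card (triangles G) * (2 * L)" .
  moreover have "finite Bad" unfolding Bad_def using finP finC by auto
  moreover have "let b = block (2 ^ \<kappa>) L a in b x \<noteq> b y \<and> b y \<noteq> b z \<and> b x \<noteq> b z \<and>
        (\<forall>t\<in>triangles G. b ` t \<subseteq> b ` {x, y, z} \<longrightarrow> t = {x, y, z})"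
    if a: "a < 2 ^ \<kappa>" "odd a" "a \<notin> Bad" for a
  proof -
    define b where "b = block (2 ^ \<kappa>) L a"
    have nc: "b u \<noteq> b v" if "(u, v) \<in> Pr" for u v
      using block_eq_imp_colliding[OF a(2,1)] neq[OF that] a(3) that unfolding b_def Bad_def by blast
    have "t = t0" if t: "t \<in> triangles G" "b ` t \<subseteq> b ` t0" for t
    proof (rule ccontr)
      assume "t \<noteq> t0"
      then have w: "wit t \<in> t" "\<And>v. v \<in> t0 \<Longrightarrow> (wit t, v) \<in> Pr" using t wit by (auto simp: Pr_def)
      then obtain v where "v \<in> t0" "b (wit t) = b v" using t(2) by blast
      then show False using nc w by blast
    qed
    moreover have "(x, y) \<in> Pr" "(y, z) \<in> Pr" "(x, z) \<in> Pr" by (auto simp: Pr_def)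
    ultimately show ?thesis unfolding Let_def b_def[symmetric] t0_def[symmetric] using nc by blast
  qed
  ultimately show ?thesis by blast
qed

lemma pvert_cases:
  assumes "u < 3 * L"
  obtains P where "P div L \<in> {i, j, k}" "pvert p L a (i, j, k) u = a * P mod p"
    "(P div L = i \<and> u = P mod L) \<or> (P div L = j \<and> u = L + P mod L) \<or> (P div L = k \<and> u = 2 * L + P mod L)"
proof -
  have L: "L > 0" using assms by (cases L) auto
  have "u div L < 3" using assms by (simp add: less_mult_imp_div_less)
  then consider "u div L = 0" | "u div L = 1" | "u div L = 2" by linarith
  then show ?thesis
  proof cases
    case 1
    then have "u < L" using L by (simp add: div_eq_0_iff)
    with 1 L that[of "i * L + u mod L"] show ?thesis by (simp add: pvert_def)
  next
    case 2
    then have "u = L + u mod L" using div_mult_mod_eq[of u L] by simp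
    with 2 L that[of "j * L + u mod L"] show ?thesis by (simp add: pvert_def)
  next
    case 3
    then have "u = 2 * L + u mod L" using div_mult_mod_eq[of u L] by simp
    with 3 L that[of "k * L + u mod L"] show ?thesis by (simp add: pvert_def)
  qed
qed

lemma block_pvert:
  assumes "odd a" "i < g" "j < g" "k < g" "g * L = 2 ^ \<kappa>" "u < 3 * L"
  shows "block (2 ^ \<kappa>) L a (pvert (2 ^ \<kappa>) L a (i, j, k) u) \<in> {i, j, k}"
proof -
  obtain P where P: "P div L \<in> {i, j, k}" "pvert (2 ^ \<kappa>) L a (i, j, k) u = a * P mod 2 ^ \<kappa>"
    using pvert_cases[OF assms(6)] by metis
  then have "P div L < g" using assms by auto
  then have "P < 2 ^ \<kappa>" unfolding assms(5)[symmetric] by (metis div_less_iff_less_mult gr0I less_nat_zero_code mult_is_0 assms(5) power_not_zero zero_neq_numeral)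
  then show ?thesis using P block_eq[OF assms(1)] by simp
qed

lemma ex_index:
  assumes "odd a" "x < n" "n \<le> 2 ^ \<kappa>" "block (2 ^ \<kappa>) L a x \<in> {i, j, k}" "L > 0"
  shows "\<exists>u. pvalid n (2 ^ \<kappa>) L a (i, j, k) u \<and> pvert (2 ^ \<kappa>) L a (i, j, k) u = x"
proof -
  obtain P where P: "P < 2 ^ \<kappa>" "a * P mod 2 ^ \<kappa> = x"
    using ex_position[OF assms(1), of x \<kappa>] assms(2,3) by auto
  have b: "P div L \<in> {i, j, k}" using assms(4) block_eq[OF assms(1) P(1)] P(2) by auto
  have r: "P mod L < L" using assms(5) by simp
  have "\<exists>u<3 * L. pvert (2 ^ \<kappa>) L a (i, j, k) u = a * P mod 2 ^ \<kappa>"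
  proof -
    consider "P div L = i" | "P div L = j" | "P div L = k" using b by blast
    then show ?thesis
    proof cases
      case 1 then show ?thesis using r by (intro exI[of _ "P mod L"]) (auto simp: pvert_def)
    next
      case 2 then show ?thesis using r by (intro exI[of _ "L + P mod L"]) (auto simp: pvert_def)
    next
      case 3 then show ?thesis using r by (intro exI[of _ "2 * L + P mod L"]) (auto simp: pvert_def)
    qed
  qed
  then show ?thesis using P(2) assms(2) by (auto simp: pvalid_def)
qed

text \<open>A triangle of the piece maps to a triangle of \<open>G\<close> inside the three blocks,
  hence to \<open>{x, y, z}\<close>; as \<open>pvert\<close> is injective on the indices of the
  blocks, only one vertex set of the piece can do so.\<close>

lemma piece_isolated:
  assumes "odd a" and ijk: "i < g" "j < g" "k < g" "i \<noteq> j" "j \<noteq> k" "i \<noteq> k" and g_mult_L: "g * L = 2 ^ \<kappa>"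
    and G: "simple_graph G" "verts G = {..<n}" "n \<le> 2 ^ \<kappa>" "L > 0" "3 * L \<le> m"
    and xyz: "{x, y} \<in> edges G" "{y, z} \<in> edges G" "{x, z} \<in> edges G"
    and b: "block (2 ^ \<kappa>) L a ` {x, y, z} = {i, j, k}"
    and only: "\<And>t. t \<in> triangles G \<Longrightarrow> block (2 ^ \<kappa>) L a ` t \<subseteq> {i, j, k} \<Longrightarrow> t = {x, y, z}"
  shows "has_triangle (piece G n m (2 ^ \<kappa>) L a (i, j, k))"
    and "card (triangles (piece G n m (2 ^ \<kappa>) L a (i, j, k))) \<le> 1"
proof -
  let ?f = "pvert (2 ^ \<kappa>) L a (i, j, k)" and ?P = "piece G n m (2 ^ \<kappa>) L a (i, j, k)"
  have "x < n" "y < n" "z < n" using edge_in_verts[OF G(1)] xyz G(2) by auto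
  moreover have "block (2 ^ \<kappa>) L a x \<in> {i, j, k}" "block (2 ^ \<kappa>) L a y \<in> {i, j, k}"
    "block (2 ^ \<kappa>) L a z \<in> {i, j, k}" using b by blast+
  ultimately obtain u v w where "pvalid n (2 ^ \<kappa>) L a (i, j, k) u" "?f u = x"
    "pvalid n (2 ^ \<kappa>) L a (i, j, k) v" "?f v = y" "pvalid n (2 ^ \<kappa>) L a (i, j, k) w" "?f w = z"
    using ex_index[OF assms(1) _ G(3) _ G(4), of x i j k] ex_index[OF assms(1) _ G(3) _ G(4), of y i j k]
      ex_index[OF assms(1) _ G(3) _ G(4), of z i j k] by blast
  then show "has_triangle ?P" unfolding has_triangle_iff piece_edge using xyz by blast
  have inj: "inj_on ?f {..<3 * L}" by (rule inj_on_pvert[OF assms(1) ijk g_mult_L])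
  have *: "t \<subseteq> {..<3 * L} \<and> ?f ` t = {x, y, z}" if h: "t \<in> triangles ?P" for t
  proof -
    obtain u v w where t: "t = {u, v, w}" "{u, v} \<in> edges ?P" "{v, w} \<in> edges ?P" "{u, w} \<in> edges ?P"
      using h unfolding triangles_def by blast
    then have s: "t \<subseteq> {..<3 * L}" by (auto simp: piece_edge pvalid_def)
    have "?f ` t \<in> triangles G"
      using t unfolding piece_edge triangles_def by auto
    moreover have "block (2 ^ \<kappa>) L a ` ?f ` t \<subseteq> {i, j, k}"
      using block_pvert[OF assms(1) ijk(1-3) g_mult_L] s by blast
    ultimately show ?thesis using only s by blast
  qed
  have "t1 = t2" if "t1 \<in> triangles ?P" "t2 \<in> triangles ?P" for t1 t2
    using *[OF that(1)] *[OF that(2)] inj_on_image_eq_iff[OF inj, of t1 t2] by simp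
  moreover have "finite (triangles ?P)"
    using triangles_subset_Pow[OF simple_piece[OF G(1,5), of n "2 ^ \<kappa>" a "(i, j, k)"]]
    by (rule finite_subset) simp
  ultimately show "card (triangles ?P) \<le> 1" by (simp add: card_le_Suc0_iff_eq)
qed

lemma piece_free:
  assumes "simple_graph H" "inj_on h (verts (augment H))" "odd a"
    and ijk: "i < g" "j < g" "k < g" "i \<noteq> j" "j \<noteq> k" "i \<noteq> k" and g_mult_L: "g * L = 2 ^ \<kappa>"
    and G: "simple_graph G" "verts G = {..<n}" "n > 0" "3 * L \<le> m" "induced_free_of H G"
    and le: "card (triangles (piece G n m (2 ^ \<kappa>) L a (i, j, k))) \<le> 1"
  shows "free_of (map_graph h (augment H)) (piece G n m (2 ^ \<kappa>) L a (i, j, k))"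
proof (rule free_of_augment[where V = "{u. pvalid n (2 ^ \<kappa>) L a (i, j, k) u}"])
  show "inj_on (pvert (2 ^ \<kappa>) L a (i, j, k)) {u. pvalid n (2 ^ \<kappa>) L a (i, j, k) u}"
    by (rule inj_on_subset[OF inj_on_pvert[OF assms(3) ijk g_mult_L]]) (auto simp: pvalid_def)
qed (use assms simple_piece in \<open>auto simp: piece_edge pvalid_def\<close>)

section \<open>Program logic\<close>

definition wp :: "nat \<Rightarrow> com \<Rightarrow> (st \<Rightarrow> bool) \<Rightarrow> st \<Rightarrow> bool" where
  "wp w c Q s \<longleftrightarrow> (\<forall>s'\<in>set_pmf (sem w c s). Q s')"

text \<open>Expectations live in \<open>ennreal\<close>, so no integrability has to be shown for the
  potentials below.\<close>

definition wex :: "nat \<Rightarrow> com \<Rightarrow> (st \<Rightarrow> ennreal) \<Rightarrow> st \<Rightarrow> ennreal" where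
  "wex w c g s = (\<integral>\<^sup>+s'. g s' \<partial>measure_pmf (sem w c s))"

lemma wp_simps [simp]:
  "wp w Skip Q s = Q s"
  "wp w (Asg x e) Q s = Q (tick (elen e + 1) (asg x (aval w e s) s))"
  "wp w (Sto a e) Q s = Q (tick (elen a + elen e + 1) (sto (aval w a s) (aval w e s) s))"
  "wp w (c ;; d) Q s = wp w c (wp w d Q) s"
  "wp w (Ite e c d) Q s = (if aval w e s \<noteq> 0 then wp w c (\<lambda>s'. Q (tick 2 s')) (tick (elen e + 1) s)
     else wp w d Q (tick (elen e + 1) s))"
  by (auto simp: wp_def)

lemma wp_Rnd: "wp w (Rnd x) Q s \<longleftrightarrow> (\<forall>v<2 ^ w. Q (tick 1 (asg x v s)))"
  by (auto simp: wp_def set_pmf_of_set lessThan_empty_iff)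

lemma wp_mono: "wp w c P s \<Longrightarrow> (\<And>s'. P s' \<Longrightarrow> Q s') \<Longrightarrow> wp w c Q s"
  by (auto simp: wp_def)

lemma wp_conj: "wp w c P s \<Longrightarrow> wp w c Q s \<Longrightarrow> wp w c (\<lambda>s. P s \<and> Q s) s"
  by (auto simp: wp_def)

lemma wp_frame: "wp w c (\<lambda>s'. \<forall>x. x \<notin> writes c \<longrightarrow> vr s' x = vr s x) s"
  by (auto simp: wp_def sem_frame)

lemma wex_simps [simp]:
  "wex w Skip g s = g s"
  "wex w (Asg x e) g s = g (tick (elen e + 1) (asg x (aval w e s) s))"
  "wex w (c ;; d) g s = wex w c (wex w d g) s"
  "wex w (Ite e c d) g s = (if aval w e s \<noteq> 0 then wex w c (\<lambda>s'. g (tick 2 s')) (tick (elen e + 1) s)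
     else wex w d g (tick (elen e + 1) s))"
  by (simp_all add: wex_def nn_integral_bind_pmf)

lemma wex_mono: "wp w c (\<lambda>s'. f s' \<le> g s') s \<Longrightarrow> wex w c f s \<le> wex w c g s"
  unfolding wex_def wp_def by (rule nn_integral_mono_AE) (simp add: AE_measure_pmf_iff)

lemma wex_const [simp]: "wex w c (\<lambda>s. r) s = r"
  by (simp add: wex_def measure_pmf.emeasure_space_1)

lemma wex_le: "wp w c (\<lambda>s'. g s' \<le> r) s \<Longrightarrow> wex w c g s \<le> r"
  using wex_mono[of w c g "\<lambda>_. r" s] by simp

text \<open>\<open>f k\<close> bounds the expected final value of \<open>g\<close> when
  \<open>k\<close> turns remain; \<open>step\<close> makes it a supermartingale along the loop.
  Invariant and expectation are proved together because \<open>I\<close> must be available on the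
  support when a turn is estimated.\<close>

lemma For_rule:
  assumes I: "I (aval w e s) (tick (elen e + 1) s)" "f (aval w e s) (tick (elen e + 1) s) \<le> r"
    and step: "\<And>k s'. k < aval w e s \<Longrightarrow> I (Suc k) s' \<Longrightarrow>
       wp w c (\<lambda>s'. I k (tick 2 s')) (tick 3 (asg x k s')) \<and>
       wex w c (\<lambda>s'. f k (tick 2 s')) (tick 3 (asg x k s')) \<le> f (Suc k) s'"
    and fin: "\<And>s'. I 0 s' \<Longrightarrow> Q (tick 1 (asg x 0 s')) \<and> g (tick 1 (asg x 0 s')) \<le> f 0 s'"
  shows "wp w (For x e c) Q s \<and> wex w (For x e c) g s \<le> r"
proof -
  have "(\<forall>s''\<in>set_pmf (loop x (sem w c) k s'). Q s'') \<and>
     (\<integral>\<^sup>+s''. g s'' \<partial>measure_pmf (loop x (sem w c) k s')) \<le> f k s'"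
    if "k \<le> aval w e s" "I k s'" for k s'
    using that
  proof (induction k arbitrary: s')
    case 0
    then show ?case using fin by (simp add: nn_integral_return_pmf)
  next
    case (Suc k)
    let ?p = "sem w c (tick 3 (asg x k s'))"
    have st: "\<And>s1. s1 \<in> set_pmf ?p \<Longrightarrow> I k (tick 2 s1)"
      "(\<integral>\<^sup>+s1. f k (tick 2 s1) \<partial>measure_pmf ?p) \<le> f (Suc k) s'"
      using step[of k s'] Suc.prems by (auto simp: wp_def wex_def)
    have "(\<integral>\<^sup>+s''. g s'' \<partial>measure_pmf (loop x (sem w c) (Suc k) s')) =
       (\<integral>\<^sup>+s1. (\<integral>\<^sup>+s''. g s'' \<partial>measure_pmf (loop x (sem w c) k (tick 2 s1))) \<partial>measure_pmf ?p)"
      by (simp add: nn_integral_bind_pmf)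
    also have "\<dots> \<le> (\<integral>\<^sup>+s1. f k (tick 2 s1) \<partial>measure_pmf ?p)"
      by (rule nn_integral_mono_AE) (use Suc st in \<open>simp add: AE_measure_pmf_iff\<close>)
    finally show ?case using Suc st by (auto intro: order_trans)
  qed
  from this[OF order_refl I(1)] I(2) show ?thesis by (auto simp: wp_def wex_def)
qed

lemma wp_For:
  assumes "I (aval w e s) (tick (elen e + 1) s)"
    and "\<And>k s'. k < aval w e s \<Longrightarrow> I (Suc k) s' \<Longrightarrow> wp w c (\<lambda>s'. I k (tick 2 s')) (tick 3 (asg x k s'))"
    and "\<And>s'. I 0 s' \<Longrightarrow> Q (tick 1 (asg x 0 s'))"
  shows "wp w (For x e c) Q s"
  using For_rule[of I w e s "\<lambda>_ _. 0" 0 c x Q "\<lambda>_. 0"] assms by simp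

primrec loopfree :: "com \<Rightarrow> bool" where
  "loopfree Skip = True"
| "loopfree (Asg x e) = True"
| "loopfree (Sto a e) = True"
| "loopfree (Rnd x) = True"
| "loopfree (c ;; d) = (loopfree c \<and> loopfree d)"
| "loopfree (Ite e c d) = (loopfree c \<and> loopfree d)"
| "loopfree (For x e c) = False"

text \<open>Without loops all jumps go forward, so each instruction is executed at most
  once.\<close>

lemma loopfree_tm: "loopfree c \<Longrightarrow> wp w c (\<lambda>s'. tm s' \<le> tm s + clen c) s"
proof (induction c arbitrary: s)
  case (Seq c d)
  then show ?case by (fastforce simp: wp_def)
next
  case (Ite e c d)
  then show ?case by (fastforce simp: wp_def)
qed (auto simp: wp_Rnd)

lemma For_tm:
  assumes "loopfree c"
  shows "wp w (For x e c) (\<lambda>s'. tm s' \<le> tm s + aval w e s * (clen c + 5) + elen e + 2) s"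
proof (rule wp_For[where I = "\<lambda>k (s' :: st). tm s' + k * (clen c + 5) \<le> tm s + aval w e s * (clen c + 5) + elen e + 1"])
  fix k and s' :: st assume "tm s' + Suc k * (clen c + 5) \<le> tm s + aval w e s * (clen c + 5) + elen e + 1"
  then show "wp w c (\<lambda>s'. tm (tick 2 s') + k * (clen c + 5) \<le> tm s + aval w e s * (clen c + 5) + elen e + 1)
      (tick 3 (asg x k s'))"
    by (intro wp_mono[OF loopfree_tm[OF assms]]) auto
qed auto

section \<open>The reduction program\<close>

text \<open>Variables: 0 \<open>n\<close>, 1 \<open>m\<close>, 2 \<open>l\<close>, 3 \<open>q\<close>, 4 region size, 5 answer, 6 region base, 7 step budget,
  8 votes, 9 multiplier, 10--12 blocks, 13 repetitions, 14 short loops, 15 simulated program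
  counter, 16 rounds, 17 random word, \<open>18 + r\<close> simulated register \<open>r\<close>.\<close>

abbreviation (input) eadd (infixl "\<oplus>" 65) where "x \<oplus> y \<equiv> Bn Add x y"
abbreviation (input) esub (infixl "\<ominus>" 65) where "x \<ominus> y \<equiv> Bn Sub x y"
abbreviation (input) emul (infixl "\<otimes>" 70) where "x \<otimes> y \<equiv> Bn Mul x y"
abbreviation (input) ediv (infixl "\<oslash>" 70) where "x \<oslash> y \<equiv> Bn Div x y"
abbreviation (input) emod (infixl "\<odot>" 70) where "x \<odot> y \<equiv> Bn Mod x y"
abbreviation (input) elt (infix "\<prec>" 50) where "x \<prec> y \<equiv> Bn Less x y"
abbreviation (input) eeq (infix "\<doteq>" 50) where "x \<doteq> y \<equiv> Bn Equal x y"

text \<open>Block length, number of positions and number of blocks. Variable 3 is the power of two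
  \<open>q\<close> with \<open>m + 2 <= q < 2 * (m + 2)\<close>. The factor 16 lets three blocks fit
  into \<open>m\<close> vertices and keeps the bad multipliers of a round to at most a
  quarter.\<close>

definition eL :: aexp where "eL = Vr 3 \<oslash> Nm 16"
definition ep :: aexp where "ep = Vr 3 \<otimes> Vr 3"
definition eg :: aexp where "eg = Nm 16 \<otimes> Vr 3"

definition evert :: "aexp \<Rightarrow> aexp" where
  "evert u = (Vr 9 \<otimes> ((Vr 10 \<otimes> (u \<oslash> eL \<doteq> Nm 0) \<oplus> Vr 11 \<otimes> (u \<oslash> eL \<doteq> Nm 1) \<oplus> Vr 12 \<otimes> (u \<oslash> eL \<doteq> Nm 2)) \<otimes> eL
     \<oplus> u \<odot> eL)) \<odot> ep"

text \<open>Truth values are multiplied instead of branched on. The load takes place even for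
  invalid indices, but then a zero factor cancels whatever it reads.\<close>

definition eadj :: "aexp \<Rightarrow> aexp \<Rightarrow> aexp" where
  "eadj u v = (u \<prec> Nm 3 \<otimes> eL) \<otimes> (evert u \<prec> Vr 0) \<otimes> (v \<prec> Nm 3 \<otimes> eL) \<otimes> (evert v \<prec> Vr 0) \<otimes>
     Ld (evert u \<otimes> Vr 0 \<oplus> evert v)"

definition build :: com where
  "build = For 14 (Vr 1 \<otimes> Vr 1) (Sto (Vr 6 \<oplus> Vr 14) (eadj (Vr 14 \<oslash> Vr 1) (Vr 14 \<odot> Vr 1)))"

text \<open>One counter below \<open>m ^ 3\<close> encodes the triple of vertices in base
  \<open>m\<close>, so the search is a single loop with a loop-free body.\<close>

definition brute :: com where
  "brute = For 14 (Vr 1 \<otimes> Vr 1 \<otimes> Vr 1)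
     (Ite (eadj (Vr 14 \<oslash> Vr 1 \<oslash> Vr 1) (Vr 14 \<oslash> Vr 1 \<odot> Vr 1) \<otimes> eadj (Vr 14 \<oslash> Vr 1 \<odot> Vr 1) (Vr 14 \<odot> Vr 1)
        \<otimes> eadj (Vr 14 \<oslash> Vr 1 \<oslash> Vr 1) (Vr 14 \<odot> Vr 1))
       (Asg 5 (Nm 1)) Skip)"

primrec reset :: "nat \<Rightarrow> com" where
  "reset 0 = Skip"
| "reset (Suc r) = reset r ;; Asg (18 + r) (Nm 0)"

text \<open>Variable 4 holds the power of two \<open>S\<close>, so the mask \<open>S - 1\<close>
  reduces a value to the word size of the simulated machine.\<close>

definition clip :: "aexp \<Rightarrow> aexp" where
  "clip e = Bn And e (Vr 4 \<ominus> Nm 1)"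

definition next_pc :: com where "next_pc = Asg 15 (Vr 15 \<oplus> Nm 1)"

text \<open>Addresses are shifted by the region base. Constants, results of operations and random
  words are clipped; loaded words are short already, since everything in the region is.\<close>

fun simulate :: "instr \<Rightarrow> com" where
  "simulate (Const r k) = Asg (18 + r) (clip (Nm k)) ;; next_pc"
| "simulate (Op f r s t) = Asg (18 + r) (clip (Bn f (Vr (18 + s)) (Vr (18 + t)))) ;; next_pc"
| "simulate (Load r s) = Asg (18 + r) (Ld (Vr 6 \<oplus> Vr (18 + s))) ;; next_pc"
| "simulate (Store r s) = Sto (Vr 6 \<oplus> Vr (18 + r)) (Vr (18 + s)) ;; next_pc"
| "simulate (Rand r) = Rnd (18 + r) ;; Asg (18 + r) (clip (Vr (18 + r))) ;; next_pc"
| "simulate (Jump_Zero r l) = Ite (Vr (18 + r)) next_pc (Asg 15 (Nm l))"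

text \<open>The program is fixed, so a chain of tests takes constant time. A program counter outside
  the program falls through to \<open>Skip\<close>, as a halted machine stays put.\<close>

primrec dispatch :: "nat \<Rightarrow> instr list \<Rightarrow> com" where
  "dispatch i [] = Skip"
| "dispatch i (ins # xs) = Ite (Vr 15 \<doteq> Nm i) (simulate ins) (dispatch (Suc i) xs)"

fun reg_bound :: "instr \<Rightarrow> nat" where
  "reg_bound (Const r k) = Suc r"
| "reg_bound (Op f r s t) = Suc (r + s + t)"
| "reg_bound (Load r s) = Suc (r + s)"
| "reg_bound (Store r s) = Suc (r + s)"
| "reg_bound (Rand r) = Suc r"
| "reg_bound (Jump_Zero r l) = Suc r"

fun jump_bound :: "instr \<Rightarrow> nat" where
  "jump_bound (Jump_Zero r l) = l"
| "jump_bound _ = 0"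

text \<open>The \<open>Suc\<close> covers register 0, which carries the input size and the answer
  even if the program never mentions it.\<close>

definition num_regs :: "program \<Rightarrow> nat" where
  "num_regs A = Suc (sum_list (map reg_bound A))"

text \<open>Jumps may lead beyond the end of the program, so the length alone does not bound the
  program counter.\<close>

definition max_pc :: "program \<Rightarrow> nat" where
  "max_pc A = length A + sum_list (map jump_bound A)"

text \<open>Moving the base by \<open>S\<close> opens a fresh region. Only the \<open>m * m\<close>
  matrix cells are then written; the rest of the region is still zero, and the registers are reset
  one by one.\<close>

definition prepare :: "program \<Rightarrow> com" where
  "prepare A = Asg 6 (Vr 6 \<oplus> Vr 4) ;; build ;; reset (num_regs A) ;; Asg 18 (Vr 1) ;; Asg 15 (Nm 0)"

definition simul :: "program \<Rightarrow> com" where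
  "simul A = For 14 (Vr 7) (dispatch 0 A)"

definition conclude :: "program \<Rightarrow> com" where
  "conclude A = Ite (Vr 15 \<prec> Nm (length A)) (brute ;; Asg 7 (Vr 7 \<oplus> Nm 1))
     (Ite (Vr 18) (Asg 8 (Vr 8 \<oplus> Nm 1)) Skip)"

definition trial :: "program \<Rightarrow> com" where
  "trial A = prepare A ;; simul A ;; conclude A"

text \<open>\<open>120 * l\<close> trials of error \<open>1 / 3\<close> with threshold
  \<open>60 * l\<close> err with probability at most \<open>(8 / 9) ^ (60 * l)\<close>, which is
  below \<open>2 ^ - (10 * l)\<close>; that survives a union bound over all votes of all
  rounds.\<close>

definition vote :: "program \<Rightarrow> com" where
  "vote A = Asg 8 (Nm 0) ;; For 13 (Nm 120 \<otimes> Vr 2) (Ite (Vr 5) Skip (trial A)) ;;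
     Ite (Nm 60 \<otimes> Vr 2 \<prec> Vr 8) (Asg 5 (Nm 1)) Skip"

text \<open>The nested bounds produce strictly decreasing block indices, so each set of three
  distinct blocks is treated exactly once.\<close>

definition all_pieces :: "program \<Rightarrow> com" where
  "all_pieces A = For 10 eg (For 11 (Vr 10) (For 12 (Vr 11) (vote A)))"

text \<open>\<open>2 * x + 1\<close> with \<open>x\<close> below \<open>p div 2\<close> ranges over
  the odd multipliers. With few triangles a round misses with probability at most
  \<open>1 / 2\<close>, and \<open>n\<close> is at most \<open>p = 2 ^ (2 * l)\<close>, so
  \<open>2 * l\<close> rounds reach error \<open>1 / n\<close>.\<close>

definition rounds :: "program \<Rightarrow> com" where
  "rounds A = For 16 (Nm 2 \<otimes> Vr 2)
     ((Rnd 9 ;; Asg 9 ((Vr 9 \<odot> (ep \<oslash> Nm 2)) \<otimes> Nm 2 \<oplus> Nm 1)) ;; all_pieces A)"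

text \<open>The three lowest base-\<open>p\<close> digits of one random word are independent uniform
  vertices, as \<open>p ^ 3\<close> divides \<open>2 ^ w\<close>. With at least \<open>q / 3\<close>
  triangles a sample hits with probability at least \<open>1 / (3 * q ^ 5)\<close>, so all
  \<open>6 * l * q ^ 5\<close> samples miss with probability at most
  \<open>exp (- 2 * l)\<close>.\<close>

definition sample :: com where
  "sample = For 14 (Nm 6 \<otimes> Vr 2 \<otimes> Vr 3 \<otimes> Vr 3 \<otimes> Vr 3 \<otimes> Vr 3 \<otimes> Vr 3) (Rnd 17 ;;
     (let x = Vr 17 \<odot> ep; y = Vr 17 \<oslash> ep \<odot> ep; z = Vr 17 \<oslash> ep \<oslash> ep \<odot> ep in
      Ite ((x \<prec> Vr 0) \<otimes> (y \<prec> Vr 0) \<otimes> (z \<prec> Vr 0) \<otimes> Ld (x \<otimes> Vr 0 \<oplus> y) \<otimes> Ld (y \<otimes> Vr 0 \<oplus> z) \<otimes> Ld (x \<otimes> Vr 0 \<oplus> z))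
       (Asg 5 (Nm 1)) Skip))"

text \<open>The square root and the logarithm are found by linear search; the
  \<open>n + m + 2\<close> turns are negligible against the rest. The region base starts just behind
  the input matrix.\<close>

definition startup :: "nat \<Rightarrow> com" where
  "startup ca =
     For 14 (Vr 0) (Ite (Vr 0 \<prec> (Vr 1 \<oplus> Nm 1) \<otimes> (Vr 1 \<oplus> Nm 1)) Skip (Asg 1 (Vr 1 \<oplus> Nm 1))) ;;
     For 14 (Vr 1 \<oplus> Nm 2) (Ite (Bn Shl (Nm 1) (Vr 2) \<prec> Vr 1 \<oplus> Nm 2) (Asg 2 (Vr 2 \<oplus> Nm 1)) Skip) ;;
     Asg 3 (Bn Shl (Nm 1) (Vr 2)) ;; Asg 4 (Bn Shl (Nm 1) (Nm ca \<otimes> Vr 2)) ;; Asg 6 (Vr 0 \<otimes> Vr 0)"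

text \<open>From \<open>49 = 7 ^ 2\<close> on, \<open>m >= 7\<close> and hence
  \<open>l >= 4\<close>, so 16 divides \<open>q\<close>. Smaller inputs are answered blindly;
  finitely many exceptions do not affect an \<open>O(1/n)\<close> error.\<close>

definition reduction :: "program \<Rightarrow> nat \<Rightarrow> com" where
  "reduction A ca = Ite (Vr 0 \<prec> Nm 49) (Asg 0 (Nm 0))
     (startup ca ;; sample ;; rounds A ;; Asg 0 (Vr 5))"

lemma writes_reset: "writes (reset k) \<subseteq> {18..<18 + k}"
  by (induction k) auto

lemma writes_dispatch: "writes (dispatch i xs) \<subseteq> {15} \<union> {18..<18 + sum_list (map reg_bound xs)}"
proof (induction xs arbitrary: i)
  case (Cons ins xs)
  have "writes (simulate ins) \<subseteq> {15} \<union> {18..<18 + reg_bound ins}"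
    by (cases ins) (auto simp: next_pc_def)
  then show ?case using Cons[of "Suc i"] by (auto simp: subset_iff)
qed simp

lemma wfc_loopfree: "loopfree c \<Longrightarrow> wfc c"
  by (induction c) auto

lemma loopfree_reset: "loopfree (reset k)"
  by (induction k) auto

lemma loopfree_dispatch: "loopfree (dispatch i xs)"
proof (induction xs arbitrary: i)
  case (Cons ins xs)
  then show ?case by (cases ins) (auto simp: next_pc_def)
qed simp

lemma writes_trial: "writes (trial A) \<subseteq> {5, 6, 7, 8, 14, 15} \<union> {18..<18 + num_regs A}"
  using writes_dispatch[of 0 A] writes_reset[of "num_regs A"]
  by (auto simp: trial_def prepare_def simul_def conclude_def build_def brute_def num_regs_def)

lemma wfc_reduction: "wfc (reduction A ca)"
proof -
  have "wfc (trial A)"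
    using loopfree_dispatch[of 0 A] loopfree_reset[of "num_regs A"] writes_dispatch[of 0 A]
    by (auto simp: trial_def prepare_def simul_def conclude_def build_def brute_def wfc_loopfree)
  moreover have "10 \<notin> writes (trial A)" "11 \<notin> writes (trial A)" "12 \<notin> writes (trial A)"
    "13 \<notin> writes (trial A)" "16 \<notin> writes (trial A)"
    using writes_trial[of A] by auto
  ultimately show ?thesis
    by (auto simp: reduction_def startup_def sample_def rounds_def all_pieces_def vote_def Let_def)
qed

section \<open>Simulation with shorter words\<close>

definition sim_config :: "nat \<Rightarrow> st \<Rightarrow> config" where
  "sim_config S s = \<lparr>pc = vr s 15, regs = (\<lambda>r. vr s (18 + r)),
     mem = (\<lambda>x. if x < S then mm s (vr s 6 + x) else 0)\<rparr>"

definition word_config :: "nat \<Rightarrow> program \<Rightarrow> config \<Rightarrow> bool" where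
  "word_config w A cfg \<longleftrightarrow> (\<forall>r. regs cfg r < 2 ^ w) \<and> (\<forall>x. mem cfg x < 2 ^ w) \<and>
     (\<forall>x\<ge>2 ^ w. mem cfg x = 0) \<and> pc cfg \<le> max_pc A"

lemma sim_config_tick [simp]: "sim_config S (tick k s) = sim_config S s"
  by (simp add: sim_config_def cong: if_cong)

lemma sim_config_asg_14 [simp]: "sim_config S (asg 14 k s) = sim_config S s"
  by (simp add: sim_config_def cong: if_cong)

lemma jump_bound_le: "ins \<in> set A \<Longrightarrow> jump_bound ins \<le> max_pc A"
  using member_le_sum_list[of "jump_bound ins" "map jump_bound A"] by (simp add: max_pc_def)

text \<open>Truncation commutes with addition, multiplication and left shifts, and the remaining
  operations on short words give short results. For \<open>Sub\<close> the two offsets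
  \<open>2 ^ w\<close> and \<open>2 ^ w'\<close> are congruent modulo \<open>2 ^ w'\<close>.\<close>

lemma take_bit_eval_op:
  assumes "w' \<le> w" "x < 2 ^ w'" "y < 2 ^ w'"
  shows "take_bit w' (eval_op w f x y) = eval_op w' f x y"
proof -
  have e: "take_bit w' (eval_op w' f x y) = eval_op w' f x y"
    using eval_op_less[OF assms(2,3)] by (simp add: take_bit_nat_eq_self_iff)
  have pw: "(2::nat) ^ w = 2 ^ w' + 2 ^ w' * (2 ^ (w - w') - 1)"
  proof -
    have "(2::nat) ^ w = 2 ^ w' * 2 ^ (w - w')" using assms(1) by (simp flip: power_add)
    moreover have "(1::nat) \<le> 2 ^ (w - w')" by simp
    ultimately show ?thesis by (metis add_diff_inverse_nat distrib_left mult.right_neutral not_le)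
  qed
  have sub: "take_bit w' (x + 2 ^ w - y) = take_bit w' (x + 2 ^ w' - y)"
  proof -
    have "x + 2 ^ w - y = (x + 2 ^ w' - y) + 2 ^ w' * (2 ^ (w - w') - 1)" using assms(3) pw by simp
    then show ?thesis by (simp add: take_bit_eq_mod)
  qed
  show ?thesis
    using assms(1) sub e by (cases f) (simp_all add: min_absorb1)
qed

lemma and_pred_exp: "semiring_bit_operations_class.and x (2 ^ k - Suc 0) = take_bit k (x::nat)"
  by (simp add: take_bit_eq_mask mask_eq_exp_minus_1)

lemma step_word_config:
  assumes "word_config w A cfg" "cfg' \<in> set_pmf (step w A cfg)"
  shows "word_config w A cfg'"
proof (cases "halted A cfg")
  case True
  then show ?thesis using assms by (simp add: step_def)
next
  case False
  then have pc: "pc cfg < length A" by (simp add: halted_def)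
  then have ins: "A ! pc cfg \<in> set A" by simp
  have S: "Suc (pc cfg) \<le> max_pc A" using pc by (simp add: max_pc_def)
  show ?thesis
    using assms False S jump_bound_le[OF ins] eval_op_less[of _ w]
    by (cases "A ! pc cfg")
      (auto simp: step_def word_config_def set_reg_def set_pmf_of_set lessThan_empty_iff fun_upd_def not_le
        split: if_splits, metis leD)
qed

text \<open>\<open>w\<close> is the word size of the simulating machine, \<open>w'\<close> that of
  the simulated one, and \<open>S\<close> the size of the simulated memory. \<open>pc_bound\<close>
  lets a variable hold the simulated program counter.\<close>

locale simulator =
  fixes A :: program and w w' S :: nat
  assumes w': "0 < w'" "w' \<le> w" and S: "S = 2 ^ w'" and pc_bound: "max_pc A + 1 < 2 ^ w"
begin

definition sim_inv :: "st \<Rightarrow> bool" where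
  "sim_inv s \<longleftrightarrow> vr s 4 = S \<and> vr s 6 + S \<le> 2 ^ w \<and> word_config w' A (sim_config S s)"

lemma sim_inv_tick [simp]: "sim_inv (tick k s) = sim_inv s"
  by (simp add: sim_inv_def)

lemma aval_clip: "vr s 4 = S \<Longrightarrow> aval w (clip e) s = take_bit w' (aval w e s)"
proof -
  assume s: "vr s 4 = S"
  have "w > 0" using w' by simp
  then have 1: "take_bit w (1::nat) = 1" by (simp add: take_bit_nat_eq_self_iff)
  have le: "(2::nat) ^ w' \<le> 2 ^ w" using w' by simp
  have "(2::nat) ^ w' + 2 ^ w - 1 = (2 ^ w' - 1) + 2 ^ w" by simp
  moreover have "(2::nat) ^ w' - 1 < 2 ^ w" using le by (rule less_le_trans[rotated]) simp
  ultimately have "take_bit w (2 ^ w' + 2 ^ w - 1) = (2 ^ w' - 1 :: nat)"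
    by (simp only: take_bit_eq_mod mod_add_self2 mod_less)
  then show ?thesis using s 1 by (simp add: clip_def S and_pred_exp)
qed

lemma simulate:
  assumes inv: "sim_inv s" and pc: "vr s 15 + 1 < 2 ^ w" and j: "jump_bound ins < 2 ^ w"
  shows "map_pmf (sim_config S) (sem w (simulate ins) s) = exec w' ins (sim_config S s)"
proof -
  have w0: "take_bit w (Suc 0) = Suc 0" using w' by (simp add: take_bit_nat_eq_self_iff)
  have S4: "vr s 4 = S" and r: "\<And>r. vr s (18 + r) < 2 ^ w'"
    and base: "vr s 6 + S \<le> 2 ^ w"
    using inv by (auto simp: sim_inv_def word_config_def sim_config_def)
  have b: "take_bit w (vr s 6 + vr s (18 + r)) = vr s 6 + vr s (18 + r)" for r
    using r[of r] base S by (simp add: take_bit_nat_eq_self_iff)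
  have p: "take_bit w (vr s 15 + 1) = vr s 15 + 1" using pc by (simp add: take_bit_nat_eq_self_iff)
  have tt: "take_bit w' (take_bit w k) = take_bit w' k" for k :: nat using w' by (simp add: min_absorb1)
  show ?thesis
  proof (cases ins)
    case (Const x k)
    then show ?thesis
      using p w0 tt by (simp add: bind_return_pmf next_pc_def aval_clip S4 sim_config_def set_reg_def fun_eq_iff)
  next
    case (Op f x y z)
    then show ?thesis
      using p w0 take_bit_eval_op[OF w'(2) r r]
      by (simp add: bind_return_pmf next_pc_def aval_clip S4 sim_config_def set_reg_def fun_eq_iff)
  next
    case (Load x y)
    then show ?thesis
      using p w0 b r[of y] S by (simp add: bind_return_pmf next_pc_def sim_config_def set_reg_def fun_eq_iff)
  next
    case (Store x y)
    then show ?thesis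
      using p w0 b r[of x] S by (auto simp: bind_return_pmf next_pc_def sim_config_def set_reg_def fun_eq_iff)
  next
    \<comment> \<open>A uniform long word, clipped, is a uniform short word.\<close>
    case (Rand x)
    have "map_pmf (sim_config S) (sem w (simulate ins) s) =
        map_pmf (\<lambda>v. set_reg x (take_bit w' v) (sim_config S s)) (pmf_of_set {..<2 ^ w})"
      using p w0 S4 unfolding Rand
      by (simp add: map_bind_pmf bind_map_pmf map_pmf_def bind_assoc_pmf bind_return_pmf)
        (auto intro!: bind_pmf_cong simp: bind_return_pmf next_pc_def aval_clip sim_config_def set_reg_def fun_eq_iff)
    also have "\<dots> = map_pmf (\<lambda>v. set_reg x v (sim_config S s)) (map_pmf (\<lambda>v. v mod 2 ^ w') (pmf_of_set {..<2 ^ w}))"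
      by (simp add: map_pmf_comp take_bit_eq_mod)
    finally show ?thesis using Rand by (simp add: map_mod_pmf_of_set[OF w'(2)])
  next
    case (Jump_Zero x l)
    then have "take_bit w l = l" using j by (simp add: take_bit_nat_eq_self_iff)
    then show ?thesis
      using p w0 Jump_Zero by (simp add: bind_return_pmf next_pc_def sim_config_def fun_eq_iff)
  qed
qed

text \<open>Short addresses cannot leave the region, so neither the input matrix nor the regions
  reserved for later runs are touched.\<close>

lemma simulate_mem:
  assumes inv: "sim_inv s"
  shows "wp w (simulate ins) (\<lambda>s'. \<forall>x. x < vr s 6 \<or> vr s 6 + S \<le> x \<longrightarrow> mm s' x = mm s x) s"
proof -
  have "vr s (18 + r) < S" and b: "vr s 6 + S \<le> 2 ^ w" for r
    using inv unfolding sim_inv_def word_config_def sim_config_def by (auto simp: S)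
  moreover from this have "take_bit w (vr s 6 + vr s (18 + r)) = vr s 6 + vr s (18 + r)" for r
    by (metis add_less_cancel_left less_le_trans take_bit_nat_eq_self_iff)
  ultimately show ?thesis by (cases ins) (auto simp: next_pc_def wp_Rnd not_le, metis leD)
qed

text \<open>The ticks stay existential: \<open>sim_config\<close> ignores the clock, and time is
  bounded separately through \<open>loopfree_tm\<close>.\<close>

lemma dispatch_hit:
  assumes "i \<le> vr s 15" "vr s 15 < i + length xs" "i + length xs \<le> 2 ^ w"
  shows "\<exists>t u. sem w (dispatch i xs) s = map_pmf (tick u) (sem w (simulate (xs ! (vr s 15 - i))) (tick t s))"
  using assms
proof (induction xs arbitrary: i s)
  case (Cons ins xs)
  have i: "take_bit w i = i" using Cons.prems by (simp add: take_bit_nat_eq_self_iff)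
  have w0: "take_bit w (Suc 0) = Suc 0" using w' by (simp add: take_bit_nat_eq_self_iff)
  show ?case
  proof (cases "vr s 15 = i")
    case True
    then have "sem w (dispatch i (ins # xs)) s = map_pmf (tick 2) (sem w (simulate ins) (tick 4 s))"
      using i w0 by (simp add: eval_nat_numeral)
    then show ?thesis using True by auto
  next
    case False
    let ?s = "tick 4 s"
    have "sem w (dispatch i (ins # xs)) s = sem w (dispatch (Suc i) xs) ?s"
      using i False by (simp add: eval_nat_numeral)
    moreover obtain t u where "sem w (dispatch (Suc i) xs) ?s =
        map_pmf (tick u) (sem w (simulate (xs ! (vr ?s 15 - Suc i))) (tick t ?s))"
      using Cons.IH[of "Suc i" ?s] Cons.prems False by auto
    moreover have "tick t ?s = tick (4 + t) s" by (simp add: tick_def)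
    moreover have "(ins # xs) ! (vr s 15 - i) = xs ! (vr ?s 15 - Suc i)"
      using False Cons.prems by (simp add: nth_Cons')
    ultimately show ?thesis by auto
  qed
qed simp

lemma dispatch_miss:
  assumes "i + length xs \<le> vr s 15" "i + length xs \<le> 2 ^ w"
  shows "\<exists>t. sem w (dispatch i xs) s = return_pmf (tick t s)"
  using assms
proof (induction xs arbitrary: i s)
  case Nil
  have "tick 0 s = s" by (simp add: tick_def)
  then show ?case by (metis dispatch.simps(1) sem.simps(1))
next
  case (Cons ins xs)
  have i: "take_bit w i = i" using Cons.prems by (simp add: take_bit_nat_eq_self_iff)
  then have "sem w (dispatch i (ins # xs)) s = sem w (dispatch (Suc i) xs) (tick 4 s)"
    using Cons.prems by (simp add: eval_nat_numeral)
  moreover obtain t where "sem w (dispatch (Suc i) xs) (tick 4 s) = return_pmf (tick t (tick 4 s))"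
    using Cons.IH[of "Suc i" "tick 4 s"] Cons.prems by auto
  moreover have "tick t (tick 4 s) = tick (4 + t) s" by (simp add: tick_def)
  ultimately show ?case by auto
qed

lemma dispatch_step:
  assumes inv: "sim_inv s"
  shows "map_pmf (sim_config S) (sem w (dispatch 0 A) s) = step w' A (sim_config S s)"
    and "wp w (dispatch 0 A) (\<lambda>s'. sim_inv s' \<and> (\<forall>x. x < vr s 6 \<or> vr s 6 + S \<le> x \<longrightarrow> mm s' x = mm s x)) s"
proof -
  have len: "length A \<le> 2 ^ w" using pc_bound by (simp add: max_pc_def)
  have main: "map_pmf (sim_config S) (sem w (dispatch 0 A) s) = step w' A (sim_config S s) \<and>
     wp w (dispatch 0 A) (\<lambda>s'. \<forall>x. x < vr s 6 \<or> vr s 6 + S \<le> x \<longrightarrow> mm s' x = mm s x) s"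
  proof (cases "vr s 15 < length A")
    case True
    let ?ins = "A ! vr s 15"
    obtain t u where eq: "sem w (dispatch 0 A) s = map_pmf (tick u) (sem w (simulate ?ins) (tick t s))"
      using dispatch_hit[of 0 s A] True len by auto
    have "jump_bound ?ins < 2 ^ w" using jump_bound_le[of ?ins A] True pc_bound by fastforce
    moreover have "vr s 15 + 1 < 2 ^ w" using True pc_bound by (simp add: max_pc_def)
    ultimately have "map_pmf (sim_config S) (sem w (simulate ?ins) (tick t s)) = exec w' ?ins (sim_config S s)"
      using simulate[of "tick t s" ?ins] inv by simp
    moreover have "step w' A (sim_config S s) = exec w' ?ins (sim_config S s)"
      using True by (simp add: step_def halted_def sim_config_def)
    ultimately show ?thesis
      using simulate_mem[of "tick t s" ?ins] inv eq by (simp add: map_pmf_comp wp_def)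
  next
    case False
    then obtain t where "sem w (dispatch 0 A) s = return_pmf (tick t s)"
      using dispatch_miss[of 0 A s] len by auto
    then show ?thesis using False by (auto simp: wp_def step_def halted_def sim_config_def)
  qed
  then show "map_pmf (sim_config S) (sem w (dispatch 0 A) s) = step w' A (sim_config S s)" by simp
  have fr: "vr s' 4 = vr s 4 \<and> vr s' 6 = vr s 6" if "s' \<in> set_pmf (sem w (dispatch 0 A) s)" for s'
  proof -
    have "4 \<notin> writes (dispatch 0 A)" "6 \<notin> writes (dispatch 0 A)" using writes_dispatch[of 0 A] by auto
    then show ?thesis using sem_frame[OF that] by simp
  qed
  have "word_config w' A (sim_config S s')" if "s' \<in> set_pmf (sem w (dispatch 0 A) s)" for s'
  proof (rule step_word_config)
    show "word_config w' A (sim_config S s)" using inv by (simp add: sim_inv_def)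
    have "sim_config S s' \<in> set_pmf (map_pmf (sim_config S) (sem w (dispatch 0 A) s))" using that by simp
    then show "sim_config S s' \<in> set_pmf (step w' A (sim_config S s))" using main by simp
  qed
  then show "wp w (dispatch 0 A) (\<lambda>s'. sim_inv s' \<and> (\<forall>x. x < vr s 6 \<or> vr s 6 + S \<le> x \<longrightarrow> mm s' x = mm s x)) s"
    using main fr inv by (auto simp: wp_def sim_inv_def)
qed

lemma simul_run:
  assumes "sim_inv s"
  shows "map_pmf (sim_config S) (sem w (simul A) s) = run w' A (vr s 7) (sim_config S s)"
    and "wp w (simul A) (\<lambda>s'. \<forall>x. x < vr s 6 \<or> vr s 6 + S \<le> x \<longrightarrow> mm s' x = mm s x) s"
proof -
  have "map_pmf (sim_config S) (loop 14 (sem w (dispatch 0 A)) k s) = run w' A k (sim_config S s)"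
    if "sim_inv s" for k s
    using that
  proof (induction k arbitrary: s)
    case (Suc k)
    have inv: "sim_inv (tick 3 (asg 14 k s))" using Suc.prems by (simp add: sim_inv_def)
    let ?p = "sem w (dispatch 0 A) (tick 3 (asg 14 k s))"
    have "map_pmf (sim_config S) (loop 14 (sem w (dispatch 0 A)) (Suc k) s)
        = bind_pmf ?p (\<lambda>s'. map_pmf (sim_config S) (loop 14 (sem w (dispatch 0 A)) k (tick 2 s')))"
      by (simp add: map_bind_pmf)
    also have "\<dots> = bind_pmf ?p (\<lambda>s'. run w' A k (sim_config S s'))"
      by (rule bind_pmf_cong) (use Suc.IH dispatch_step(2)[OF inv] in \<open>auto simp: wp_def\<close>)
    also have "\<dots> = bind_pmf (map_pmf (sim_config S) ?p) (run w' A k)" by (simp add: bind_map_pmf)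
    finally show ?case by (simp add: dispatch_step(1)[OF inv])
  qed simp
  from this[of "tick 2 s" "vr s 7"] assms
  show "map_pmf (sim_config S) (sem w (simul A) s) = run w' A (vr s 7) (sim_config S s)"
    by (simp add: simul_def eval_nat_numeral)
  have m: "wp w (simul A) (\<lambda>s'. sim_inv s' \<and> vr s' 6 = vr s 6 \<and>
     (\<forall>x. x < vr s 6 \<or> vr s 6 + S \<le> x \<longrightarrow> mm s' x = mm s x)) s" (is "wp _ _ ?Q s")
    unfolding simul_def
  proof (rule wp_For[where I = "\<lambda>_. ?Q"])
    fix k s' assume Q: "?Q s'"
    then have "sim_inv (tick 3 (asg 14 k s'))" by (simp add: sim_inv_def)
    note st = wp_conj[OF dispatch_step(2)[OF this] wp_frame]
    have "6 \<notin> writes (dispatch 0 A)" using writes_dispatch[of 0 A] by auto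
    then show "wp w (dispatch 0 A) (\<lambda>s'. ?Q (tick 2 s')) (tick 3 (asg 14 k s'))"
      by (intro wp_mono[OF st]) (use Q in auto)
  qed (use assms in \<open>auto simp: sim_inv_def\<close>)
  then show "wp w (simul A) (\<lambda>s'. \<forall>x. x < vr s 6 \<or> vr s 6 + S \<le> x \<longrightarrow> mm s' x = mm s x) s"
    by (rule wp_mono) simp
qed

end

section \<open>Building and searching a piece\<close>

lemma For_tm':
  assumes "loopfree c"
  shows "wp w (For x e c) (\<lambda>s'. tm s' \<le> tm s + (aval w e s + 1) * clen (For x e c)) s"
proof -
  have "aval w e s * (clen c + 5) + elen e + 2 \<le> (aval w e s + 1) * clen (For x e c)"
    by (simp add: algebra_simps)
  then show ?thesis by (intro wp_mono[OF For_tm[OF assms]]) simp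
qed

lemma run_add: "run w P (a + b) c = bind_pmf (run w P a c) (run w P b)"
  by (induction a arbitrary: c) (auto simp: bind_return_pmf bind_assoc_pmf intro!: bind_pmf_cong)

lemma flat_less: "x < N \<Longrightarrow> y < N \<Longrightarrow> k \<le> N \<Longrightarrow> x * k + y < N * (N :: nat)"
proof -
  assume h: "x < N" "y < N" "k \<le> N"
  have "x * k + y < x * N + N" using h by (intro add_le_less_mono mult_left_mono) auto
  also have "\<dots> = Suc x * N" by simp
  also have "\<dots> \<le> N * N" using h by (intro mult_right_mono) auto
  finally show ?thesis .
qed

lemma ex_ge_Suc: "(\<exists>t\<ge>k. P t) \<longleftrightarrow> P k \<or> (\<exists>t\<ge>Suc k. P t)"
proof
  assume "\<exists>t\<ge>k. P t"
  then obtain t where "k \<le> t" "P t" by blast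
  then show "P k \<or> (\<exists>t\<ge>Suc k. P t)" by (cases "t = k") auto
next
  assume "P k \<or> (\<exists>t\<ge>Suc k. P t)"
  then show "\<exists>t\<ge>k. P t" using Suc_leD by blast
qed

lemma run_halted: "halted P c \<Longrightarrow> run w P t c = return_pmf c"
  by (induction t) (simp_all add: step_def bind_return_pmf)

text \<open>\<open>4 <= l\<close> makes the division by 16 exact, and
  \<open>16 * d < 2 * m + 4\<close> leaves room for three blocks of length \<open>d\<close> among
  \<open>m\<close> vertices.\<close>

lemma block_size:
  fixes l m :: nat
  assumes "4 \<le> l" "2 ^ l < 2 * (m + 2)"
  shows "16 * (2 ^ l div 16) = (2::nat) ^ l" "0 < (2::nat) ^ l div 16" "3 * (2 ^ l div 16) \<le> m"
proof -
  define d where "d = (2::nat) ^ (l - 4)"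
  have l: "(2::nat) ^ l = 16 * d" using assms(1) power_add[of "2::nat" 4 "l - 4"] by (simp add: d_def)
  have d: "0 < d" by (simp add: d_def)
  have "16 * d < 2 * m + 4" using assms(2) l by simp
  then have "3 * d \<le> m" using d by simp
  then show "16 * (2 ^ l div 16) = (2::nat) ^ l" "0 < (2::nat) ^ l div 16" "3 * (2 ^ l div 16) \<le> m"
    using d by (simp_all add: l)
qed

text \<open>The requirement of \<open>triangle_detection\<close> for a single graph, so that the
  promise is discharged once and need not be carried through the program proof.\<close>

definition solves :: "program \<Rightarrow> nat \<Rightarrow> nat \<Rightarrow> nat \<Rightarrow> nat graph \<Rightarrow> bool" where
  "solves A w' TT m \<Gamma> \<longleftrightarrow> (let R = run w' A TT (input_config m \<Gamma>) in
     (\<forall>s\<in>set_pmf R. halted A s) \<and> measure_pmf.prob R {s. answer s \<longleftrightarrow> has_triangle \<Gamma>} \<ge> 2 / 3)"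

text \<open>A halted configuration does not change any more, so a wrong answer present at time
  \<open>t\<close> is still present at time \<open>TT\<close>. Stopping early therefore never
  creates wrong answers, only missing ones.\<close>

lemma solves_error:
  assumes "solves A w' TT m \<Gamma>" "t \<le> TT"
  shows "emeasure (run w' A t (input_config m \<Gamma>)) {c. halted A c \<and> answer c \<noteq> has_triangle \<Gamma>} \<le> ennreal (1 / 3)"
proof -
  define R where "R = run w' A TT (input_config m \<Gamma>)"
  define R' where "R' = run w' A t (input_config m \<Gamma>)"
  let ?W = "{c. answer c \<noteq> has_triangle \<Gamma>}"
  have R: "R = bind_pmf R' (run w' A (TT - t))"
    using run_add[of w' A t "TT - t"] assms(2) by (simp add: R_def R'_def)
  have "emeasure R' {c. halted A c \<and> answer c \<noteq> has_triangle \<Gamma>}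
      = (\<integral>\<^sup>+c. indicator {c. halted A c \<and> answer c \<noteq> has_triangle \<Gamma>} c \<partial>measure_pmf R')" by simp
  also have "\<dots> \<le> (\<integral>\<^sup>+c. emeasure (run w' A (TT - t) c) ?W \<partial>measure_pmf R')"
    by (rule nn_integral_mono) (auto simp: indicator_def run_halted)
  also have "\<dots> = emeasure R ?W" by (simp add: R emeasure_bind_pmf)
  also have "\<dots> = ennreal (measure_pmf.prob R ?W)" by (simp add: measure_pmf.emeasure_eq_measure)
  also have "measure_pmf.prob R ?W = 1 - measure_pmf.prob R {c. answer c = has_triangle \<Gamma>}"
  proof -
    have "?W = space (measure_pmf R) - {c. answer c = has_triangle \<Gamma>}" by auto
    then show ?thesis using measure_pmf.prob_compl[of "{c. answer c = has_triangle \<Gamma>}" R] by simp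
  qed
  also have "ennreal \<dots> \<le> ennreal (1 / 3)"
    using assms(1) by (intro ennreal_leI) (simp add: solves_def R_def Let_def)
  finally show ?thesis by (simp add: R'_def)
qed

lemma wp_reset: "wp w (reset k) (\<lambda>s'. mm s' = mm s \<and> (\<forall>x. vr s' x = (if 18 \<le> x \<and> x < 18 + k then 0 else vr s x))) s"
proof (induction k)
  case (Suc k)
  show ?case
    unfolding reset.simps wp_simps
    by (rule wp_mono[OF Suc]) auto
qed simp

text \<open>The last assumption is all that is known about the given algorithm; about pieces with
  several triangles it is silent. \<open>64 * q ^ 7 < 2 ^ w\<close> keeps counters and matrix
  addresses within words, and \<open>Tot\<close> is the time bound to be met.\<close>

locale reduction_run = simulator +
  fixes n m l q TT Tot :: nat and G :: "nat graph"
  assumes G: "simple_graph G" "verts G = {..<n}" "n > 0"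
    and m: "m * m \<le> n" "n < (m + 1) * (m + 1)"
    and q: "q = 2 ^ l" "m + 2 \<le> q" "q < 2 * (m + 2)" "4 \<le> l"
    and mS: "m * m \<le> S"
    and w: "64 * q ^ 7 < 2 ^ w" "6 * l \<le> w"
    and solves: "\<And>a i j k. odd a \<Longrightarrow> a < q * q \<Longrightarrow> i < 16 * q \<Longrightarrow> j < i \<Longrightarrow> k < j \<Longrightarrow>
      card (triangles (piece G n m (q * q) (q div 16) a (i, j, k))) \<le> 1 \<Longrightarrow>
      solves A w' TT m (piece G n m (q * q) (q div 16) a (i, j, k))"
begin

abbreviation "p \<equiv> q * q"
abbreviation "L \<equiv> q div 16"
abbreviation "g \<equiv> 16 * q"

definition inp :: "nat \<Rightarrow> nat" where
  "inp x = (if {x div n, x mod n} \<in> edges G then 1 else 0)"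

definition core :: "st \<Rightarrow> bool" where
  "core s \<longleftrightarrow> vr s 0 = n \<and> vr s 1 = m \<and> vr s 2 = l \<and> vr s 3 = q \<and> vr s 4 = S \<and>
     (\<forall>r\<ge>num_regs A. vr s (18 + r) = 0) \<and> (\<forall>x<n * n. mm s x = inp x)"

definition PG :: "st \<Rightarrow> nat graph" where
  "PG s = piece G n m p L (vr s 9) (vr s 10, vr s 11, vr s 12)"

definition at_piece :: "st \<Rightarrow> bool" where
  "at_piece s \<longleftrightarrow> odd (vr s 9) \<and> vr s 9 < p \<and> vr s 10 < g \<and> vr s 11 < vr s 10 \<and> vr s 12 < vr s 11"

lemma L_bounds: "16 * L = q" "L > 0"
  using block_size(1,2)[of l m] q by simp_all

lemma g_mult_L: "g * L = p" using L_bounds by (metis mult.assoc mult.commute)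

lemma p_pow: "p = 2 ^ (2 * l)" by (simp add: q(1) power_add[symmetric] mult_2)

lemma n_le_p: "n \<le> p"
proof -
  have "(m + 1) * (m + 1) \<le> q * q" using q(2) by (intro mult_mono) auto
  then show ?thesis using m(2) by simp
qed

lemma three_L_le_m: "3 * L \<le> m"
  using block_size(3)[of l m] q by simp

lemma q_ge: "16 \<le> q" using L_bounds by linarith

lemma qpow_less: "j \<le> 7 \<Longrightarrow> c \<le> 64 \<Longrightarrow> c * q ^ j < 2 ^ w"
proof -
  assume "j \<le> 7" "c \<le> 64"
  then have "c * q ^ j \<le> 64 * q ^ 7" using q_ge by (intro mult_mono power_increasing) auto
  then show ?thesis using w(1) by simp
qed

lemma small: "x \<le> 1024 \<Longrightarrow> take_bit w x = (x::nat)"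
proof -
  assume "x \<le> 1024"
  have "64 * 16 \<le> 64 * q" using q_ge by simp
  then show ?thesis using qpow_less[of 1 64] \<open>x \<le> 1024\<close> by (simp add: take_bit_nat_eq_self_iff)
qed

lemma p_less: "p < 2 ^ w" "p * p < 2 ^ w" "p * p * p < 2 ^ w" "g < 2 ^ w" "q < 2 ^ w"
  using qpow_less[of 2 1] qpow_less[of 4 1] qpow_less[of 6 1] qpow_less[of 1 16] qpow_less[of 1 1]
  by (simp_all add: eval_nat_numeral mult.assoc)

lemma m_le_q: "m \<le> q" using q by simp

lemma m_less: "m * m < 2 ^ w" "m * m * m < 2 ^ w"
  using p_less mult_mono[OF m_le_q m_le_q] mult_mono[OF mult_mono[OF m_le_q m_le_q] m_le_q] qpow_less[of 3 1]
  by (simp_all add: eval_nat_numeral mult.assoc)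

lemma take_bit_word: "x < 2 ^ w \<Longrightarrow> take_bit w x = (x :: nat)"
  by (simp add: take_bit_nat_eq_self_iff)

lemma aval_consts:
  assumes "core s"
  shows "aval w eL s = L" "aval w ep s = p" "aval w eg s = g"
  using assms p_less small[of 16] by (simp_all add: eL_def ep_def eg_def core_def take_bit_word)

lemma aval_evert:
  assumes "core s" "at_piece s"
  shows "aval w (evert u) s = pvert p L (vr s 9) (vr s 10, vr s 11, vr s 12) (aval w u s)"
proof -
  define x where "x = aval w u s"
  define f where "f = (if x div L = 0 then vr s 10 else if x div L = 1 then vr s 11 else if x div L = 2 then vr s 12 else 0)"
  have fg: "f < g" using assms(2) by (auto simp: f_def at_piece_def)
  then have "Suc f * L \<le> g * L" by (intro mult_right_mono) auto
  moreover have "x mod L < L" using L_bounds by simp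
  ultimately have pos: "f * L + x mod L < p" unfolding g_mult_L by simp
  have "vr s 9 * (f * L + x mod L) \<le> p * p"
    using assms(2) pos by (intro mult_mono) (auto simp: at_piece_def)
  then have 1: "vr s 9 * (f * L + x mod L) < 2 ^ w" using p_less by simp
  have i: "vr s 10 < 2 ^ w" "vr s 11 < 2 ^ w" "vr s 12 < 2 ^ w" using assms(2) p_less by (auto simp: at_piece_def)
  have 2: "f * L < 2 ^ w" "f * L + x mod L < 2 ^ w" using pos p_less by simp_all
  have w1: "take_bit w (Suc 0) = Suc 0" using small[of 1] by simp
  have 3: "aval w (Vr 10 \<otimes> (u \<oslash> eL \<doteq> Nm 0) \<oplus> Vr 11 \<otimes> (u \<oslash> eL \<doteq> Nm 1) \<oplus> Vr 12 \<otimes> (u \<oslash> eL \<doteq> Nm 2)) s = f"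
    using i w1 small[of 2]
    by (simp add: aval_consts[OF assms(1)] x_def[symmetric] f_def take_bit_word)
  show ?thesis
    unfolding evert_def aval.simps(3) 3[simplified aval.simps(3)]
    using 1 2 by (simp add: aval_consts[OF assms(1)] x_def[symmetric] take_bit_word pvert_def f_def[symmetric])
qed

lemma aval_eadj:
  assumes "core s" "at_piece s"
  shows "aval w (eadj u v) s = of_bool ({aval w u s, aval w v s} \<in> edges (PG s))"
proof -
  define x where "x = aval w u s"
  define y where "y = aval w v s"
  let ?f = "pvert p L (vr s 9) (vr s 10, vr s 11, vr s 12)"
  have w1: "take_bit w (Suc 0) = Suc 0" using small[of 1] by simp
  have "3 * L \<le> q" using L_bounds by linarith
  then have three_L_le_m: "take_bit w (3 * L) = 3 * L" using p_less by (simp add: take_bit_word)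
  have s0: "vr s 0 = n" using assms(1) by (simp add: core_def)
  have "0 < p" using q_ge by simp
  then have fp: "?f z < p" for z by (simp add: pvert_def split del: if_split)
  have "?f x * n + ?f y < p * p" by (rule flat_less[OF fp fp n_le_p])
  then have a: "take_bit w (?f x * n) = ?f x * n" "take_bit w (?f x * n + ?f y) = ?f x * n + ?f y"
    using p_less(2) by (simp_all add: take_bit_word)
  have ld: "mm s (?f x * n + ?f y) = of_bool ({?f x, ?f y} \<in> edges G)" if "?f x < n" "?f y < n"
  proof -
    have "Suc (?f x) * n \<le> n * n" using that by (intro mult_right_mono) auto
    then have "?f x * n + ?f y < n * n" using that by simp
    then show ?thesis using assms(1) that by (simp add: core_def inp_def)
  qed
  show ?thesis
    unfolding eadj_def
    by (simp add: aval_evert[OF assms] aval_consts[OF assms(1)] x_def[symmetric] y_def[symmetric]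
        small[of 3] three_L_le_m s0 a w1 PG_def piece_edge pvalid_def)
      (use w' in \<open>auto simp: ld take_bit_word\<close>)
qed

lemma core_at_frame:
  assumes "core s" "at_piece s" "\<And>x. x \<notin> {5, 6, 7, 8, 13, 14, 15} \<Longrightarrow> vr s' x = vr s x"
    "\<And>x. x < n * n \<Longrightarrow> mm s' x = mm s x"
  shows "core s'" "at_piece s'" "PG s' = PG s"
  using assms by (auto simp: core_def at_piece_def PG_def)

lemma wp_build:
  assumes "core s" "at_piece s" "n * n \<le> vr s 6" "vr s 6 + m * m \<le> 2 ^ w"
  shows "wp w build (\<lambda>s'. (\<forall>x. x \<noteq> 14 \<longrightarrow> vr s' x = vr s x) \<and>
     mm s' = (\<lambda>x. if vr s 6 \<le> x \<and> x < vr s 6 + m * m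
       then of_bool ({(x - vr s 6) div m, (x - vr s 6) mod m} \<in> edges (PG s)) else mm s x)) s"
proof -
  let ?b = "vr s 6"
  \<comment> \<open>The loop counts down, so the cells from offset \<open>k\<close> upwards are
    those already written.\<close>
  define M where "M k = (\<lambda>x. if ?b + k \<le> x \<and> x < ?b + m * m
       then of_bool ({(x - ?b) div m, (x - ?b) mod m} \<in> edges (PG s)) else mm s x)" for k
  have s1: "vr s 1 = m" using assms(1) by (simp add: core_def)
  have len: "aval w (Vr 1 \<otimes> Vr 1) s = m * m" using s1 m_less by (simp add: take_bit_word)
  show ?thesis
    unfolding build_def
  proof (rule wp_For[where I = "\<lambda>k s'. (\<forall>x. x \<noteq> 14 \<longrightarrow> vr s' x = vr s x) \<and> mm s' = M k"])
    show "(\<forall>x. x \<noteq> 14 \<longrightarrow> vr (tick (elen (Vr 1 \<otimes> Vr 1) + 1) s) x = vr s x) \<and>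
       mm (tick (elen (Vr 1 \<otimes> Vr 1) + 1) s) = M (aval w (Vr 1 \<otimes> Vr 1) s)"
      unfolding len by (simp add: M_def fun_eq_iff)
  next
    fix k and s' :: st assume k: "k < aval w (Vr 1 \<otimes> Vr 1) s"
      and I: "(\<forall>x. x \<noteq> 14 \<longrightarrow> vr s' x = vr s x) \<and> mm s' = M (Suc k)"
    let ?s = "tick 3 (asg 14 k s')"
    have fr: "core ?s" "at_piece ?s" "PG ?s = PG s"
      using core_at_frame[OF assms(1,2), of ?s] I assms(3) by (auto simp: M_def)
    have km: "k < m * m" using k len by simp
    have "take_bit w (?b + k) = ?b + k" using km assms(4) by (simp add: take_bit_word)
    moreover have "(M (Suc k))(?b + k := of_bool ({k div m, k mod m} \<in> edges (PG s))) = M k"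
      using km by (auto simp: M_def fun_eq_iff not_less_eq_eq)
    ultimately show "wp w (Sto (Vr 6 \<oplus> Vr 14) (eadj (Vr 14 \<oslash> Vr 1) (Vr 14 \<odot> Vr 1)))
       (\<lambda>s'. (\<forall>x. x \<noteq> 14 \<longrightarrow> vr (tick 2 s') x = vr s x) \<and> mm (tick 2 s') = M k) ?s"
      using I s1 by (simp add: aval_eadj[OF fr(1,2)] fr(3))
  qed (simp add: M_def)
qed

lemma has_triangle_PG:
  "has_triangle (PG s) \<longleftrightarrow> (\<exists>t<m * m * m. {t div m div m, t div m mod m} \<in> edges (PG s) \<and>
     {t div m mod m, t mod m} \<in> edges (PG s) \<and> {t div m div m, t mod m} \<in> edges (PG s))"
proof
  assume "has_triangle (PG s)"
  then obtain x y z where e: "{x, y} \<in> edges (PG s)" "{y, z} \<in> edges (PG s)" "{x, z} \<in> edges (PG s)"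
    unfolding has_triangle_iff by blast
  then have "x < m" "y < m" "z < m" using three_L_le_m by (auto simp: PG_def piece_edge pvalid_def)
  define t where "t = (x * m + y) * m + z"
  have "Suc x * m \<le> m * m" using \<open>x < m\<close> by (intro mult_right_mono) auto
  then have "Suc (x * m + y) \<le> m * m" using \<open>y < m\<close> by simp
  then have "Suc (x * m + y) * m \<le> m * m * m" by (rule mult_right_mono) simp
  then have "t < m * m * m" using \<open>z < m\<close> by (simp add: t_def)
  moreover have "t div m = x * m + y" "t mod m = z" "(x * m + y) div m = x" "(x * m + y) mod m = y"
    using \<open>y < m\<close> \<open>z < m\<close> by (simp_all add: t_def)
  ultimately show "\<exists>t<m * m * m. {t div m div m, t div m mod m} \<in> edges (PG s) \<and>
     {t div m mod m, t mod m} \<in> edges (PG s) \<and> {t div m div m, t mod m} \<in> edges (PG s)"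
    using e by (intro exI[of _ t]) simp
qed (auto simp: has_triangle_iff)

lemma wp_brute:
  assumes "core s" "at_piece s"
  shows "wp w brute (\<lambda>s'. (\<forall>x. x \<noteq> 5 \<and> x \<noteq> 14 \<longrightarrow> vr s' x = vr s x) \<and> mm s' = mm s \<and>
     vr s' 5 = (if has_triangle (PG s) then 1 else vr s 5)) s"
proof -
  define tri where "tri t \<longleftrightarrow> {t div m div m, t div m mod m} \<in> edges (PG s) \<and>
     {t div m mod m, t mod m} \<in> edges (PG s) \<and> {t div m div m, t mod m} \<in> edges (PG s)" for t
  have s1: "vr s 1 = m" using assms(1) by (simp add: core_def)
  have len: "aval w (Vr 1 \<otimes> Vr 1 \<otimes> Vr 1) s = m * m * m" using s1 m_less by (simp add: take_bit_word)
  let ?I = "\<lambda>k (s' :: st). (\<forall>x. x \<noteq> 5 \<and> x \<noteq> 14 \<longrightarrow> vr s' x = vr s x) \<and> mm s' = mm s \<and>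
     vr s' 5 = (if \<exists>t\<ge>k. t < m * m * m \<and> tri t then 1 else vr s 5)"
  have w1: "take_bit w (Suc 0) = Suc 0" using small[of 1] by simp
  show ?thesis
    unfolding brute_def
  proof (rule wp_For[where I = ?I])
    fix k and s' :: st assume k: "k < aval w (Vr 1 \<otimes> Vr 1 \<otimes> Vr 1) s" and I: "?I (Suc k) s'"
    let ?s = "tick 3 (asg 14 k s')"
    have fr: "core ?s" "at_piece ?s" "PG ?s = PG s"
      using core_at_frame[OF assms(1,2), of ?s] I by auto
    have v: "vr ?s 1 = m" using I s1 by (simp add: numeral_eq_Suc)
    have vk: "vr ?s 14 = k" by simp
    have tb: "take_bit w (of_bool P * of_bool Q :: nat) = of_bool (P \<and> Q)" for P Q
      using w1 by simp
    have ex: "(\<exists>t\<ge>k. t < m * m * m \<and> tri t) \<longleftrightarrow> tri k \<or> (\<exists>t\<ge>Suc k. t < m * m * m \<and> tri t)"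
    proof -
      have "k < m * m * m" using k unfolding len .
      then show ?thesis unfolding ex_ge_Suc[of k] by blast
    qed
    have val: "(if \<exists>t\<ge>k. t < m * m * m \<and> tri t then 1 else vr s 5) = (if tri k then 1 else vr s' 5)"
    proof -
      have "vr s' 5 = (if \<exists>t\<ge>Suc k. t < m * m * m \<and> tri t then 1 else vr s 5)" using I by blast
      then show ?thesis unfolding ex by (cases "tri k") (simp_all only: simp_thms if_True if_False)
    qed
    from I have fr': "\<forall>x. x \<noteq> 5 \<and> x \<noteq> 14 \<longrightarrow> vr s' x = vr s x" "mm s' = mm s" by blast+
    let ?e = "eadj (Vr 14 \<oslash> Vr 1 \<oslash> Vr 1) (Vr 14 \<oslash> Vr 1 \<odot> Vr 1) \<otimes> eadj (Vr 14 \<oslash> Vr 1 \<odot> Vr 1) (Vr 14 \<odot> Vr 1)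
        \<otimes> eadj (Vr 14 \<oslash> Vr 1 \<oslash> Vr 1) (Vr 14 \<odot> Vr 1)"
    have e: "aval w ?e ?s = of_bool (tri k)"
      by (simp only: aval.simps eval_op.simps aval_eadj[OF fr(1,2)] fr(3) tb v vk tri_def conj_assoc)
    show "wp w (Ite ?e (Asg 5 (Nm 1)) Skip) (\<lambda>s'. ?I k (tick 2 s')) ?s"
    proof (cases "tri k")
      case True
      then have "aval w ?e ?s \<noteq> 0" by (simp only: e) simp
      then show ?thesis using fr' True w1 unfolding val by (simp only: wp_simps(5) if_True simp_thms) simp
    next
      case False
      then have "\<not> aval w ?e ?s \<noteq> 0" by (simp only: e) simp
      then show ?thesis using fr' False unfolding val by (simp only: wp_simps(5) if_False simp_thms) simp
    qed
  qed (unfold len, auto simp: has_triangle_PG tri_def)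
qed

text \<open>Freshness of the region makes all cells beyond the matrix zero, so the decoded state
  equals \<open>input_config\<close> exactly and the guarantee for the given algorithm applies to
  it.\<close>

lemma wp_prepare:
  assumes "core s" "at_piece s" "n * n \<le> vr s 6" "vr s 6 + 2 * S \<le> 2 ^ w" "\<And>x. vr s 6 + S \<le> x \<Longrightarrow> mm s x = 0"
  shows "wp w (prepare A) (\<lambda>s'. vr s' 6 = vr s 6 + S \<and> sim_config S s' = input_config m (PG s) \<and>
     (\<forall>x. x < vr s 6 + S \<or> vr s 6 + 2 * S \<le> x \<longrightarrow> mm s' x = mm s x) \<and>
     tm s' \<le> tm s + (m * m + 1) * clen (prepare A)) s"
proof -
  let ?b = "vr s 6 + S"
  have s4: "vr s 4 = S" and s1m: "vr s 1 = m" using assms(1) by (simp_all add: core_def)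
  have "S > 0" by (simp add: S)
  then have b: "take_bit w ?b = ?b" using assms(4) by (intro take_bit_word) simp
  define s0 where "s0 = tick (elen (Vr 6 \<oplus> Vr 4) + 1) (asg 6 (aval w (Vr 6 \<oplus> Vr 4) s) s)"
  define s1 where "s1 = tick 4 (asg 6 ?b s)"
  have s01: "s0 = s1"
  proof -
    have "elen (Vr 6 \<oplus> Vr 4) + 1 = 4" "aval w (Vr 6 \<oplus> Vr 4) s = ?b" using s4 b by simp_all
    then show ?thesis unfolding s0_def s1_def by (simp only:)
  qed
  have fr1: "core s1" "at_piece s1" "PG s1 = PG s"
    using core_at_frame[OF assms(1,2), of s1] by (auto simp: s1_def)
  have b1: "n * n \<le> vr s1 6" "vr s1 6 + m * m \<le> 2 ^ w" using assms(3,4) mS by (simp_all add: s1_def)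
  have len: "aval w (Vr 1 \<otimes> Vr 1) s1 = m * m" using fr1(1) m_less by (simp add: take_bit_word core_def)
  have tm1: "wp w build (\<lambda>s'. tm s' \<le> tm s1 + (m * m + 1) * clen build) s1"
    using For_tm'[of "Sto (Vr 6 \<oplus> Vr 14) (eadj (Vr 14 \<oslash> Vr 1) (Vr 14 \<odot> Vr 1))" w 14 "Vr 1 \<otimes> Vr 1" s1, unfolded len]
    by (simp add: build_def)
  let ?k = "num_regs A"
  have k0: "?k > 0" by (simp add: num_regs_def)
  have fin: "vr s' 6 = ?b \<and> sim_config S s' = input_config m (PG s) \<and>
     (\<forall>x. x < ?b \<or> vr s 6 + 2 * S \<le> x \<longrightarrow> mm s' x = mm s x) \<and> tm s' \<le> tm s + (m * m + 1) * clen (prepare A)"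
    if s2: "s2 \<in> set_pmf (sem w build s1)" and s3: "s3 \<in> set_pmf (sem w (reset ?k) s2)"
      and s': "s' = tick 2 (asg 15 0 (tick 2 (asg 18 m s3)))" for s2 s3 s'
  proof -
    have v2: "\<And>x. x \<noteq> 14 \<Longrightarrow> vr s2 x = vr s1 x"
      "mm s2 = (\<lambda>x. if ?b \<le> x \<and> x < ?b + m * m then of_bool ({(x - ?b) div m, (x - ?b) mod m} \<in> edges (PG s)) else mm s x)"
      and t2: "tm s2 \<le> tm s1 + (m * m + 1) * clen build"
      using wp_build[OF fr1(1,2) b1] tm1 s2 by (auto simp: wp_def s1_def fr1(3)[unfolded s1_def])
    have v3: "mm s3 = mm s2" "\<And>x. vr s3 x = (if 18 \<le> x \<and> x < 18 + ?k then 0 else vr s2 x)"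
      using wp_reset[of w ?k s2] s3 by (auto simp: wp_def)
    have t3: "tm s3 \<le> tm s2 + clen (reset ?k)"
      using loopfree_tm[OF loopfree_reset, of w ?k s2] s3 by (auto simp: wp_def)
    have mem: "(if x < S then mm s3 (?b + x) else 0) = (if x < m * m \<and> {x div m, x mod m} \<in> edges (PG s) then 1 else 0)" for x
      using assms(5)[of "?b + x"] mS by (auto simp: v3 v2)
    have reg: "vr s' (18 + r) = ((\<lambda>_. 0)(0 := m)) r" for r
    proof (cases "r < ?k")
      case False
      then have "vr s (18 + r) = 0" using assms(1) by (simp add: core_def)
      then show ?thesis using False k0 by (simp add: s' v3 v2 s1_def)
    qed (simp add: s' v3)
    have "sim_config S s' = input_config m (PG s)"
    proof -
      have e1: "(\<lambda>r. vr s' (18 + r)) = (\<lambda>_. 0)(0 := m)" by (rule ext, rule reg)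
      have e2: "(\<lambda>x. if x < S then mm s3 (?b + x) else 0)
        = (\<lambda>x. if x < m * m \<and> {x div m, x mod m} \<in> edges (PG s) then 1 else 0)" by (rule ext, rule mem)
      have e3: "vr s' 15 = 0" "vr s' 6 = ?b" "mm s' = mm s3" by (simp_all add: s' v3 v2 s1_def)
      show ?thesis unfolding sim_config_def input_config_def e1 e3 e2 ..
    qed
    moreover have "tm s' \<le> tm s + (m * m + 1) * clen (prepare A)"
    proof -
      have "tm s' \<le> tm s + (m * m + 1) * clen build + clen (reset ?k) + 8"
        using t2 t3 by (simp add: s' s1_def)
      moreover have "clen (prepare A) = clen build + clen (reset ?k) + 8"
        by (simp add: prepare_def)
      ultimately show ?thesis by (simp add: algebra_simps)
    qed
    ultimately show ?thesis using mS by (auto simp: s' v3 v2 s1_def)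
  qed
  have w0: "aval w (Vr 1) s3 = m" if "s2 \<in> set_pmf (sem w build s1)" "s3 \<in> set_pmf (sem w (reset ?k) s2)" for s2 s3
  proof -
    have "14 \<noteq> (1::nat)" by simp
    then show ?thesis
      using wp_build[OF fr1(1,2) b1] wp_reset[of w ?k s2] that s1m by (simp add: wp_def s1_def)
  qed
  have "\<exists>s2\<in>set_pmf (sem w build s0). \<exists>s3\<in>set_pmf (sem w (reset ?k) s2).
      s' = tick 2 (asg 15 0 (tick 2 (asg 18 (aval w (Vr 1) s3) s3)))"
    if "s' \<in> set_pmf (sem w (prepare A) s)" for s'
    using that by (simp add: prepare_def bind_return_pmf s0_def numeral_2_eq_2)
  then show ?thesis using fin w0 unfolding s01 by (fastforce simp: wp_def)
qed

section \<open>Accounting of time and memory for one trial\<close>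

definition P :: nat where "P = clen (trial A)"
text \<open>The summand 20 makes a credit large enough to pay alternatively for the control steps of
  a loop or a branch (\<open>Inv_tick\<close>).\<close>

definition E :: nat where "E = P * (m * m + TT + 5) + 20"
definition D :: nat where "D = P * (m * m * m + 1)"

text \<open>\<open>Y\<close> counts credits: every trial and every turn of an enclosing loop may use a fresh memory region of
  size \<open>S\<close> and \<open>E\<close> steps. A brute-force search costs \<open>D\<close> further steps and is paid by the growth of the
  budget, variable 7, which stays below \<open>TT\<close> until a triangle is found.\<close>

definition Inv :: "nat \<Rightarrow> st \<Rightarrow> bool" where
  "Inv Y s \<longleftrightarrow> core s \<and> (\<forall>x\<ge>vr s 6 + S. mm s x = 0) \<and> n * n \<le> vr s 6 \<and> vr s 6 + (Y + 1) * S \<le> 2 ^ w \<and>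
     vr s 5 \<le> 1 \<and> (vr s 5 = 0 \<longrightarrow> vr s 7 \<le> TT) \<and> vr s 7 \<le> TT + 1 \<and> vr s 7 \<le> vr s 6 \<and>
     tm s + Y * E + (TT + 1 - vr s 7) * D \<le> Tot"

lemma sim_inv_prepared:
  assumes "core s'" "vr s' 6 + S \<le> 2 ^ w" "sim_config S s' = input_config m \<Gamma>"
  shows "sim_inv s'"
proof -
  \<comment> \<open>Register 0 of the simulated machine starts with \<open>m\<close>, so
    \<open>m\<close> itself has to be a short word.\<close>
  have "m \<ge> 2" using q(3) q_ge by simp
  then have "1 * m < m * m" by (intro mult_strict_right_mono) auto
  from less_le_trans[OF this mS] have "m < S" by simp
  moreover have "1 < S" using \<open>m \<ge> 2\<close> \<open>m < S\<close> by simp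
  ultimately have "word_config w' A (input_config m \<Gamma>)"
    using mS by (auto simp: word_config_def input_config_def S)
  then show ?thesis using assms by (simp add: sim_inv_def core_def)
qed

lemma conclude_tm:
  assumes "core s2" "at_piece s2"
  shows "wp w (conclude A) (\<lambda>s3. tm s3 \<le> tm s2 + clen (conclude A)
     + (if vr s2 15 < length A then m * m * m * clen brute else 0)) s2"
proof -
  have la: "take_bit w (length A) = length A" using pc_bound by (simp add: max_pc_def take_bit_word)
  have w1: "take_bit w (Suc 0) = Suc 0" using small[of 1] by simp
  let ?s = "tick 4 s2"
  have len: "aval w (Vr 1 \<otimes> Vr 1 \<otimes> Vr 1) ?s = m * m * m" using assms(1) m_less by (simp add: take_bit_word core_def)
  have "wp w brute (\<lambda>s'. tm s' \<le> tm ?s + (m * m * m + 1) * clen brute) ?s"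
    unfolding brute_def
  proof (rule wp_mono[OF For_tm'], goal_cases)
    case (2 s')
    then show ?case by (simp only: len)
  qed simp
  then have b: "wp w brute (\<lambda>s'. tm s' + 8 \<le> tm s2 + clen (conclude A) + m * m * m * clen brute) ?s"
    by (rule wp_mono) (simp add: conclude_def algebra_simps)
  show ?thesis
  proof (cases "vr s2 15 < length A")
    case True
    then show ?thesis
      unfolding conclude_def using b w1 la
      by (auto simp: conclude_def eval_nat_numeral elim!: wp_mono)
  next
    case False
    then show ?thesis using w1 la by (simp add: conclude_def)
  qed
qed

lemma core_frame:
  assumes "core s" "\<And>x. x \<notin> {5, 6, 7, 8, 9, 10, 11, 12, 13, 14, 15, 16, 17} \<union> {18..<18 + num_regs A} \<Longrightarrow> vr s' x = vr s x"
    "\<And>x. x < n * n \<Longrightarrow> mm s' x = mm s x"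
  shows "core s'"
  using assms by (auto simp: core_def)

lemma at_piece_frame:
  assumes "at_piece s" "\<And>x. x \<in> {9, 10, 11, 12} \<Longrightarrow> vr s' x = vr s x"
  shows "at_piece s'" "PG s' = PG s"
  using assms by (auto simp: at_piece_def PG_def)

section \<open>Trials, votes and rounds\<close>

lemma conclude_result:
  assumes c: "core s2" "at_piece s2" "vr s2 7 + 1 < 2 ^ w" "vr s2 8 + 1 < 2 ^ w"
    and s3: "s3 \<in> set_pmf (sem w (conclude A) s2)"
  shows "mm s3 = mm s2" "\<And>x. x \<notin> {5, 7, 8, 14} \<Longrightarrow> vr s3 x = vr s2 x"
    "vr s2 15 < length A \<Longrightarrow> vr s3 5 = (if has_triangle (PG s2) then 1 else vr s2 5)"
    "\<not> vr s2 15 < length A \<Longrightarrow> vr s3 5 = vr s2 5"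
    "vr s3 7 = vr s2 7 + of_bool (vr s2 15 < length A)"
    "vr s3 8 = vr s2 8 + of_bool (\<not> vr s2 15 < length A \<and> vr s2 18 \<noteq> 0)"
proof -
  have la: "take_bit w (length A) = length A" using pc_bound by (simp add: max_pc_def take_bit_word)
  have w1: "take_bit w (Suc 0) = Suc 0" using small[of 1] by simp
  have t: "take_bit w (Suc (vr s2 7)) = Suc (vr s2 7)" "take_bit w (Suc (vr s2 8)) = Suc (vr s2 8)"
    using c(3,4) by (simp_all add: take_bit_word)
  have "wp w (conclude A) (\<lambda>s3. mm s3 = mm s2 \<and> (\<forall>x. x \<notin> {5, 7, 8, 14} \<longrightarrow> vr s3 x = vr s2 x) \<and>
    (vr s2 15 < length A \<longrightarrow> vr s3 5 = (if has_triangle (PG s2) then 1 else vr s2 5)) \<and>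
    (\<not> vr s2 15 < length A \<longrightarrow> vr s3 5 = vr s2 5) \<and>
    vr s3 7 = vr s2 7 + of_bool (vr s2 15 < length A) \<and>
    vr s3 8 = vr s2 8 + of_bool (\<not> vr s2 15 < length A \<and> vr s2 18 \<noteq> 0)) s2"
  proof (cases "vr s2 15 < length A")
    case True
    define s2' where "s2' = tick (elen (Vr 15 \<prec> Nm (length A)) + 1) s2"
    have p: "core s2'" "at_piece s2'" "PG s2' = PG s2"
      using c(1,2) by (simp_all add: s2'_def core_def at_piece_def PG_def)
    have fr: "vr s2' = vr s2" "mm s2' = mm s2" by (simp_all add: s2'_def)
    have cond: "aval w (Vr 15 \<prec> Nm (length A)) s2 \<noteq> 0" using True la w1 by simp
    show ?thesis
      unfolding conclude_def wp_simps(5) if_P[OF cond] s2'_def[symmetric] wp_simps(4)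
      by (rule wp_mono[OF wp_brute[OF p(1,2)]]) (use True t w1 in \<open>simp add: fr p(3)\<close>)
  next
    case False
    then show ?thesis using la w1 t by (simp add: conclude_def)
  qed
  then show "mm s3 = mm s2" "\<And>x. x \<notin> {5, 7, 8, 14} \<Longrightarrow> vr s3 x = vr s2 x"
    "vr s2 15 < length A \<Longrightarrow> vr s3 5 = (if has_triangle (PG s2) then 1 else vr s2 5)"
    "\<not> vr s2 15 < length A \<Longrightarrow> vr s3 5 = vr s2 5"
    "vr s3 7 = vr s2 7 + of_bool (vr s2 15 < length A)"
    "vr s3 8 = vr s2 8 + of_bool (\<not> vr s2 15 < length A \<and> vr s2 18 \<noteq> 0)"
    using s3 by (auto simp: wp_def)
qed

lemma writes_prepare: "writes (prepare A) \<subseteq> {6, 14, 15} \<union> {18..<18 + num_regs A}"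
  using writes_reset[of "num_regs A"] by (auto simp: prepare_def build_def num_regs_def)

lemma writes_simul: "writes (simul A) \<subseteq> {14, 15} \<union> {18..<18 + num_regs A}"
  using writes_dispatch[of 0 A] by (auto simp: simul_def num_regs_def)

text \<open>Besides relating the run to the given algorithm, this records that everything above the
  new region is still zero, which keeps the supply of fresh regions alive.\<close>

lemma trial_parts:
  assumes I: "Inv (Suc Y) s" "vr s 5 = 0" "at_piece s"
    and s1: "s1 \<in> set_pmf (sem w (prepare A) s)" and s2: "s2 \<in> set_pmf (sem w (simul A) s1)"
  defines "R \<equiv> run w' A (vr s 7) (input_config m (PG s))"
  shows "map_pmf (sim_config S) (sem w (simul A) s1) = R"
    and "core s2" "at_piece s2" "PG s2 = PG s" "vr s2 6 = vr s 6 + S"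
    and "\<And>x. x \<in> {5, 7, 8, 9, 10, 11, 12, 13, 16, 17} \<Longrightarrow> vr s2 x = vr s x"
    and "\<And>x. vr s 6 + 2 * S \<le> x \<Longrightarrow> mm s2 x = 0"
    and "tm s2 \<le> tm s + (m * m + 1) * clen (prepare A) + (vr s 7 + 1) * clen (simul A)"
proof -
  have i: "core s" "n * n \<le> vr s 6" "\<And>x. vr s 6 + S \<le> x \<Longrightarrow> mm s x = 0"
    and b: "vr s 6 + 2 * S \<le> 2 ^ w"
    using I(1) by (auto simp: Inv_def algebra_simps)
  have p: "vr s1 6 = vr s 6 + S" "sim_config S s1 = input_config m (PG s)"
    "\<And>x. x < vr s 6 + S \<or> vr s 6 + 2 * S \<le> x \<Longrightarrow> mm s1 x = mm s x"
    "tm s1 \<le> tm s + (m * m + 1) * clen (prepare A)"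
    using wp_prepare[OF i(1) I(3) i(2) b i(3)] s1 by (auto simp: wp_def)
  have f1: "vr s1 x = vr s x" if "x \<notin> {6, 14, 15} \<union> {18..<18 + num_regs A}" for x
    using sem_frame[OF s1] writes_prepare that by blast
  have f2: "vr s2 x = vr s1 x" if "x \<notin> {14, 15} \<union> {18..<18 + num_regs A}" for x
    using sem_frame[OF s2] writes_simul that by blast
  have c1: "core s1" by (rule core_frame[OF i(1)]) (use f1 p(3) i(2) in auto)
  have inv1: "sim_inv s1" by (rule sim_inv_prepared[OF c1 _ p(2)]) (use p(1) b in simp)
  have m2: "\<And>x. x < vr s1 6 \<or> vr s1 6 + S \<le> x \<Longrightarrow> mm s2 x = mm s1 x"
    using simul_run(2)[OF inv1] s2 by (auto simp: wp_def)
  have "vr s1 7 = vr s 7" by (rule f1) simp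
  then show "map_pmf (sim_config S) (sem w (simul A) s1) = R"
    using simul_run(1)[OF inv1] p(2) by (simp add: R_def)
  show "core s2" by (rule core_frame[OF c1]) (use f2 m2 p(1) i(2) in auto)
  show fr: "\<And>x. x \<in> {5, 7, 8, 9, 10, 11, 12, 13, 16, 17} \<Longrightarrow> vr s2 x = vr s x"
    using f1 f2 by auto
  show "at_piece s2" "PG s2 = PG s" by (rule at_piece_frame[OF I(3)], rule fr, blast)+
  show "vr s2 6 = vr s 6 + S" using f2[of 6] p(1) by simp
  show "\<And>x. vr s 6 + 2 * S \<le> x \<Longrightarrow> mm s2 x = 0"
    using m2 p(1,3) i(3) by simp
  have "tm s2 \<le> tm s1 + (vr s1 7 + 1) * clen (simul A)"
    using For_tm'[OF loopfree_dispatch, of w 14 "Vr 7" 0 A s1] s2 by (simp add: simul_def wp_def)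
  then show "tm s2 \<le> tm s + (m * m + 1) * clen (prepare A) + (vr s 7 + 1) * clen (simul A)"
    using p(4) \<open>vr s1 7 = vr s 7\<close> by simp
qed

lemma trial_result:
  assumes I: "Inv (Suc Y) s" "vr s 5 = 0" "at_piece s" "vr s 8 + 1 < 2 ^ w"
    and s1: "s1 \<in> set_pmf (sem w (prepare A) s)" and s2: "s2 \<in> set_pmf (sem w (simul A) s1)"
    and s3: "s3 \<in> set_pmf (sem w (conclude A) s2)"
  shows "Inv Y (tick 10 s3)"
    and "vr s3 8 = vr s 8 + of_bool (halted A (sim_config S s2) \<and> answer (sim_config S s2))"
    and "vr s3 5 = of_bool (\<not> halted A (sim_config S s2) \<and> has_triangle (PG s))"
proof -
  note tp = trial_parts[OF I(1-3) s1 s2]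
  have b7: "vr s2 7 = vr s 7" "vr s2 8 = vr s 8" "vr s2 5 = 0" using tp(6) I(2) by auto
  have i: "core s" "n * n \<le> vr s 6" "vr s 6 + (Suc Y + 1) * S \<le> 2 ^ w" "vr s 7 \<le> TT" "vr s 7 \<le> vr s 6"
    and t: "tm s + Suc Y * E + (TT + 1 - vr s 7) * D \<le> Tot"
    using I(1,2) by (auto simp: Inv_def)
  have S0: "0 < S" by (simp add: S)
  have S1: "1 < S" unfolding S using w'(1) by (intro one_less_power) auto
  \<comment> \<open>\<open>TT\<close> may exceed the range of a word. The budget still fits, because
    it starts below the region base and grows by at most one per trial, while the base grows by
    \<open>S\<close>.\<close>
  have b71: "vr s2 7 + 1 < 2 ^ w" using i(3,5) S1 b7 by (simp add: algebra_simps)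
  have b81: "vr s2 8 + 1 < 2 ^ w" using I(4) b7 by simp
  note cr = conclude_result[OF tp(2,3) b71 b81 s3]
  have h: "halted A (sim_config S s2) \<longleftrightarrow> \<not> vr s2 15 < length A" "answer (sim_config S s2) \<longleftrightarrow> vr s2 18 \<noteq> 0"
    by (auto simp: halted_def answer_def sim_config_def)
  show "vr s3 8 = vr s 8 + of_bool (halted A (sim_config S s2) \<and> answer (sim_config S s2))"
    using cr(6) h b7 by simp
  show v5: "vr s3 5 = of_bool (\<not> halted A (sim_config S s2) \<and> has_triangle (PG s))"
    using cr(3,4) h b7 tp(4) by auto
  have t2: "tm s3 \<le> tm s2 + clen (conclude A) + (if vr s2 15 < length A then m * m * m * clen brute else 0)"
    using conclude_tm[OF tp(2,3)] s3 by (auto simp: wp_def)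
  have Pp: "P = clen (prepare A) + clen (simul A) + clen (conclude A)" by (simp add: P_def trial_def)
  have Pb: "clen brute \<le> P" by (simp add: Pp conclude_def)
  have "(m * m + 1) * clen (prepare A) + (vr s 7 + 1) * clen (simul A) + clen (conclude A)
     \<le> (m * m + 1) * P + (TT + 1) * P + P"
    using i(4) by (intro add_mono mult_mono) (auto simp: Pp)
  moreover have "(m * m + 1) * P + (TT + 1) * P + P + 10 \<le> E" by (simp add: E_def algebra_simps)
  moreover have "m * m * m * clen brute \<le> D"
  proof -
    have "m * m * m * clen brute \<le> m * m * m * P" by (rule mult_le_mono2[OF Pb])
    also have "\<dots> \<le> D" by (simp add: D_def algebra_simps)
    finally show ?thesis .
  qed
  ultimately have e1: "tm s3 + 10 \<le> tm s + E + (if vr s2 15 < length A then D else 0)"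
    using t2 tp(8) by (cases "vr s2 15 < length A"; simp only: if_True if_False; linarith)
  have sim_in: "sim_config S s2 \<in> set_pmf (run w' A (vr s 7) (input_config m (PG s)))"
  proof -
    have "sim_config S s2 \<in> set_pmf (map_pmf (sim_config S) (sem w (simul A) s1))" using s2 by simp
    then show ?thesis using tp(1) by simp
  qed
  \<comment> \<open>A triangle-free piece has at most one triangle, so the guarantee applies and
    \<open>TT\<close> steps would have sufficed; a run that did not halt must have had a smaller
    budget. Hence raising the budget keeps it within \<open>TT\<close>.\<close>
  have notri: "vr s 7 < TT" if "\<not> halted A (sim_config S s2)" "\<not> has_triangle (PG s)"
  proof (rule ccontr)
    assume "\<not> vr s 7 < TT"
    then have "vr s 7 = TT" using i(4) by simp
    have "triangles (PG s) = {}" using that(2) by (simp add: has_triangle_def)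
    then have "card (triangles (PG s)) \<le> 1" by simp
    then have "solves A w' TT m (PG s)" using solves I(3) by (auto simp: at_piece_def PG_def)
    then show False using sim_in \<open>vr s 7 = TT\<close> that(1) by (auto simp: solves_def Let_def)
  qed
  have v: "vr s3 6 = vr s 6 + S" "mm s3 = mm s2" using cr(1) cr(2)[of 6] tp(5) by auto
  have time: "tm s3 + 10 + Y * E + (TT + 1 - vr s3 7) * D \<le> Tot"
  proof (cases "vr s2 15 < length A")
    case True
    then have "TT + 1 - vr s 7 = Suc (TT + 1 - vr s3 7)" using cr(5) b7 i(4) by simp
    then show ?thesis using t e1 True by simp
  next
    case False
    then show ?thesis using t e1 cr(5) b7 by simp
  qed
  show "Inv Y (tick 10 s3)"
    unfolding Inv_def
  proof (intro conjI)
    have "core s3" by (rule core_frame[OF tp(2)]) (use cr(1,2) in auto)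
    then show "core (tick 10 s3)" by (simp add: core_def)
    show "\<forall>x\<ge>vr (tick 10 s3) 6 + S. mm (tick 10 s3) x = 0" using tp(7) v by simp
    show "n * n \<le> vr (tick 10 s3) 6" using i(2) v by simp
    show "vr (tick 10 s3) 6 + (Y + 1) * S \<le> 2 ^ w" using i(3) v by (simp add: algebra_simps)
    show "vr (tick 10 s3) 5 \<le> 1" using v5 by simp
    show "vr (tick 10 s3) 5 = 0 \<longrightarrow> vr (tick 10 s3) 7 \<le> TT"
      using v5 cr(5) b7 h i(4) notri by (auto split: if_splits)
    show "vr (tick 10 s3) 7 \<le> TT + 1" using cr(5) b7 i(4) by simp
    show "vr (tick 10 s3) 7 \<le> vr (tick 10 s3) 6" using cr(5) b7 i(5) v S0 by (simp split: if_splits)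
    show "tm (tick 10 s3) + Y * E + (TT + 1 - vr (tick 10 s3) 7) * D \<le> Tot" using time by simp
  qed
qed

text \<open>Reduces the expectation over a trial to one over the truncated run of the given
  algorithm: \<open>h\<close> only has to dominate \<open>f\<close> when votes and answer are those
  which the final configuration \<open>c\<close> causes.\<close>

lemma wex_trial:
  assumes I: "Inv (Suc Y) s" "vr s 5 = 0" "at_piece s" "vr s 8 + 1 < 2 ^ w"
    and h: "\<And>c s3. vr s3 8 = vr s 8 + of_bool (halted A c \<and> answer c) \<Longrightarrow>
       vr s3 5 = of_bool (\<not> halted A c \<and> has_triangle (PG s)) \<Longrightarrow> f s3 \<le> h c"
  shows "wex w (trial A) f s \<le> (\<integral>\<^sup>+c. h c \<partial>measure_pmf (run w' A (vr s 7) (input_config m (PG s))))"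
proof -
  have "wex w (simul A) (wex w (conclude A) f) s1
      \<le> (\<integral>\<^sup>+c. h c \<partial>measure_pmf (run w' A (vr s 7) (input_config m (PG s))))"
    if s1: "s1 \<in> set_pmf (sem w (prepare A) s)" for s1
  proof -
    obtain s2 where s2: "s2 \<in> set_pmf (sem w (simul A) s1)" by (meson all_not_in_conv set_pmf_not_empty)
    have "wex w (simul A) (wex w (conclude A) f) s1 \<le> wex w (simul A) (\<lambda>s2. h (sim_config S s2)) s1"
    proof (rule wex_mono, unfold wp_def, intro ballI)
      fix s2 assume s2: "s2 \<in> set_pmf (sem w (simul A) s1)"
      show "wex w (conclude A) f s2 \<le> h (sim_config S s2)"
        by (rule wex_le) (use h trial_result(2,3)[OF I s1 s2] in \<open>auto simp: wp_def\<close>)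
    qed
    also have "\<dots> = (\<integral>\<^sup>+c. h c \<partial>measure_pmf (map_pmf (sim_config S) (sem w (simul A) s1)))"
      by (simp add: wex_def)
    finally show ?thesis unfolding trial_parts(1)[OF I(1-3) s1 s2] .
  qed
  then show ?thesis
    unfolding trial_def wex_simps by (intro wex_le) (simp add: wp_def)
qed

lemma wp_trial:
  assumes I: "Inv (Suc Y) s" "vr s 5 = 0" "at_piece s" "vr s 8 + 1 < 2 ^ w"
  shows "wp w (trial A) (\<lambda>s3. Inv Y (tick 10 s3) \<and> vr s3 8 \<le> vr s 8 + 1) s"
  unfolding trial_def wp_simps wp_def
  using trial_result(1,2)[OF I] by auto

lemma Inv_tick: "Inv (Suc Y) s \<Longrightarrow> k \<le> 20 \<Longrightarrow> Inv Y (tick k s)"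
  by (auto simp: Inv_def core_def E_def algebra_simps)

lemma Inv_mono: "Inv Y' s \<Longrightarrow> Y \<le> Y' \<Longrightarrow> Inv Y s"
proof -
  assume I: "Inv Y' s" and Y: "Y \<le> Y'"
  have "(Y + 1) * S \<le> (Y' + 1) * S" "Y * E \<le> Y' * E" using Y by (intro mult_right_mono; simp)+
  moreover have "vr s 6 + (Y' + 1) * S \<le> 2 ^ w" "tm s + Y' * E + (TT + 1 - vr s 7) * D \<le> Tot"
    using I unfolding Inv_def by blast+
  ultimately have "vr s 6 + (Y + 1) * S \<le> 2 ^ w" "tm s + Y * E + (TT + 1 - vr s 7) * D \<le> Tot" by linarith+
  then show ?thesis using I unfolding Inv_def by blast
qed

lemma Inv_tick_less: "Inv Y (tick k s) \<Longrightarrow> k' \<le> k \<Longrightarrow> Inv Y (tick k' s)"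
  by (auto simp: Inv_def core_def)

lemma Inv_tickD: "Inv Y (tick k s) \<Longrightarrow> Inv Y s"
  by (auto simp: Inv_def core_def)

lemma Inv_asg: "8 \<le> x \<Longrightarrow> x < 18 \<Longrightarrow> Inv Y (asg x v s) \<longleftrightarrow> Inv Y s"
  by (auto simp: Inv_def core_def)

text \<open>A turn is priced at the \<open>X\<close> credits of its body and two for loop control;
  entry and exit take two more. \<open>elen e <= 18\<close> lets one credit cover the evaluation of
  the loop bound.\<close>

lemma For_Inv:
  assumes x: "8 \<le> x" "x < 18" and e: "elen e \<le> 18"
    and I: "Inv (Y + (aval w e s * (X + 2) + 2)) s" "J (aval w e s) s"
    and inv: "\<And>k t s. J k (tick t s) = J k s" "\<And>k t s. f k (tick t s) = f k s"
      "\<And>k v s. J k (asg x v s) = J k s" "\<And>k v s. f k (asg x v s) = f k s"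
    and body: "\<And>k s' Y'. k < aval w e s \<Longrightarrow> vr s' x = k \<Longrightarrow> Inv (Y' + X) s' \<Longrightarrow> J (Suc k) s' \<Longrightarrow>
      wp w c (\<lambda>s'. Inv Y' s' \<and> J k s') s' \<and> wex w c (f k) s' \<le> f (Suc k) s'"
  shows "wp w (For x e c) (\<lambda>s'. Inv Y s' \<and> J 0 s') s \<and> wex w (For x e c) (f 0) s \<le> f (aval w e s) s"
proof (rule For_rule[where I = "\<lambda>k s'. Inv (Y + (k * (X + 2) + 1)) s' \<and> J k s'" and f = f])
  have "Inv (Suc (Y + (aval w e s * (X + 2) + 1))) s" using I(1) by simp
  then show "Inv (Y + (aval w e s * (X + 2) + 1)) (tick (elen e + 1) s) \<and> J (aval w e s) (tick (elen e + 1) s)"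
    using I(2) e inv by (intro conjI Inv_tick) auto
  show "f (aval w e s) (tick (elen e + 1) s) \<le> f (aval w e s) s" by (simp add: inv)
next
  fix k s' assume k: "k < aval w e s" and I: "Inv (Y + (Suc k * (X + 2) + 1)) s' \<and> J (Suc k) s'"
  let ?s = "tick 3 (asg x k s')"
  define Y' where "Y' = Y + (k * (X + 2) + 1)"
  have "Inv (Suc (Suc Y' + X)) (asg x k s')" using I by (simp add: Y'_def Inv_asg x algebra_simps)
  then have Is: "Inv (Suc Y' + X) ?s" by (rule Inv_tick) simp
  have J: "J (Suc k) ?s" using I inv by simp
  have b: "wp w c (\<lambda>s'. Inv (Suc Y') s' \<and> J k s') ?s \<and> wex w c (f k) ?s \<le> f (Suc k) ?s"
    by (rule body[OF k _ Is J]) simp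
  then have "wp w c (\<lambda>s'. Inv Y' (tick 2 s') \<and> J k (tick 2 s')) ?s"
    by (elim conjE wp_mono) (auto simp: inv intro: Inv_tick)
  then show "wp w c (\<lambda>s'. Inv (Y + (k * (X + 2) + 1)) (tick 2 s') \<and> J k (tick 2 s')) ?s \<and>
      wex w c (\<lambda>s'. f k (tick 2 s')) ?s \<le> f (Suc k) s'"
    using b by (simp add: inv Y'_def)
next
  fix s' assume "Inv (Y + (0 * (X + 2) + 1)) s' \<and> J 0 s'"
  then have "Inv (Suc Y) (asg x 0 s')" "J 0 s'" by (simp_all add: Inv_asg x)
  then show "(Inv Y (tick 1 (asg x 0 s')) \<and> J 0 (tick 1 (asg x 0 s'))) \<and> f 0 (tick 1 (asg x 0 s')) \<le> f 0 s'"
    using inv by (auto intro: Inv_tick)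
qed

text \<open>\<open>F k u c\<close> bounds the expectation of \<open>h\<close> when \<open>k\<close> repetitions remain, the answer is \<open>u\<close> and
  \<open>c\<close> votes have been cast.\<close>

lemma vote_rule:
  assumes I: "Inv (Y + (480 * l + 4)) s" and at: "at_piece s"
    and trial: "\<And>k s' Y'. k < 120 * l \<Longrightarrow> Inv (Suc Y') s' \<Longrightarrow> vr s' 5 = 0 \<Longrightarrow> at_piece s' \<Longrightarrow> PG s' = PG s \<Longrightarrow>
      vr s' 8 + Suc k \<le> 120 * l \<Longrightarrow> vr s' 8 + 1 < 2 ^ w \<Longrightarrow>
      wex w (trial A) (\<lambda>s3. F k (vr s3 5) (vr s3 8)) s' \<le> F (Suc k) 0 (vr s' 8)"
    and skip: "\<And>k u c. u \<noteq> 0 \<Longrightarrow> F k u c \<le> F (Suc k) u c"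
    and fin: "\<And>u c. u \<le> 1 \<Longrightarrow> c \<le> 120 * l \<Longrightarrow> h (if 60 * l < c then 1 else u) \<le> F 0 u c"
  shows "wp w (vote A) (Inv Y) s \<and> wex w (vote A) (\<lambda>s'. h (vr s' 5)) s \<le> F (120 * l) (vr s 5) 0"
proof -
  define s0 where "s0 = tick 2 (asg 8 0 s)"
  have lq: "l < q" unfolding q(1) by simp
  have "128 * l \<le> 64 * q ^ 2" using lq q_ge by (simp add: power2_eq_square) (rule mult_le_mono; simp)
  then have l128: "128 * l < 2 ^ w" using qpow_less[of 2 64] by simp
  have core: "core s" using I by (simp add: Inv_def)
  have len: "aval w (Nm 120 \<otimes> Vr 2) s0 = 120 * l" "vr s0 2 = l"
    using core l128 small[of 120] by (simp_all add: s0_def core_def take_bit_word)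
  let ?J = "\<lambda>k s'. (\<forall>x\<in>{9, 10, 11, 12}. vr s' x = vr s x) \<and> vr s' 8 + k \<le> 120 * l"
  let ?f = "\<lambda>k s'. F k (vr s' 5) (vr s' 8)"
  \<comment> \<open>Each of the \<open>120 * l\<close> turns takes four credits: loop control two,
    the test one, the trial one. The additional 4 pay for clearing the votes, loop entry and exit,
    and the final test.\<close>
  have eq: "Y + (480 * l + 4) = Suc (Y + (480 * l + 3))" by simp
  have "Inv (Suc (Y + (480 * l + 3))) (asg 8 0 s)" using I unfolding eq by (simp add: Inv_asg)
  then have "Inv (Y + (480 * l + 3)) s0" unfolding s0_def by (rule Inv_tick) simp
  moreover have "Y + (480 * l + 3) = Suc Y + (120 * l * (2 + 2) + 2)" by simp
  ultimately have I0: "Inv (Suc Y + (120 * l * (2 + 2) + 2)) s0" by simp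
  let ?loop = "For 13 (Nm 120 \<otimes> Vr 2) (Ite (Vr 5) Skip (trial A))"
  have loop: "wp w ?loop (\<lambda>s'. Inv (Suc Y) s' \<and> ?J 0 s') s0 \<and>
     wex w ?loop (?f 0) s0 \<le> ?f (aval w (Nm 120 \<otimes> Vr 2) s0) s0"
  proof (rule For_Inv[where X = 2])
    show "Inv (Suc Y + (aval w (Nm 120 \<otimes> Vr 2) s0 * (2 + 2) + 2)) s0" unfolding len using I0 .
    show "?J (aval w (Nm 120 \<otimes> Vr 2) s0) s0" unfolding len by (simp add: s0_def)
  next
    fix k s' Y' assume k: "k < aval w (Nm 120 \<otimes> Vr 2) s0" and I: "Inv (Y' + 2) s'" and J: "?J (Suc k) s'"
    have k': "k < 120 * l" using k unfolding len .
    let ?s = "tick 2 s'"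
    have at': "at_piece ?s" "PG ?s = PG s" by (rule at_piece_frame[OF at], use J in auto)+
    have "Inv (Suc (Suc Y')) s'" using I by simp
    then have I': "Inv (Suc Y') ?s" by (rule Inv_tick) simp
    have e2: "elen (Vr 5) + 1 = 2" by simp
    show "wp w (Ite (Vr 5) Skip (trial A)) (\<lambda>s'. Inv Y' s' \<and> ?J k s') s' \<and>
        wex w (Ite (Vr 5) Skip (trial A)) (?f k) s' \<le> ?f (Suc k) s'"
    proof (cases "vr s' 5 = 0")
      case True
      have v8: "vr ?s 8 + 1 < 2 ^ w" "vr ?s 8 + Suc k \<le> 120 * l" using J l128 by simp_all
      have v5: "vr ?s 5 = 0" using True by simp
      have fr: "{9, 10, 11, 12} \<inter> writes (trial A) = {}" using writes_trial[of A] by auto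
      have "wp w (trial A) (\<lambda>s3. Inv Y' s3 \<and> ?J k s3) ?s"
        by (rule wp_mono[OF wp_conj[OF wp_trial[OF I' v5 at'(1) v8(1)] wp_frame]])
          (use fr J v8 in \<open>auto dest: Inv_tickD\<close>)
      moreover have "wex w (trial A) (?f k) ?s \<le> ?f (Suc k) s'"
        using trial[OF k' I' v5 at' v8(2,1)] True by simp
      ultimately show ?thesis unfolding wp_simps(5) wex_simps(4) e2 using True by simp
    next
      case False
      have "Inv Y' (tick 2 ?s)" using Inv_tick[OF I', of 2] by simp
      then show ?thesis unfolding wp_simps(5) wex_simps(4) e2
        using False J skip[of "vr s' 5" k "vr s' 8"] by simp
    qed
  qed auto
  let ?last = "Ite (Nm 60 \<otimes> Vr 2 \<prec> Vr 8) (Asg 5 (Nm 1)) Skip"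
  have last: "wp w ?last (\<lambda>s''. Inv Y s'' \<and> h (vr s'' 5) \<le> ?f 0 s') s'"
    if I: "Inv (Suc Y) s'" and J: "?J 0 s'" for s'
  proof -
    have c: "core s'" and u: "vr s' 5 \<le> 1" using I by (simp_all add: Inv_def)
    have "vr s' 2 = l" using c by (simp add: core_def)
    then have e: "aval w (Nm 60 \<otimes> Vr 2 \<prec> Vr 8) s' = of_bool (60 * l < vr s' 8)"
      using l128 small[of 60] small[of 1] by (simp add: take_bit_word)
    have 1: "Inv Y (tick 20 s')" by (rule Inv_tick[OF I]) simp
    have 2: "Inv Y (tick k (asg 5 1 s'))" if "k \<le> 20" for k
    proof -
      have "Inv Y (tick k s')" by (rule Inv_tick_less[OF 1 that])
      then show ?thesis by (auto simp: Inv_def core_def)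
    qed
    have f: "h (if 60 * l < vr s' 8 then 1 else vr s' 5) \<le> ?f 0 s'" by (rule fin[OF u]) (use J in simp)
    show ?thesis
    proof (cases "60 * l < vr s' 8")
      case True
      have tt: "\<And>a b s. tick a (tick b s) = tick (a + b) s" "\<And>a u s. asg 5 u (tick a s) = tick a (asg 5 u s)"
        by (simp_all add: tick_def asg_def)
      then show ?thesis
        unfolding wp_simps(5) e using True 2 f small[of 1] by (simp add: tt)
    next
      case False
      then show ?thesis
        unfolding wp_simps(5) e using f Inv_tick_less[OF 1] by simp
    qed
  qed
  have v: "vote A = Asg 8 (Nm 0) ;; ?loop ;; ?last" by (simp add: vote_def)
  have s0': "tick (elen (Nm 0) + 1) (asg 8 (aval w (Nm 0) s) s) = s0" by (simp add: s0_def numeral_2_eq_2)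
  show ?thesis
  proof
    show "wp w (vote A) (Inv Y) s"
      unfolding v wp_simps(2,4) s0'
    proof (rule wp_mono[OF conjunct1[OF loop]])
      fix s' assume I: "Inv (Suc Y) s' \<and> ?J 0 s'"
      show "wp w ?last (Inv Y) s'" by (rule wp_mono[OF last]) (use I in auto)
    qed
    have "wex w ?loop (wex w ?last (\<lambda>s'. h (vr s' 5))) s0 \<le> wex w ?loop (?f 0) s0"
    proof (rule wex_mono, rule wp_mono[OF conjunct1[OF loop]])
      fix s' assume I: "Inv (Suc Y) s' \<and> ?J 0 s'"
      show "wex w ?last (\<lambda>s'. h (vr s' 5)) s' \<le> ?f 0 s'"
        by (rule wex_le, rule wp_mono[OF last]) (use I in auto)
    qed
    also have "\<dots> \<le> ?f (120 * l) s0" using conjunct2[OF loop] unfolding len .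
    finally show "wex w (vote A) (\<lambda>s'. h (vr s' 5)) s \<le> F (120 * l) (vr s 5) 0"
      unfolding v wex_simps(2,3) s0' by (simp add: s0_def)
  qed
qed

section \<open>Error of the majority vote\<close>

definition \<delta> :: ennreal where "\<delta> = ennreal ((8 / 9) ^ (60 * l))"

lemma error_integral:
  assumes "solves A w' TT m \<Gamma>" "t \<le> TT" "0 \<le> K"
  shows "(\<integral>\<^sup>+c. ennreal K * (1 + indicator {c. halted A c \<and> answer c \<noteq> has_triangle \<Gamma>} c)
      \<partial>measure_pmf (run w' A t (input_config m \<Gamma>))) \<le> ennreal (K * (4 / 3))"
proof -
  let ?R = "run w' A t (input_config m \<Gamma>)" and ?W = "{c. halted A c \<and> answer c \<noteq> has_triangle \<Gamma>}"
  have "(\<integral>\<^sup>+c. ennreal K * (1 + indicator ?W c) \<partial>measure_pmf ?R) = ennreal K * (1 + emeasure ?R ?W)"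
    by (simp add: nn_integral_cmult nn_integral_add measure_pmf.emeasure_space_1)
  also have "\<dots> \<le> ennreal K * (1 + ennreal (1 / 3))"
    by (intro mult_left_mono add_left_mono solves_error[OF assms(1,2)]) simp
  also have "1 + ennreal (1 / 3) = ennreal (4 / 3)"
    by (simp flip: ennreal_1 ennreal_plus)
  also have "ennreal K * \<dots> = ennreal (K * (4 / 3))" using assms(3) by (simp flip: ennreal_mult)
  finally show ?thesis .
qed

lemma delta_eq: "(4 / 3) ^ (120 * l) / 2 ^ (60 * l) = ((8 / 9) ^ (60 * l) :: real)"
proof -
  have "((4 / 3) ^ (120 * l) :: real) = ((4 / 3) ^ 2) ^ (60 * l)" by (simp flip: power_mult)
  then show ?thesis by (simp add: power_divide[symmetric] power2_eq_square)
qed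

text \<open>Exponential moments: weigh a state by \<open>2\<close> to the number of votes. A trial
  votes wrongly with probability at most \<open>1 / 3\<close> and so multiplies the expected weight
  by at most \<open>4 / 3\<close>; an accepting state weighs at least \<open>2 ^ (60 * l)\<close>,
  whence \<open>delta_eq\<close>. A trial that does not halt casts no vote, and its brute-force
  search finds nothing.\<close>

lemma vote_no:
  assumes I: "Inv (Y + (480 * l + 4)) s" and at: "at_piece s" and tri: "\<not> has_triangle (PG s)"
  shows "wex w (vote A) (\<lambda>s'. of_bool (vr s' 5 \<noteq> 0)) s \<le> (if vr s 5 = 0 then \<delta> else 1)"
proof -
  define F :: "nat \<Rightarrow> nat \<Rightarrow> nat \<Rightarrow> ennreal" where
    "F k u c = (if u = 0 then ennreal (2 ^ c * (4 / 3) ^ k / 2 ^ (60 * l)) else 1)" for k u c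
  have sol: "solves A w' TT m (PG s)"
  proof -
    have "triangles (PG s) = {}" using tri by (simp add: has_triangle_def)
    then have "card (triangles (PG s)) \<le> 1" by simp
    then show ?thesis using solves at by (auto simp: at_piece_def PG_def)
  qed
  have "wp w (vote A) (Inv Y) s \<and> wex w (vote A) (\<lambda>s'. of_bool (vr s' 5 \<noteq> 0)) s \<le> F (120 * l) (vr s 5) 0"
  proof (rule vote_rule[OF I at])
    fix k s' Y' assume h: "Inv (Suc Y') s'" "vr s' 5 = 0" "at_piece s'" "PG s' = PG s" "vr s' 8 + 1 < 2 ^ w"
    define K :: real where "K = 2 ^ vr s' 8 * (4 / 3) ^ k / 2 ^ (60 * l)"
    have "wex w (trial A) (\<lambda>s3. F k (vr s3 5) (vr s3 8)) s' \<le>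
      (\<integral>\<^sup>+c. ennreal K * (1 + indicator {c. halted A c \<and> answer c \<noteq> has_triangle (PG s')} c)
       \<partial>measure_pmf (run w' A (vr s' 7) (input_config m (PG s'))))"
    proof (rule wex_trial[OF h(1-3,5)])
      fix c s3 assume s3: "vr s3 8 = vr s' 8 + of_bool (halted A c \<and> answer c)"
        "vr s3 5 = of_bool (\<not> halted A c \<and> has_triangle (PG s'))"
      have "K * 2 = 2 ^ Suc (vr s' 8) * (4 / 3) ^ k / 2 ^ (60 * l)" by (simp add: K_def)
      moreover have "0 \<le> K" by (simp add: K_def)
      then have "ennreal K * 2 = ennreal (K * 2)" by (simp add: ennreal_mult)
      ultimately show "F k (vr s3 5) (vr s3 8) \<le> ennreal K * (1 + indicator {c. halted A c \<and> answer c \<noteq> has_triangle (PG s')} c)"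
        using s3 tri h(4) by (auto simp: F_def K_def[symmetric] indicator_def)
    qed
    also have "\<dots> \<le> ennreal (K * (4 / 3))"
      using h sol by (intro error_integral) (auto simp: Inv_def K_def)
    also have "\<dots> = F (Suc k) 0 (vr s' 8)" by (simp add: F_def K_def)
    finally show "wex w (trial A) (\<lambda>s3. F k (vr s3 5) (vr s3 8)) s' \<le> F (Suc k) 0 (vr s' 8)" .
  next
    fix u c :: nat assume "u \<le> 1" "c \<le> 120 * l"
    have "1 \<le> (2 ^ c / 2 ^ (60 * l) :: real)" if "60 * l < c"
      using that by (simp add: power_increasing)
    then have "1 \<le> ennreal (2 ^ c / 2 ^ (60 * l))" if "60 * l < c"
      using that by (simp flip: ennreal_1 add: ennreal_leI)
    then show "of_bool ((if 60 * l < c then 1 else u) \<noteq> 0) \<le> F 0 u c"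
      by (auto simp: F_def)
  qed (simp add: F_def)
  moreover have "F (120 * l) (vr s 5) 0 = (if vr s 5 = 0 then \<delta> else 1)"
    by (cases "vr s 5 = 0") (simp_all add: F_def delta_eq \<delta>_def)
  ultimately show ?thesis by simp
qed

text \<open>The mirror image of \<open>vote_no\<close>: the exponent \<open>120 * l - k - c\<close>
  counts the trials so far without a vote. If a run is cut off, the brute-force search finds the
  triangle and the weight drops to 0.\<close>

lemma vote_yes:
  assumes I: "Inv (Y + (480 * l + 4)) s" and at: "at_piece s" and tri: "has_triangle (PG s)"
    and one: "card (triangles (PG s)) \<le> 1"
  shows "wex w (vote A) (\<lambda>s'. of_bool (vr s' 5 = 0)) s \<le> (if vr s 5 = 0 then \<delta> else 0)"
proof -
  define F :: "nat \<Rightarrow> nat \<Rightarrow> nat \<Rightarrow> ennreal" where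
    "F k u c = (if u = 0 then ennreal (2 ^ (120 * l - k - c) * (4 / 3) ^ k / 2 ^ (60 * l)) else 0)" for k u c
  have sol: "solves A w' TT m (PG s)" using solves at one by (auto simp: at_piece_def PG_def)
  have "wp w (vote A) (Inv Y) s \<and> wex w (vote A) (\<lambda>s'. of_bool (vr s' 5 = 0)) s \<le> F (120 * l) (vr s 5) 0"
  proof (rule vote_rule[OF I at])
    fix k s' Y' assume h: "Inv (Suc Y') s'" "vr s' 5 = 0" "at_piece s'" "PG s' = PG s" "vr s' 8 + 1 < 2 ^ w"
      and le: "vr s' 8 + Suc k \<le> 120 * l"
    define K :: real where "K = 2 ^ (120 * l - Suc k - vr s' 8) * (4 / 3) ^ k / 2 ^ (60 * l)"
    have "wex w (trial A) (\<lambda>s3. F k (vr s3 5) (vr s3 8)) s' \<le>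
      (\<integral>\<^sup>+c. ennreal K * (1 + indicator {c. halted A c \<and> answer c \<noteq> has_triangle (PG s')} c)
       \<partial>measure_pmf (run w' A (vr s' 7) (input_config m (PG s'))))"
    proof (rule wex_trial[OF h(1-3,5)])
      fix c s3 assume s3: "vr s3 8 = vr s' 8 + of_bool (halted A c \<and> answer c)"
        "vr s3 5 = of_bool (\<not> halted A c \<and> has_triangle (PG s'))"
      have "120 * l - k - vr s' 8 = Suc (120 * l - Suc k - vr s' 8)" using le by simp
      then have "K * 2 = 2 ^ (120 * l - k - vr s' 8) * (4 / 3) ^ k / 2 ^ (60 * l)" by (simp add: K_def)
      moreover have "0 \<le> K" by (simp add: K_def)
      then have "ennreal K * 2 = ennreal (K * 2)" by (simp add: ennreal_mult)
      ultimately have e: "F k 0 (vr s' 8) = ennreal K * 2" by (simp add: F_def)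
      have e': "F k 0 (Suc (vr s' 8)) = ennreal K" by (simp add: F_def K_def)
      have e'': "F k (Suc 0) c = 0" for c by (simp add: F_def)
      show "F k (vr s3 5) (vr s3 8) \<le> ennreal K * (1 + indicator {c. halted A c \<and> answer c \<noteq> has_triangle (PG s')} c)"
        using s3 tri h(4) by (auto simp: e e' e'' indicator_def)
    qed
    also have "\<dots> \<le> ennreal (K * (4 / 3))"
      using h sol by (intro error_integral) (auto simp: Inv_def K_def)
    also have "\<dots> = F (Suc k) 0 (vr s' 8)" by (simp add: F_def K_def)
    finally show "wex w (trial A) (\<lambda>s3. F k (vr s3 5) (vr s3 8)) s' \<le> F (Suc k) 0 (vr s' 8)" .
  next
    fix u c :: nat assume "u \<le> 1" "c \<le> 120 * l"
    have "1 \<le> (2 ^ (120 * l - c) / 2 ^ (60 * l) :: real)" if "\<not> 60 * l < c"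
      using that by (simp add: power_increasing)
    then have "1 \<le> ennreal (2 ^ (120 * l - c) / 2 ^ (60 * l))" if "\<not> 60 * l < c"
      using that by (simp flip: ennreal_1 add: ennreal_leI)
    then show "of_bool ((if 60 * l < c then 1 else u) = 0) \<le> F 0 u c"
      by (auto simp: F_def)
  qed (simp add: F_def)
  moreover have "F (120 * l) (vr s 5) 0 = (if vr s 5 = 0 then \<delta> else 0)"
    by (cases "vr s 5 = 0") (simp_all add: F_def delta_eq \<delta>_def)
  ultimately show ?thesis by simp
qed

text \<open>For pieces without any guarantee: resources are respected and an answer once set is
  never revoked.\<close>

lemma vote_any:
  assumes I: "Inv (Y + (480 * l + 4)) s" and at: "at_piece s"
  shows "wp w (vote A) (Inv Y) s"
    and "wex w (vote A) (\<lambda>s'. if vr s' 5 = 0 then r else 0) s \<le> (if vr s 5 = 0 then r else 0)"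
proof -
  define F where "F k u (c::nat) = (if u = 0 then r else 0)" for k u c :: nat
  have "wp w (vote A) (Inv Y) s \<and> wex w (vote A) (\<lambda>s'. if vr s' 5 = 0 then r else 0) s \<le> F (120 * l) (vr s 5) 0"
  proof (rule vote_rule[OF I at])
    fix k s' show "wex w (trial A) (\<lambda>s3. F k (vr s3 5) (vr s3 8)) s' \<le> F (Suc k) 0 (vr s' 8)"
      by (rule wex_le) (simp add: wp_def F_def)
  qed (auto simp: F_def)
  then show "wp w (vote A) (Inv Y) s"
    "wex w (vote A) (\<lambda>s'. if vr s' 5 = 0 then r else 0) s \<le> (if vr s 5 = 0 then r else 0)"
    by (simp_all add: F_def)
qed

section \<open>Nested loops over the pieces, and the rounds around them\<close>

definition "XK = g * (480 * l + 4 + 2) + 2"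
definition "XJ = g * (XK + 2) + 2"
definition "XI = g * (XJ + 2) + 2"

text \<open>\<open>f1\<close>, \<open>f2\<close> and \<open>f3\<close> are the potentials of the
  outer, middle and inner loop, indexed by the turns left. An inner potential has to start below the
  outer one and end above it; the inner loops make \<open>i\<close> and \<open>j\<close> turns,
  hence \<open>f2 i i\<close> and \<open>f3 i j j\<close> at their starts.\<close>

lemma pieces_rule:
  assumes I: "Inv (Y + XI) s" and a: "odd (vr s 9)" "vr s 9 < p"
    and vote: "\<And>i j k s' Y'. k < j \<Longrightarrow> j < i \<Longrightarrow> i < g \<Longrightarrow> Inv (Y' + (480 * l + 4)) s' \<Longrightarrow> at_piece s' \<Longrightarrow>
      vr s' 9 = vr s 9 \<Longrightarrow> vr s' 10 = i \<Longrightarrow> vr s' 11 = j \<Longrightarrow> vr s' 12 = k \<Longrightarrow>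
      wex w (vote A) (\<lambda>s'. f3 i j k (vr s' 5)) s' \<le> f3 i j (Suc k) (vr s' 5)"
    and f2: "\<And>i j u. j < i \<Longrightarrow> i < g \<Longrightarrow> f2 i j u \<le> f3 i j 0 u" "\<And>i j u. j < i \<Longrightarrow> i < g \<Longrightarrow> f3 i j j u \<le> f2 i (Suc j) u"
    and f1: "\<And>i u. i < g \<Longrightarrow> f1 i u \<le> f2 i 0 u" "\<And>i u. i < g \<Longrightarrow> f2 i i u \<le> f1 (Suc i) u"
  shows "wp w (all_pieces A) (Inv Y) s \<and> wex w (all_pieces A) (\<lambda>s'. f1 0 (vr s' 5)) s \<le> f1 g (vr s 5)"
proof -
  have sub: "{9, 10, 11, 12} \<inter> writes (vote A) = {}" using writes_trial[of A] by (auto simp: vote_def)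
  have kl: "wp w (For 12 (Vr 11) (vote A)) (\<lambda>s'. Inv Y' s' \<and> vr s' 9 = vr s 9 \<and> vr s' 10 = i) s' \<and>
      wex w (For 12 (Vr 11) (vote A)) (\<lambda>s'. f2 i j (vr s' 5)) s' \<le> f2 i (Suc j) (vr s' 5)"
    if h: "j < i" "i < g" "Inv (Y' + XK) s'" "vr s' 9 = vr s 9" "vr s' 10 = i" "vr s' 11 = j" for i j s' Y'
  proof -
    let ?J = "\<lambda>k s'. vr s' 9 = vr s 9 \<and> vr s' 10 = i \<and> vr s' 11 = j"
    have "wp w (For 12 (Vr 11) (vote A)) (\<lambda>s'. Inv Y' s' \<and> ?J 0 s') s' \<and>
      wex w (For 12 (Vr 11) (vote A)) (\<lambda>s'. f3 i j 0 (vr s' 5)) s' \<le> f3 i j (aval w (Vr 11) s') (vr s' 5)"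
    proof (rule For_Inv[where X = "480 * l + 4"])
      show "Inv (Y' + (aval w (Vr 11) s' * (480 * l + 4 + 2) + 2)) s'"
        by (rule Inv_mono[OF h(3)]) (use h in \<open>simp add: XK_def\<close>)
    next
      fix k s1 Y1 assume k: "k < aval w (Vr 11) s'" "vr s1 12 = k" "Inv (Y1 + (480 * l + 4)) s1" and J: "?J (Suc k) s1"
      have at: "at_piece s1" using k J h a by (simp add: at_piece_def)
      have "wp w (vote A) (\<lambda>s2. Inv Y1 s2 \<and> ?J k s2) s1"
        by (rule wp_mono[OF wp_conj[OF vote_any(1)[OF k(3) at] wp_frame]]) (use sub J in auto)
      moreover have "k < j" using k h by simp
      ultimately show "wp w (vote A) (\<lambda>s2. Inv Y1 s2 \<and> ?J k s2) s1 \<and>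
        wex w (vote A) (\<lambda>s'. f3 i j k (vr s' 5)) s1 \<le> f3 i j (Suc k) (vr s1 5)"
        using vote[of k j i Y1 s1] h k(2,3) at J by blast
    qed (use h in auto)
    moreover have "wex w (For 12 (Vr 11) (vote A)) (\<lambda>s'. f2 i j (vr s' 5)) s' \<le> wex w (For 12 (Vr 11) (vote A)) (\<lambda>s'. f3 i j 0 (vr s' 5)) s'"
      by (rule wex_mono) (use f2(1) h in \<open>simp add: wp_def\<close>)
    moreover have "f3 i j (aval w (Vr 11) s') (vr s' 5) \<le> f2 i (Suc j) (vr s' 5)" using f2(2) h by simp
    ultimately show ?thesis by (auto elim: wp_mono order_trans)
  qed
  let ?jl = "For 11 (Vr 10) (For 12 (Vr 11) (vote A))"
  have jl: "wp w ?jl (\<lambda>s'. Inv Y' s' \<and> vr s' 9 = vr s 9) s' \<and>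
      wex w ?jl (\<lambda>s'. f1 i (vr s' 5)) s' \<le> f1 (Suc i) (vr s' 5)"
    if h: "i < g" "Inv (Y' + XJ) s'" "vr s' 9 = vr s 9" "vr s' 10 = i" for i s' Y'
  proof -
    let ?J = "\<lambda>k s'. vr s' 9 = vr s 9 \<and> vr s' 10 = i"
    have "wp w ?jl (\<lambda>s'. Inv Y' s' \<and> ?J 0 s') s' \<and>
      wex w ?jl (\<lambda>s'. f2 i 0 (vr s' 5)) s' \<le> f2 i (aval w (Vr 10) s') (vr s' 5)"
    proof (rule For_Inv[where X = XK])
      have "aval w (Vr 10) s' * (XK + 2) \<le> g * (XK + 2)" using h by (intro mult_right_mono) auto
      then show "Inv (Y' + (aval w (Vr 10) s' * (XK + 2) + 2)) s'"
        by (intro Inv_mono[OF h(2)]) (simp only: XJ_def add_le_mono order_refl)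
    next
      fix k s1 Y1 assume "k < aval w (Vr 10) s'" "vr s1 11 = k" "Inv (Y1 + XK) s1" "?J (Suc k) s1"
      then show "wp w (For 12 (Vr 11) (vote A)) (\<lambda>s2. Inv Y1 s2 \<and> ?J k s2) s1 \<and>
        wex w (For 12 (Vr 11) (vote A)) (\<lambda>s'. f2 i k (vr s' 5)) s1 \<le> f2 i (Suc k) (vr s1 5)"
        using kl[of k i Y1 s1] h by simp
    qed (use h in auto)
    moreover have "wex w ?jl (\<lambda>s'. f1 i (vr s' 5)) s' \<le> wex w ?jl (\<lambda>s'. f2 i 0 (vr s' 5)) s'"
      by (rule wex_mono) (use f1(1) h in \<open>simp add: wp_def\<close>)
    moreover have "f2 i (aval w (Vr 10) s') (vr s' 5) \<le> f1 (Suc i) (vr s' 5)" using f1(2) h by simp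
    ultimately show ?thesis by (auto elim: wp_mono order_trans)
  qed
  have core: "core s" using I by (simp add: Inv_def)
  let ?J = "\<lambda>(k::nat) s'. vr s' 9 = vr s 9"
  have "wp w (all_pieces A) (\<lambda>s'. Inv Y s' \<and> ?J 0 s') s \<and>
      wex w (all_pieces A) (\<lambda>s'. f1 0 (vr s' 5)) s \<le> f1 (aval w eg s) (vr s 5)"
    unfolding all_pieces_def
  proof (rule For_Inv[where X = XJ])
    show "Inv (Y + (aval w eg s * (XJ + 2) + 2)) s"
      using I by (simp add: XI_def aval_consts(3)[OF core])
  next
    fix k s1 Y1 assume k: "k < aval w eg s" "vr s1 10 = k" "Inv (Y1 + XJ) s1" "?J (Suc k) s1"
    have "k < g" using k(1) unfolding aval_consts(3)[OF core] .
    then show "wp w ?jl (\<lambda>s2. Inv Y1 s2 \<and> ?J k s2) s1 \<and> wex w ?jl (\<lambda>s'. f1 k (vr s' 5)) s1 \<le> f1 (Suc k) (vr s1 5)"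
      using jl[of k Y1 s1] k by simp
  qed (auto simp: eg_def)
  then show ?thesis unfolding aval_consts(3)[OF core] by (auto elim: wp_mono)
qed

abbreviation choose_mult :: com where
  "choose_mult \<equiv> Rnd 9 ;; Asg 9 ((Vr 9 \<odot> (ep \<oslash> Nm 2)) \<otimes> Nm 2 \<oplus> Nm 1)"

lemma half_p: "p div 2 = 2 ^ (2 * l - 1)" "2 * (p div 2) = p"
proof -
  have "p = 2 * 2 ^ (2 * l - 1)" unfolding p_pow using q(4) by (simp flip: power_Suc)
  then show "p div 2 = 2 ^ (2 * l - 1)" "2 * (p div 2) = p" by simp_all
qed

lemma aval_mult:
  assumes "core s" "vr s 9 = v"
  shows "aval w ((Vr 9 \<odot> (ep \<oslash> Nm 2)) \<otimes> Nm 2 \<oplus> Nm 1) s = 2 * (v mod (p div 2)) + 1"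
proof -
  have "0 < p div 2" unfolding half_p by simp
  then have "v mod (p div 2) < p div 2" by simp
  then have "2 * (v mod (p div 2)) + 1 < p" using half_p(2) by linarith
  then have "2 * (v mod (p div 2)) + 1 < 2 ^ w" using p_less by simp
  then show ?thesis
    using assms(2) small[of 1] small[of 2] by (simp add: aval_consts(2)[OF assms(1)] take_bit_word mult.commute)
qed

lemma mult_ok: "odd (2 * (v mod (p div 2)) + 1)" "2 * (v mod (p div 2)) + 1 < p"
proof -
  have "0 < p div 2" unfolding half_p by simp
  then have "v mod (p div 2) < p div 2" by simp
  then show "2 * (v mod (p div 2)) + 1 < p" using half_p(2) by linarith
qed simp

lemma wp_choose:
  assumes "Inv (Suc Y) s"
  shows "wp w choose_mult (\<lambda>s'. Inv Y s' \<and> odd (vr s' 9) \<and> vr s' 9 < p \<and> vr s' 5 = vr s 5) s"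
proof -
  have t: "elen ((Vr 9 \<odot> (ep \<oslash> Nm 2)) \<otimes> Nm 2 \<oplus> Nm 1) + 1 = 12" by (simp add: ep_def)
  have tt: "tick 12 (asg 9 b (tick 1 (asg 9 a s))) = tick 13 (asg 9 b s)" for a b
    by (simp add: tick_def asg_def)
  have I: "Inv Y (tick 13 (asg 9 b s))" for b using assms by (intro Inv_tick) (auto simp: Inv_asg)
  have c: "core (tick 1 (asg 9 v s))" for v using assms by (auto simp: Inv_def core_def)
  show ?thesis
    unfolding wp_simps wp_Rnd t aval_mult[OF c refl] tt using I mult_ok by simp
qed

lemma wex_Rnd: "wex w (Rnd x) f s = (\<integral>\<^sup>+v. f (tick 1 (asg x v s)) \<partial>measure_pmf (pmf_of_set {..<2 ^ w}))"
  by (simp add: wex_def)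

lemma wex_choose:
  assumes "core s"
  shows "wex w choose_mult (\<lambda>s'. h (vr s' 9)) s =
    (\<integral>\<^sup>+x. h (2 * x + 1) \<partial>measure_pmf (pmf_of_set {..<2 ^ (2 * l - 1)}))"
proof -
  have c: "core (tick 1 (asg 9 v s))" for v using assms by (auto simp: core_def)
  have le: "2 * l - 1 \<le> w" using w(2) by simp
  have "wex w choose_mult (\<lambda>s'. h (vr s' 9)) s =
      (\<integral>\<^sup>+v. h (2 * (v mod 2 ^ (2 * l - 1)) + 1) \<partial>measure_pmf (pmf_of_set {..<2 ^ w}))"
    unfolding wex_simps wex_Rnd aval_mult[OF c refl] half_p(1) by simp
  also have "\<dots> = (\<integral>\<^sup>+x. h (2 * x + 1) \<partial>measure_pmf (map_pmf (\<lambda>v. v mod 2 ^ (2 * l - 1)) (pmf_of_set {..<2 ^ w})))"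
    by simp
  finally show ?thesis unfolding map_mod_pmf_of_set[OF le] .
qed

definition "XR = 2 * l * (XI + 1 + 2) + 2"

lemma rounds_rule:
  assumes I: "Inv (Y + XR) s"
    and step: "\<And>r s' Y'. Inv (Y' + (XI + 1)) s' \<Longrightarrow>
      wp w (choose_mult ;; all_pieces A) (Inv Y') s' \<and>
      wex w (choose_mult ;; all_pieces A) (\<lambda>s'. F r (vr s' 5)) s' \<le> F (Suc r) (vr s' 5)"
  shows "wp w (rounds A) (Inv Y) s \<and> wex w (rounds A) (\<lambda>s'. F 0 (vr s' 5)) s \<le> F (2 * l) (vr s 5)"
proof -
  have core: "core s" using I by (simp add: Inv_def)
  have lq: "l < q" unfolding q(1) by simp
  then have "2 * l < 2 ^ w" using p_less(4) by simp
  then have len: "aval w (Nm 2 \<otimes> Vr 2) s = 2 * l"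
    using core small[of 2] by (simp add: core_def take_bit_word)
  have "wp w (rounds A) (\<lambda>s'. Inv Y s' \<and> True) s \<and>
     wex w (rounds A) (\<lambda>s'. F 0 (vr s' 5)) s \<le> F (aval w (Nm 2 \<otimes> Vr 2) s) (vr s 5)"
    unfolding rounds_def
  proof (rule For_Inv[where X = "XI + 1" and J = "\<lambda>_ _. True"])
    show "Inv (Y + (aval w (Nm 2 \<otimes> Vr 2) s * (XI + 1 + 2) + 2)) s" unfolding len using I by (simp add: XR_def)
  qed (use step in auto)
  then show ?thesis unfolding len by simp
qed

lemma wex_add_const: "wex w c (\<lambda>s. f s + r) s = wex w c f s + r"
  by (simp add: wex_def nn_integral_add measure_pmf.emeasure_space_1)

lemma pieces_any:
  assumes I: "Inv (Y + XI) s" and a: "odd (vr s 9)" "vr s 9 < p"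
  shows "wp w (all_pieces A) (Inv Y) s"
    and "wex w (all_pieces A) (\<lambda>s'. if vr s' 5 = 0 then r else 0) s \<le> (if vr s 5 = 0 then r else 0)"
proof -
  define f where "f u = (if u = 0 then r else 0)" for u :: nat
  have "wp w (all_pieces A) (Inv Y) s \<and> wex w (all_pieces A) (\<lambda>s'. (\<lambda>_. f) (0::nat) (vr s' 5)) s \<le> (\<lambda>_. f) g (vr s 5)"
  proof (rule pieces_rule[where ?f1.0 = "\<lambda>_. f" and ?f2.0 = "\<lambda>_ _. f" and ?f3.0 = "\<lambda>_ _ _. f", OF I a])
    fix s' Y' assume "Inv (Y' + (480 * l + 4)) s'" "at_piece s'"
    from vote_any(2)[OF this, of r] show "wex w (vote A) (\<lambda>s'. f (vr s' 5)) s' \<le> f (vr s' 5)"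
      by (simp add: f_def)
  qed auto
  then show "wp w (all_pieces A) (Inv Y) s"
    "wex w (all_pieces A) (\<lambda>s'. if vr s' 5 = 0 then r else 0) s \<le> (if vr s 5 = 0 then r else 0)"
    by (simp_all add: f_def)
qed

lemma wp_round:
  assumes I: "Inv (Y + (XI + 1)) s"
  shows "wp w (choose_mult ;; all_pieces A) (Inv Y) s"
proof -
  have "Inv (Suc (Y + XI)) s" using I by simp
  from wp_choose[OF this] show ?thesis
    unfolding wp_simps(4)[of w choose_mult] by (rule wp_mono) (auto intro: pieces_any)
qed

text \<open>A union bound written as a potential: \<open>\<Psi>\<close> adds \<open>\<delta>\<close>
  for every vote still to come, with \<open>g * g * g\<close> votes allowed per round.\<close>

lemma rounds_no:
  assumes I: "Inv (Y + XR) s" and G0: "\<not> has_triangle G" and s5: "vr s 5 = 0"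
  shows "wp w (rounds A) (Inv Y) s \<and>
    wex w (rounds A) (\<lambda>s'. of_bool (vr s' 5 \<noteq> 0)) s \<le> of_nat (2 * l * (g * g * g)) * \<delta>"
proof -
  define \<Psi> :: "nat \<Rightarrow> nat \<Rightarrow> ennreal" where "\<Psi> c u = of_bool (u \<noteq> 0) + of_nat c * \<delta>" for c u
  have \<Psi>_mono: "\<Psi> c u \<le> \<Psi> c' u" if "c \<le> c'" for c c' u
    using that unfolding \<Psi>_def by (intro add_left_mono mult_right_mono) auto
  have vote: "wex w (vote A) (\<lambda>s'. \<Psi> c (vr s' 5)) s' \<le> \<Psi> (Suc c) (vr s' 5)"
    if h: "Inv (Y' + (480 * l + 4)) s'" "at_piece s'" for c s' Y'
  proof -
    have "\<not> has_triangle (PG s')" using G0 has_triangle_piece by (auto simp: PG_def)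
    from vote_no[OF h this] have "wex w (vote A) (\<lambda>s'. \<Psi> c (vr s' 5)) s' \<le> (if vr s' 5 = 0 then \<delta> else 1) + of_nat c * \<delta>"
      unfolding \<Psi>_def wex_add_const by (rule add_right_mono)
    also have "\<dots> \<le> \<Psi> (Suc c) (vr s' 5)"
      by (auto simp: \<Psi>_def algebra_simps)
    finally show ?thesis .
  qed
  have pieces: "wex w (all_pieces A) (\<lambda>s'. \<Psi> c (vr s' 5)) s' \<le> \<Psi> (c + g * g * g) (vr s' 5)"
    if h: "Inv (Y' + XI) s'" "odd (vr s' 9)" "vr s' 9 < p" for c s' Y'
  proof -
    let ?f1 = "\<lambda>i. \<Psi> (c + i * (g * g))" and ?f2 = "\<lambda>i j. \<Psi> (c + i * (g * g) + j * g)"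
      and ?f3 = "\<lambda>i j k. \<Psi> (c + i * (g * g) + j * g + k)"
    have "wp w (all_pieces A) (Inv Y') s' \<and> wex w (all_pieces A) (\<lambda>s'. ?f1 0 (vr s' 5)) s' \<le> ?f1 g (vr s' 5)"
    proof (rule pieces_rule[where ?f1.0 = ?f1 and ?f2.0 = ?f2 and ?f3.0 = ?f3, OF h])
      fix i j k s1 Y1 assume "Inv (Y1 + (480 * l + 4)) s1" "at_piece s1"
      from vote[OF this] show "wex w (vote A) (\<lambda>s'. ?f3 i j k (vr s' 5)) s1 \<le> ?f3 i j (Suc k) (vr s1 5)"
        by simp
    next
      fix i j u :: nat assume "j < i" "i < g"
      then have "c + i * (g * g) + j * g + j \<le> c + i * (g * g) + Suc j * g" by simp
      then show "?f3 i j j u \<le> ?f2 i (Suc j) u" by (rule \<Psi>_mono)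
    next
      fix i u :: nat assume "i < g"
      then have "i * g \<le> g * g" by (intro mult_right_mono) auto
      then have "c + i * (g * g) + i * g \<le> c + Suc i * (g * g)" unfolding mult_Suc by linarith
      then show "?f2 i i u \<le> ?f1 (Suc i) u" by (rule \<Psi>_mono)
    qed auto
    then show ?thesis by (simp add: mult.assoc)
  qed
  have "wp w (rounds A) (Inv Y) s \<and>
    wex w (rounds A) (\<lambda>s'. \<Psi> (0 * (g * g * g)) (vr s' 5)) s \<le> \<Psi> (2 * l * (g * g * g)) (vr s 5)"
  proof (rule rounds_rule[where F = "\<lambda>r. \<Psi> (r * (g * g * g))", OF I])
    fix r s' Y' assume I: "Inv (Y' + (XI + 1)) s'"
    then have "Inv (Suc (Y' + XI)) s'" by simp
    note ch = wp_choose[OF this]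
    have "wex w (choose_mult ;; all_pieces A) (\<lambda>s'. \<Psi> (r * (g * g * g)) (vr s' 5)) s' \<le> \<Psi> (Suc r * (g * g * g)) (vr s' 5)"
      unfolding wex_simps(3)[of w choose_mult]
    proof (rule wex_le, rule wp_mono[OF ch])
      fix s1 assume h: "Inv (Y' + XI) s1 \<and> odd (vr s1 9) \<and> vr s1 9 < p \<and> vr s1 5 = vr s' 5"
      then show "wex w (all_pieces A) (\<lambda>s'. \<Psi> (r * (g * g * g)) (vr s' 5)) s1 \<le> \<Psi> (Suc r * (g * g * g)) (vr s' 5)"
        using pieces[of Y' s1 "r * (g * g * g)"] by (simp add: add.commute)
    qed
    with wp_round[OF I] show "wp w (choose_mult ;; all_pieces A) (Inv Y') s' \<and>
      wex w (choose_mult ;; all_pieces A) (\<lambda>s'. \<Psi> (r * (g * g * g)) (vr s' 5)) s' \<le> \<Psi> (Suc r * (g * g * g)) (vr s' 5)" ..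
  qed
  then show ?thesis using s5 by (simp add: \<Psi>_def)
qed

lemma block_less: "odd a \<Longrightarrow> x < p \<Longrightarrow> block p L a x < g"
proof -
  assume a: "odd a" "x < p"
  then obtain P where P: "P < 2 ^ (2 * l)" "a * P mod 2 ^ (2 * l) = x"
    using ex_position unfolding p_pow by blast
  have "P < g * L" unfolding g_mult_L p_pow by (rule P(1))
  then have "P div L < g" by (rule less_mult_imp_div_less)
  then show ?thesis using block_eq[OF a(1) P(1), of L] P(2) unfolding p_pow by simp
qed

lemma sorted_triple:
  fixes x y z :: nat
  assumes "x \<noteq> y" "y \<noteq> z" "x \<noteq> z"
  shows "\<exists>i j k. k < j \<and> j < i \<and> {x, y, z} = {i, j, k}"
proof -
  consider "z < y" "y < x" | "y < z" "z < x" | "z < x" "x < y" | "x < z" "z < y" | "y < x" "x < z" | "x < y" "y < z"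
    using assms by linarith
  then show ?thesis by cases blast+
qed

text \<open>The potential is \<open>\<delta>\<close> as long as the isolating piece
  \<open>(i', j', k')\<close> is still ahead in the lexicographic countdown and 1 afterwards. The
  vote on that piece pays for the change; every other vote leaves the potential alone.\<close>

lemma pieces_isolated:
  assumes I: "Inv (Y + XI) s" and a: "odd (vr s 9)" "vr s 9 < p"
    and xyz: "{x, y} \<in> edges G" "{y, z} \<in> edges G" "{x, z} \<in> edges G"
    and b: "let b = block p L (vr s 9) in b x \<noteq> b y \<and> b y \<noteq> b z \<and> b x \<noteq> b z \<and>
        (\<forall>t\<in>triangles G. b ` t \<subseteq> b ` {x, y, z} \<longrightarrow> t = {x, y, z})"
  shows "wex w (all_pieces A) (\<lambda>s'. of_bool (vr s' 5 = 0)) s \<le> (if vr s 5 = 0 then \<delta> else 0)"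
proof -
  let ?b = "block p L (vr s 9)"
  have bn: "?b x \<noteq> ?b y" "?b y \<noteq> ?b z" "?b x \<noteq> ?b z"
    and bo: "\<And>t. t \<in> triangles G \<Longrightarrow> ?b ` t \<subseteq> ?b ` {x, y, z} \<Longrightarrow> t = {x, y, z}"
    using b unfolding Let_def by blast+
  obtain i' j' k' where ijk: "k' < j'" "j' < i'" "{?b x, ?b y, ?b z} = {i', j', k'}"
    using sorted_triple[OF bn] by blast
  have im: "?b ` {x, y, z} = {i', j', k'}" using ijk(3) by simp
  have "x < p" "y < p" "z < p" using edge_in_verts[OF G(1)] xyz G(2) n_le_p by force+
  then have "?b x < g" "?b y < g" "?b z < g" using block_less[OF a(1)] by blast+
  then have "i' < g" using ijk(3) by (metis insertE insertI1 singletonD)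
  define \<Gamma> where "\<Gamma> = piece G n m p L (vr s 9) (i', j', k')"
  have \<Gamma>: "has_triangle \<Gamma>" "card (triangles \<Gamma>) \<le> 1"
    using piece_isolated[OF a(1) \<open>i' < g\<close> _ _ _ _ _ g_mult_L[unfolded p_pow] G(1,2) n_le_p[unfolded p_pow] L_bounds(2) three_L_le_m xyz
      im[unfolded p_pow] bo[unfolded p_pow im[unfolded p_pow]]] ijk(1,2) \<open>i' < g\<close>
    unfolding \<Gamma>_def p_pow by auto
  define v where "v c = (if c then \<delta> else 1)" for c
  let ?f1 = "\<lambda>i (u::nat). if u = 0 then v (i' < i) else 0"
  let ?f2 = "\<lambda>i j (u::nat). if u = 0 then v (i' < i \<or> (i' = i \<and> j' < j)) else 0"
  let ?f3 = "\<lambda>i j k (u::nat). if u = 0 then v (i' < i \<or> (i' = i \<and> (j' < j \<or> (j' = j \<and> k' < k)))) else 0"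
  have main: "wp w (all_pieces A) (Inv Y) s \<and> wex w (all_pieces A) (\<lambda>s'. ?f1 0 (vr s' 5)) s \<le> ?f1 g (vr s 5)"
  proof (rule pieces_rule[where ?f1.0 = ?f1 and ?f2.0 = ?f2 and ?f3.0 = ?f3, OF I a])
    fix i j k s1 Y1 assume kji: "k < j" "j < i" "i < g" and I: "Inv (Y1 + (480 * l + 4)) s1" and at: "at_piece s1"
      and vs: "vr s1 9 = vr s 9" "vr s1 10 = i" "vr s1 11 = j" "vr s1 12 = k"
    show "wex w (vote A) (\<lambda>s'. ?f3 i j k (vr s' 5)) s1 \<le> ?f3 i j (Suc k) (vr s1 5)"
    proof (cases "i = i' \<and> j = j' \<and> k = k'")
      case True
      then have "PG s1 = \<Gamma>" using vs by (simp add: PG_def \<Gamma>_def)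
      moreover have fe: "(\<lambda>s'. ?f3 i j k (vr s' 5)) = (\<lambda>s'. of_bool (vr s' 5 = 0))"
        using True by (auto simp: v_def)
      moreover have "v (i' < i \<or> (i' = i \<and> (j' < j \<or> (j' = j \<and> k' < Suc k)))) = \<delta>"
        using True by (simp add: v_def)
      ultimately show ?thesis unfolding fe using vote_yes[OF I at] \<Gamma> by (simp only: simp_thms)
    next
      case False
      have "wex w (vote A) (\<lambda>s'. ?f3 i j k (vr s' 5)) s1 \<le> ?f3 i j k (vr s1 5)"
        by (rule vote_any(2)[OF I at])
      moreover have "(i' < i \<or> (i' = i \<and> (j' < j \<or> (j' = j \<and> k' < k)))) = (i' < i \<or> (i' = i \<and> (j' < j \<or> (j' = j \<and> k' < Suc k))))"
        using False by auto
      then have "?f3 i j k (vr s1 5) = ?f3 i j (Suc k) (vr s1 5)" by (simp only:)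
      ultimately show ?thesis by (simp only:)
    qed
  next
    fix i j u :: nat assume "j < i" "i < g"
    have "(i' < i \<or> (i' = i \<and> (j' < j \<or> (j' = j \<and> k' < j)))) = (i' < i \<or> (i' = i \<and> j' < Suc j))"
      using ijk(1) by auto
    then show "?f3 i j j u \<le> ?f2 i (Suc j) u" by simp
  next
    fix i u :: nat assume "i < g"
    have "(i' < i \<or> (i' = i \<and> j' < i)) = (i' < Suc i)" using ijk(2) by auto
    then show "?f2 i i u \<le> ?f1 (Suc i) u" by simp
  qed auto
  have fe: "(\<lambda>s'. ?f1 0 (vr s' 5)) = (\<lambda>s'. of_bool (vr s' 5 = 0))" by (auto simp: v_def)
  have vg: "v (i' < g) = \<delta>" using \<open>i' < g\<close> by (simp add: v_def)
  show ?thesis using main[unfolded fe vg] ..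
qed

lemma delta_le: "\<delta> \<le> ennreal ((1 / 2) ^ (10 * l))"
proof -
  have "((8 / 9 :: real)) ^ (60 * l) = ((8 / 9) ^ 6) ^ (10 * l)" by (simp flip: power_mult)
  also have "\<dots> \<le> (1 / 2) ^ (10 * l)"
    by (intro power_mono) (simp_all add: power_divide)
  finally show ?thesis unfolding \<delta>_def by (rule ennreal_leI)
qed

text \<open>A round fails if its multiplier is bad, with probability at most \<open>1 / 4\<close>,
  or if the vote on the isolating piece errs, with probability at most
  \<open>\<delta> <= 1 / 4\<close>; so every round halves the potential.\<close>

lemma rounds_yes:
  assumes I: "Inv (Y + XR) s"
    and xyz: "{x, y} \<in> edges G" "{y, z} \<in> edges G" "{x, z} \<in> edges G"
    and few: "3 * card (triangles G) \<le> q"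
  shows "wp w (rounds A) (Inv Y) s \<and>
    wex w (rounds A) (\<lambda>s'. of_bool (vr s' 5 = 0)) s \<le> (if vr s 5 = 0 then ennreal ((1 / 2) ^ (2 * l)) else 0)"
proof -
  obtain Bad where Bad: "finite Bad" "card Bad \<le> 3 * card (triangles G) * (2 * L)"
    "\<And>a. a < p \<Longrightarrow> odd a \<Longrightarrow> a \<notin> Bad \<Longrightarrow>
      (let b = block p L a in b x \<noteq> b y \<and> b y \<noteq> b z \<and> b x \<noteq> b z \<and>
        (\<forall>t\<in>triangles G. b ` t \<subseteq> b ` {x, y, z} \<longrightarrow> t = {x, y, z}))"
    using isolating_multipliers[OF G(1,2) n_le_p[unfolded p_pow] L_bounds(2) xyz] unfolding p_pow by blast
  let ?U = "pmf_of_set {..<2 ^ (2 * l - 1) :: nat}"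
  \<comment> \<open>Among the \<open>p div 2\<close> odd multipliers at most
    \<open>q * (2 * L) = p div 8\<close> are bad.\<close>
  have bad: "emeasure ?U {x. 2 * x + 1 \<in> Bad} \<le> ennreal (1 / 4)"
  proof -
    let ?B = "{..<2 ^ (2 * l - 1)} \<inter> {x. 2 * x + 1 \<in> Bad}"
    have "card ?B \<le> card Bad"
      by (rule card_inj_on_le[where f = "\<lambda>x. 2 * x + 1"]) (auto simp: inj_on_def Bad(1))
    also have "\<dots> \<le> q * (2 * L)"
      by (rule le_trans[OF Bad(2)]) (rule mult_right_mono[OF few], simp)
    finally have "4 * card ?B \<le> 4 * (q * (2 * L))" by simp
    also have "\<dots> = q * (16 * L) div 2" by simp
    also have "\<dots> = 2 ^ (2 * l - 1)" unfolding L_bounds(1) half_p ..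
    finally have "real (4 * card ?B) \<le> real (2 ^ (2 * l - 1))" by (rule of_nat_mono)
    then have "measure_pmf.prob ?U {x. 2 * x + 1 \<in> Bad} \<le> 1 / 4"
      by (simp add: measure_pmf_of_set lessThan_empty_iff field_simps)
    then show ?thesis unfolding measure_pmf.emeasure_eq_measure by (rule ennreal_leI)
  qed
  define F :: "nat \<Rightarrow> nat \<Rightarrow> ennreal" where "F r u = (if u = 0 then ennreal ((1 / 2) ^ r) else 0)" for r u
  have main: "wp w (rounds A) (Inv Y) s \<and> wex w (rounds A) (\<lambda>s'. F 0 (vr s' 5)) s \<le> F (2 * l) (vr s 5)"
  proof (rule rounds_rule[OF I])
    fix r s' Y' assume I: "Inv (Y' + (XI + 1)) s'"
    then have "Inv (Suc (Y' + XI)) s'" by simp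
    note ch = wp_choose[OF this]
    have core: "core s'" using I by (simp add: Inv_def)
    define h :: "nat \<Rightarrow> ennreal" where "h a = (if vr s' 5 = 0 then (indicator Bad a + \<delta>) * ennreal ((1 / 2) ^ r) else 0)" for a
    have "wex w (choose_mult ;; all_pieces A) (\<lambda>s'. F r (vr s' 5)) s' \<le> wex w choose_mult (\<lambda>s1. h (vr s1 9)) s'"
      unfolding wex_simps(3)[of w choose_mult]
    proof (rule wex_mono, rule wp_mono[OF ch])
      fix s1 assume h: "Inv (Y' + XI) s1 \<and> odd (vr s1 9) \<and> vr s1 9 < p \<and> vr s1 5 = vr s' 5"
      then have i: "Inv (Y' + XI) s1" "odd (vr s1 9)" "vr s1 9 < p" "vr s1 5 = vr s' 5" by auto
      show "wex w (all_pieces A) (\<lambda>s'. F r (vr s' 5)) s1 \<le> h (vr s1 9)"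
      proof (cases "vr s1 9 \<in> Bad")
        case True
        have "wex w (all_pieces A) (\<lambda>s'. F r (vr s' 5)) s1 \<le> F r (vr s1 5)"
          unfolding F_def by (rule pieces_any(2)[OF i(1-3)])
        also have "\<dots> \<le> h (vr s1 9)"
        proof -
          have "1 * ennreal ((1 / 2) ^ r) \<le> (1 + \<delta>) * ennreal ((1 / 2) ^ r)" by (rule mult_right_mono) simp_all
          then show ?thesis using True i(4) by (simp add: F_def h_def)
        qed
        finally show ?thesis .
      next
        case False
        have "wex w (all_pieces A) (\<lambda>s'. F r (vr s' 5)) s1 = wex w (all_pieces A) (\<lambda>s'. ennreal ((1 / 2) ^ r) * of_bool (vr s' 5 = 0)) s1"
          unfolding wex_def by (rule nn_integral_cong) (simp add: F_def)
        also have "\<dots> = ennreal ((1 / 2) ^ r) * wex w (all_pieces A) (\<lambda>s'. of_bool (vr s' 5 = 0)) s1"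
          by (simp add: wex_def nn_integral_cmult)
        also have "\<dots> \<le> ennreal ((1 / 2) ^ r) * (if vr s1 5 = 0 then \<delta> else 0)"
          by (intro mult_left_mono pieces_isolated[OF i(1-3) xyz Bad(3)[OF i(3,2) False]]) simp
        also have "\<dots> \<le> h (vr s1 9)" using False i(4) by (simp add: h_def mult.commute)
        finally show ?thesis .
      qed
    qed
    also have "\<dots> = (\<integral>\<^sup>+x. h (2 * x + 1) \<partial>measure_pmf ?U)" by (rule wex_choose[OF core])
    also have "\<dots> \<le> F (Suc r) (vr s' 5)"
    proof (cases "vr s' 5 = 0")
      case True
      have "(\<integral>\<^sup>+x. h (2 * x + 1) \<partial>measure_pmf ?U) =
         (\<integral>\<^sup>+x. (indicator {x. 2 * x + 1 \<in> Bad} x + \<delta>) * ennreal ((1 / 2) ^ r) \<partial>measure_pmf ?U)"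
        by (rule nn_integral_cong) (simp add: h_def True indicator_def)
      also have "\<dots> = (emeasure ?U {x. 2 * x + 1 \<in> Bad} + \<delta>) * ennreal ((1 / 2) ^ r)"
        by (simp add: nn_integral_multc nn_integral_add measure_pmf.emeasure_space_1)
      also have "\<dots> \<le> (ennreal (1 / 4) + ennreal (1 / 4)) * ennreal ((1 / 2) ^ r)"
      proof (intro mult_right_mono add_mono bad)
        have "(1 / 2 :: real) ^ (10 * l) \<le> (1 / 2) ^ 2" using q(4) by (intro power_decreasing) auto
        also have "\<dots> = 1 / 4" by (simp add: power2_eq_square)
        finally show "\<delta> \<le> ennreal (1 / 4)" using delta_le ennreal_leI order_trans by blast
      qed simp
      also have "\<dots> = F (Suc r) (vr s' 5)"
      proof -
        have "ennreal (1 / 4) + ennreal (1 / 4) = ennreal (1 / 2)"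
          by (subst ennreal_plus[symmetric]) simp_all
        moreover have "ennreal (1 / 2) * ennreal ((1 / 2) ^ r) = ennreal (1 / 2 * (1 / 2) ^ r)"
          by (rule ennreal_mult[symmetric]) simp_all
        ultimately show ?thesis using True by (simp only: F_def if_True power_Suc simp_thms)
      qed
      finally show ?thesis .
    qed (simp add: h_def)
    finally have "wex w (choose_mult ;; all_pieces A) (\<lambda>s'. F r (vr s' 5)) s' \<le> F (Suc r) (vr s' 5)" .
    with wp_round[OF I] show "wp w (choose_mult ;; all_pieces A) (Inv Y') s' \<and>
      wex w (choose_mult ;; all_pieces A) (\<lambda>s'. F r (vr s' 5)) s' \<le> F (Suc r) (vr s' 5)" ..
  qed
  have fe: "(\<lambda>s'. F 0 (vr s' 5)) = (\<lambda>s'. of_bool (vr s' 5 = 0))" by (auto simp: F_def)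
  show ?thesis using main[unfolded fe] unfolding F_def .
qed

section \<open>Sampling\<close>

definition hit :: "nat \<Rightarrow> bool" where
  "hit v \<longleftrightarrow> (let x = v mod p; y = v div p mod p; z = v div p div p mod p in
     {x, y} \<in> edges G \<and> {y, z} \<in> edges G \<and> {x, z} \<in> edges G)"

text \<open>Only three base-\<open>p\<close> digits matter, so the word may be reduced modulo
  \<open>p ^ 3\<close>, a power of two, where it is exactly uniform.\<close>

lemma hit_mod: "hit (v mod (p * (p * p))) = hit v"
proof -
  have p0: "0 < p" unfolding p_pow by simp
  have 1: "v mod (p * (p * p)) = p * (v div p mod (p * p)) + v mod p" by (rule mod_mult2_eq)
  have 2: "v div p mod (p * p) = p * (v div p div p mod p) + v div p mod p" by (rule mod_mult2_eq)
  have a: "v mod (p * (p * p)) mod p = v mod p" unfolding 1 by simp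
  have b: "v mod (p * (p * p)) div p = v div p mod (p * p)" unfolding 1 using p0 by simp
  have c: "v div p mod (p * p) mod p = v div p mod p" unfolding 2 by simp
  have d: "v div p mod (p * p) div p = v div p div p mod p" unfolding 2 using p0 by simp
  show ?thesis unfolding hit_def a b c d by simp
qed

text \<open>One ordering per triangle is enough: sending a hit to its vertex set is onto
  \<open>triangles G\<close>.\<close>

lemma card_hit: "card (triangles G) \<le> card {v. v < p * (p * p) \<and> hit v}"
proof (rule surj_card_le)
  show "triangles G \<subseteq> (\<lambda>v. {v mod p, v div p mod p, v div p div p mod p}) ` {v. v < p * (p * p) \<and> hit v}"
  proof
    fix t assume "t \<in> triangles G"
    then obtain x y z where t: "t = {x, y, z}" and e: "{x, y} \<in> edges G" "{y, z} \<in> edges G" "{x, z} \<in> edges G"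
      unfolding triangles_def by blast
    then have less: "x < p" "y < p" "z < p" using edge_in_verts[OF G(1)] G(2) n_le_p by force+
    define v where "v = x + p * (y + p * z)"
    have 1: "v mod p = x" "v div p = y + p * z" using less q_ge by (simp_all add: v_def div_mult_self2)
    have 2: "(y + p * z) mod p = y" "(y + p * z) div p = z" "z mod p = z" using less q_ge by (simp_all add: div_mult_self2)
    have "y + p * z < p * p"
    proof -
      have "Suc z * p \<le> p * p" using less by (intro mult_right_mono) auto
      then show ?thesis using less by (simp add: mult.commute)
    qed
    then have "Suc (y + p * z) * p \<le> p * p * p" by (intro mult_right_mono) auto
    then have "v < p * (p * p)" using less by (simp add: v_def algebra_simps)
    moreover have "hit v" unfolding hit_def Let_def 1 2 using e by simp
    ultimately show "t \<in> (\<lambda>v. {v mod p, v div p mod p, v div p div p mod p}) ` {v. v < p * (p * p) \<and> hit v}"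
      unfolding t by (intro image_eqI[of _ _ v]) (simp_all only: 1 2 mem_Collect_eq simp_thms)
  qed
qed simp

lemma prob_hit:
  assumes "q \<le> 3 * card (triangles G)"
  shows "measure_pmf.prob (pmf_of_set {..<2 ^ w}) {v. \<not> hit v} \<le> 1 - 1 / (3 * real q ^ 5)"
proof -
  let ?U = "pmf_of_set {..<2 ^ w :: nat}"
  have p3: "p * (p * p) = 2 ^ (6 * l)" unfolding p_pow by (simp flip: power_add)
  have "measure_pmf.prob ?U {v. hit v} = measure_pmf.prob (map_pmf (\<lambda>v. v mod (p * (p * p))) ?U) {v. hit v}"
    by (simp add: vimage_def hit_mod)
  also have "\<dots> = real (card {v. v < p * (p * p) \<and> hit v}) / real (p * (p * p))"
    unfolding p3 map_mod_pmf_of_set[OF w(2)]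
    by (simp add: measure_pmf_of_set lessThan_empty_iff Int_def)
  also have "\<dots> \<ge> real (card (triangles G)) / real (p * (p * p))"
    by (intro divide_right_mono of_nat_mono card_hit) simp
  finally have 1: "real (card (triangles G)) / real (p * (p * p)) \<le> measure_pmf.prob ?U {v. hit v}" .
  have q0: "real q > 0" using q_ge by simp
  have "real q / 3 \<le> real (card (triangles G))" using assms by simp
  then have "real q / 3 / real (p * (p * p)) \<le> real (card (triangles G)) / real (p * (p * p))"
    by (intro divide_right_mono) auto
  moreover have "real q / 3 / real (p * (p * p)) = 1 / (3 * real q ^ 5)"
    using q0 by (simp add: field_simps power_numeral_reduce)
  ultimately have "1 / (3 * real q ^ 5) \<le> measure_pmf.prob ?U {v. hit v}" using 1 by simp
  moreover have "measure_pmf.prob ?U {v. \<not> hit v} = 1 - measure_pmf.prob ?U {v. hit v}"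
    using measure_pmf.prob_compl[of "{v. hit v}" ?U] by (simp add: Compl_eq_Diff_UNIV[symmetric] Collect_neg_eq)
  ultimately show ?thesis by simp
qed

lemma rate_nonneg: "0 \<le> 1 - 1 / (3 * real q ^ 5)"
proof -
  have "1 \<le> real q ^ 5" using q_ge by simp
  then have "1 \<le> 3 * real q ^ 5" by simp
  then have "1 / (3 * real q ^ 5) \<le> 1" by (subst divide_le_eq_1_pos) (use q_ge in auto)
  then show ?thesis by simp
qed

abbreviation sample_body :: com where
  "sample_body \<equiv> Rnd 17 ;;
     (let x = Vr 17 \<odot> ep; y = Vr 17 \<oslash> ep \<odot> ep; z = Vr 17 \<oslash> ep \<oslash> ep \<odot> ep in
      Ite ((x \<prec> Vr 0) \<otimes> (y \<prec> Vr 0) \<otimes> (z \<prec> Vr 0) \<otimes> Ld (x \<otimes> Vr 0 \<oplus> y) \<otimes> Ld (y \<otimes> Vr 0 \<oplus> z) \<otimes> Ld (x \<otimes> Vr 0 \<oplus> z))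
       (Asg 5 (Nm 1)) Skip)"

lemma sample_cond:
  assumes "core s" "vr s 17 = v"
  defines "x \<equiv> Vr 17 \<odot> ep" and "y \<equiv> Vr 17 \<oslash> ep \<odot> ep" and "z \<equiv> Vr 17 \<oslash> ep \<oslash> ep \<odot> ep"
  shows "aval w ((x \<prec> Vr 0) \<otimes> (y \<prec> Vr 0) \<otimes> (z \<prec> Vr 0) \<otimes> Ld (x \<otimes> Vr 0 \<oplus> y) \<otimes> Ld (y \<otimes> Vr 0 \<oplus> z) \<otimes> Ld (x \<otimes> Vr 0 \<oplus> z)) s
    = of_bool (hit v)"
proof -
  define x' y' z' where "x' = v mod p" and "y' = v div p mod p" and "z' = v div p div p mod p"
  have av: "aval w x s = x'" "aval w y s = y'" "aval w z s = z'"
    using assms(2) by (simp_all add: x_def y_def z_def aval_consts(2)[OF assms(1)] x'_def y'_def z'_def)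
  have p0: "0 < p" unfolding p_pow by simp
  have less: "x' < p" "y' < p" "z' < p" using p0 by (simp_all add: x'_def y'_def z'_def)
  have s0: "vr s 0 = n" using assms(1) by (simp add: core_def)
  have w1: "take_bit w (Suc 0) = Suc 0" using small[of 1] by simp
  have b: "take_bit w (a * n + b) = a * n + b" if "a < p" "b < p" for a b
    using flat_less[OF that n_le_p] p_less(2) by (simp add: take_bit_word)
  have b': "take_bit w (a * n) = a * n" if "a < p" for a using b[OF that p0] by simp
  have ld: "mm s (a * n + b) = of_bool ({a, b} \<in> edges G)" if "a < n" "b < n" for a b
  proof -
    have "Suc a * n \<le> n * n" using that by (intro mult_right_mono) auto
    then have "a * n + b < n * n" using that by simp
    then show ?thesis using assms(1) that by (simp add: core_def inp_def)
  qed
  have hit: "hit v \<longleftrightarrow> {x', y'} \<in> edges G \<and> {y', z'} \<in> edges G \<and> {x', z'} \<in> edges G"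
    by (simp add: hit_def Let_def x'_def y'_def z'_def)
  show ?thesis
  proof (cases "x' < n \<and> y' < n \<and> z' < n")
    case True
    then show ?thesis unfolding hit
      by (simp add: av s0 b b' less ld w1 flip: of_bool_conj) (use w' in \<open>simp add: w1\<close>)
  next
    case False
    have "\<not> hit v" using False hit edge_in_verts[OF G(1)] G(2) by auto
    then show ?thesis using False by (auto simp: av s0 w1)
  qed
qed

lemma core_asg: "core s \<Longrightarrow> x \<in> {5, 14, 17} \<Longrightarrow> core (asg x v s)" "core s \<Longrightarrow> core (tick k s)"
  by (auto simp: core_def)

lemma sample_count:
  assumes "core s"
  shows "aval w (Nm 6 \<otimes> Vr 2 \<otimes> Vr 3 \<otimes> Vr 3 \<otimes> Vr 3 \<otimes> Vr 3 \<otimes> Vr 3) s = 6 * l * q ^ 5"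
proof -
  have lq: "l \<le> q" unfolding q(1) by simp
  have le: "6 * l * q ^ j < 2 ^ w" if "j \<le> 5" for j
  proof -
    have "6 * l * q ^ j \<le> 6 * q * q ^ j" using lq by (intro mult_right_mono) auto
    also have "\<dots> = 6 * q ^ Suc j" by simp
    also have "\<dots> < 2 ^ w" using that by (intro qpow_less) auto
    finally show ?thesis .
  qed
  show ?thesis
    using assms small[of 6] le[of 0] le[of 1] le[of 2] le[of 3] le[of 4] le[of 5]
    by (simp add: core_def take_bit_word power_numeral_reduce mult.assoc)
qed

lemma sample_spec:
  assumes c: "core s" and s5: "vr s 5 \<le> 1"
  shows "wp w sample (\<lambda>s'. (\<forall>x. x \<notin> {5, 14, 17} \<longrightarrow> vr s' x = vr s x) \<and> mm s' = mm s \<and> vr s' 5 \<le> 1 \<and>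
      (vr s' 5 \<noteq> 0 \<longrightarrow> vr s 5 \<noteq> 0 \<or> has_triangle G)) s"
    and "q \<le> 3 * card (triangles G) \<Longrightarrow>
      wex w sample (\<lambda>s'. if vr s' 5 = 0 then 1 else 0) s \<le> ennreal ((1 - 1 / (3 * real q ^ 5)) ^ (6 * l * q ^ 5))"
proof -
  let ?Q = "\<lambda>s' :: st. (\<forall>x. x \<notin> {5, 14, 17} \<longrightarrow> vr s' x = vr s x) \<and> mm s' = mm s \<and> vr s' 5 \<le> 1 \<and>
      (vr s' 5 \<noteq> 0 \<longrightarrow> vr s 5 \<noteq> 0 \<or> has_triangle G)"
  let ?e = "let x = Vr 17 \<odot> ep; y = Vr 17 \<oslash> ep \<odot> ep; z = Vr 17 \<oslash> ep \<oslash> ep \<odot> ep in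
    (x \<prec> Vr 0) \<otimes> (y \<prec> Vr 0) \<otimes> (z \<prec> Vr 0) \<otimes> Ld (x \<otimes> Vr 0 \<oplus> y) \<otimes> Ld (y \<otimes> Vr 0 \<oplus> z) \<otimes> Ld (x \<otimes> Vr 0 \<oplus> z)"
  have body: "sample_body = Rnd 17 ;; Ite ?e (Asg 5 (Nm 1)) Skip" by (simp add: Let_def)
  have w1: "take_bit w 1 = (1::nat)" by (rule small) simp
  have cond: "aval w ?e (tick 1 (asg 17 v s')) = of_bool (hit v)" if "core s'" for v s'
    unfolding Let_def by (rule sample_cond) (use that core_asg in auto)
  have hitG: "hit v \<Longrightarrow> has_triangle G" for v unfolding hit_def has_triangle_iff Let_def by blast
  have coreQ: "core s'" if "?Q s'" for s' using that c by (auto simp: core_def)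
  have wpb: "wp w sample_body (\<lambda>s'. ?Q (tick 2 s')) (tick 3 (asg 14 k s'))" if Q: "?Q s'" for k s'
  proof -
    have "core (tick 3 (asg 14 k s'))" using coreQ[OF Q] by (auto simp: core_def)
    note cd = cond[OF this]
    show ?thesis
      unfolding body wp_simps wp_Rnd cd using Q w1 hitG by auto
  qed
  have samp: "sample = For 14 (Nm 6 \<otimes> Vr 2 \<otimes> Vr 3 \<otimes> Vr 3 \<otimes> Vr 3 \<otimes> Vr 3 \<otimes> Vr 3) sample_body"
    by (simp add: sample_def)
  show "wp w sample ?Q s"
    unfolding samp by (rule wp_For[where I = "\<lambda>_. ?Q"]) (use wpb s5 in auto)
  assume many: "q \<le> 3 * card (triangles G)"
  define r where "r = 1 - 1 / (3 * real q ^ 5)"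
  have r0: "0 \<le> r" unfolding r_def by (rule rate_nonneg)
  define f :: "nat \<Rightarrow> st \<Rightarrow> ennreal" where "f k s' = (if vr s' 5 = 0 then ennreal (r ^ k) else 0)" for k s'
  let ?cnt = "Nm 6 \<otimes> Vr 2 \<otimes> Vr 3 \<otimes> Vr 3 \<otimes> Vr 3 \<otimes> Vr 3 \<otimes> Vr 3"
  have "wp w sample (\<lambda>_. True) s \<and> wex w sample (\<lambda>s'. if vr s' 5 = 0 then 1 else 0) s \<le> f (aval w ?cnt s) (tick (elen ?cnt + 1) s)"
    unfolding samp
  proof (rule For_rule[where I = "\<lambda>_. ?Q" and f = f])
    fix k s' assume Q: "?Q s'"
    let ?s = "tick 3 (asg 14 k s')"
    have "core ?s" using coreQ[OF Q] by (auto simp: core_def)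
    note cd = cond[OF this]
    have "wex w sample_body (\<lambda>s'. f k (tick 2 s')) ?s =
      (\<integral>\<^sup>+v. (if vr s' 5 = 0 then ennreal (r ^ k) * indicator {v. \<not> hit v} v else 0) \<partial>measure_pmf (pmf_of_set {..<2 ^ w}))"
      unfolding body wex_simps wex_Rnd cd
      by (rule nn_integral_cong) (auto simp: f_def w1[simplified] indicator_def)
    also have "\<dots> \<le> f (Suc k) s'"
    proof (cases "vr s' 5 = 0")
      case True
      have "(\<integral>\<^sup>+v. ennreal (r ^ k) * indicator {v. \<not> hit v} v \<partial>measure_pmf (pmf_of_set {..<2 ^ w}))
          = ennreal (r ^ k) * ennreal (measure_pmf.prob (pmf_of_set {..<2 ^ w}) {v. \<not> hit v})"
        by (simp add: nn_integral_cmult measure_pmf.emeasure_eq_measure)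
      also have "\<dots> \<le> ennreal (r ^ k) * ennreal r"
        by (intro mult_left_mono ennreal_leI) (use prob_hit[OF many] in \<open>simp_all add: r_def\<close>)
      also have "\<dots> = ennreal (r ^ Suc k)" using r0 by (simp add: ennreal_mult mult.commute)
      finally show ?thesis using True by (simp add: f_def)
    qed (simp add: f_def)
    finally show "wp w sample_body (\<lambda>s'. ?Q (tick 2 s')) ?s \<and> wex w sample_body (\<lambda>s'. f k (tick 2 s')) ?s \<le> f (Suc k) s'"
      using wpb[OF Q] by blast
  qed (use s5 in \<open>auto simp: f_def\<close>)
  then have "wex w sample (\<lambda>s'. if vr s' 5 = 0 then 1 else 0) s \<le> f (6 * l * q ^ 5) (tick (elen ?cnt + 1) s)"
    unfolding sample_count[OF c] by blast
  also have "\<dots> \<le> ennreal (r ^ (6 * l * q ^ 5))" by (simp add: f_def)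
  finally show "wex w sample (\<lambda>s'. if vr s' 5 = 0 then 1 else 0) s \<le> ennreal ((1 - 1 / (3 * real q ^ 5)) ^ (6 * l * q ^ 5))"
    by (simp add: r_def)
qed

lemma sample_error: "(1 - 1 / (3 * real q ^ 5)) ^ (6 * l * q ^ 5) \<le> (1 / 2) ^ (2 * l)"
proof -
  define b where "b = 1 / (3 * real q ^ 5)"
  have q0: "real q > 0" using q_ge by simp
  have b1: "0 \<le> 1 - b" unfolding b_def by (rule rate_nonneg)
  have "(1 - b) ^ (6 * l * q ^ 5) \<le> exp (- b) ^ (6 * l * q ^ 5)"
    using exp_ge_add_one_self[of "- b"] b1 by (intro power_mono) auto
  also have "\<dots> = exp (- 1) ^ (2 * l)"
    using q0 by (simp add: b_def flip: exp_of_nat_mult)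
  also have "\<dots> \<le> (1 / 2) ^ (2 * l)"
  proof (rule power_mono)
    have "2 \<le> exp (1::real)" using exp_ge_add_one_self[of 1] by simp
    then show "exp (- 1) \<le> (1 / 2 :: real)" by (simp add: exp_minus field_simps)
  qed simp
  finally show ?thesis by (simp add: b_def)
qed

text \<open>Used when the triangles are many: the rounds need not find anything, they only must not
  lose what sampling found.\<close>

lemma rounds_any:
  assumes I: "Inv (Y + XR) s"
  shows "wp w (rounds A) (Inv Y) s"
    and "wex w (rounds A) (\<lambda>s'. of_bool (vr s' 5 = 0)) s \<le> (if vr s 5 = 0 then 1 else 0)"
proof -
  define F :: "nat \<Rightarrow> nat \<Rightarrow> ennreal" where "F r u = of_bool (u = 0)" for r u
  have main: "wp w (rounds A) (Inv Y) s \<and> wex w (rounds A) (\<lambda>s'. F 0 (vr s' 5)) s \<le> F (2 * l) (vr s 5)"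
  proof (rule rounds_rule[OF I])
    fix r s' Y' assume I: "Inv (Y' + (XI + 1)) s'"
    then have "Inv (Suc (Y' + XI)) s'" by simp
    note ch = wp_choose[OF this]
    have "wex w (choose_mult ;; all_pieces A) (\<lambda>s'. F r (vr s' 5)) s' \<le> F (Suc r) (vr s' 5)"
      unfolding wex_simps(3)[of w choose_mult]
    proof (rule wex_le, rule wp_mono[OF ch])
      fix s1 assume "Inv (Y' + XI) s1 \<and> odd (vr s1 9) \<and> vr s1 9 < p \<and> vr s1 5 = vr s' 5"
      then have i: "Inv (Y' + XI) s1" "odd (vr s1 9)" "vr s1 9 < p" "vr s1 5 = vr s' 5" by auto
      have "F r u = (if u = 0 then 1 else 0)" for u by (simp add: F_def)
      then show "wex w (all_pieces A) (\<lambda>s'. F r (vr s' 5)) s1 \<le> F (Suc r) (vr s' 5)"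
        using pieces_any(2)[OF i(1-3), of 1] i(4) by (simp add: F_def)
    qed
    with wp_round[OF I] show "wp w (choose_mult ;; all_pieces A) (Inv Y') s' \<and>
      wex w (choose_mult ;; all_pieces A) (\<lambda>s'. F r (vr s' 5)) s' \<le> F (Suc r) (vr s' 5)" ..
  qed
  then show "wp w (rounds A) (Inv Y) s"
    "wex w (rounds A) (\<lambda>s'. of_bool (vr s' 5 = 0)) s \<le> (if vr s 5 = 0 then 1 else 0)"
    by (simp_all add: F_def of_bool_def)
qed

lemma error_no: "of_nat (2 * l * (g * g * g)) * \<delta> \<le> ennreal ((1 / 2) ^ (2 * l))"
proof -
  have "l \<le> 2 ^ l" by simp
  then have "2 * l * (g * g * g) \<le> 2 * 2 ^ l * (g * g * g)" by (intro mult_right_mono) auto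
  also have "\<dots> = 2 ^ (13 + 4 * l)" 
  proof -
    have "(2::nat) ^ (13 + 4 * l) = 2 ^ 13 * (2 ^ l) ^ 4"
      by (simp only: power_add power_mult[symmetric] mult.commute[of l])
    moreover have "2 * x * (16 * x * (16 * x) * (16 * x)) = 2 ^ 13 * x ^ 4" for x :: nat
      by (simp add: power4_eq_xxxx)
    ultimately show ?thesis unfolding q(1) by (simp only:)
  qed
  \<comment> \<open>\<open>13 + 4 * l <= 8 * l\<close> is where \<open>4 <= l\<close> is
    needed.\<close>
  also have "\<dots> \<le> 2 ^ (8 * l)" using q(4) by (intro power_increasing) auto
  finally have "real (2 * l * (g * g * g)) \<le> real (2 ^ (8 * l))" by (rule of_nat_mono)
  then have le: "real (2 * l * (g * g * g)) * (1 / 2) ^ (10 * l) \<le> 2 ^ (8 * l) * (1 / 2) ^ (10 * l)"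
    by (intro mult_right_mono) simp_all
  have "(2::real) ^ (8 * l) * (1 / 2) ^ (10 * l) = (1 / 2) ^ (2 * l)"
  proof -
    have "10 * l = 8 * l + 2 * l" by simp
    then have "(1 / 2 :: real) ^ (10 * l) = (1 / 2) ^ (8 * l) * (1 / 2) ^ (2 * l)" by (simp only: power_add)
    then show ?thesis by (simp add: power_one_over)
  qed
  with le have "real (2 * l * (g * g * g)) * (1 / 2) ^ (10 * l) \<le> (1 / 2) ^ (2 * l)" by simp
  then have "ennreal (real (2 * l * (g * g * g))) * ennreal ((1 / 2) ^ (10 * l)) \<le> ennreal ((1 / 2) ^ (2 * l))"
    by (subst ennreal_mult[symmetric]) (simp_all add: ennreal_leI)
  moreover have "of_nat (2 * l * (g * g * g)) * \<delta> \<le> of_nat (2 * l * (g * g * g)) * ennreal ((1 / 2) ^ (10 * l))"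
    by (rule mult_left_mono[OF delta_le]) simp
  ultimately show ?thesis by (simp only: ennreal_of_nat_eq_real_of_nat)
qed

text \<open>If \<open>3 * card (triangles G) <= q\<close>, the rounds are reliable on their own,
  including the triangle-free case; otherwise sampling is. Both phases are tuned to the same
  threshold \<open>q\<close>, so no graph falls between them.\<close>

lemma main_part:
  assumes c: "core s" and v: "vr s 5 = 0" "vr s 7 = 0" "vr s 6 = n * n" and mem: "\<And>x. n * n \<le> x \<Longrightarrow> mm s x = 0"
    and space: "n * n + (XR + 1) * S \<le> 2 ^ w"
    and time: "tm s + (6 * l * q ^ 5 + 1) * clen sample + XR * E + (TT + 1) * D \<le> Tot"
  shows "wp w (sample ;; rounds A ;; Asg 0 (Vr 5)) (\<lambda>s'. tm s' \<le> Tot + 2) s"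
    and "wex w (sample ;; rounds A ;; Asg 0 (Vr 5)) (\<lambda>s'. of_bool ((vr s' 0 \<noteq> 0) \<noteq> has_triangle G)) s
      \<le> ennreal ((1 / 2) ^ (2 * l))"
proof -
  have s5: "vr s 5 \<le> 1" using v by simp
  have tmS: "wp w sample (\<lambda>s'. tm s' \<le> tm s + (6 * l * q ^ 5 + 1) * clen sample) s"
    unfolding sample_def
  proof (rule wp_mono[OF For_tm'], goal_cases)
    case (2 s')
    then show ?case unfolding sample_count[OF c] .
  qed (simp add: Let_def)
  let ?R = "\<lambda>s1 :: st. Inv (0 + XR) s1 \<and> (vr s1 5 \<noteq> 0 \<longrightarrow> has_triangle G)"
  have smp: "wp w sample ?R s"
  proof (rule wp_mono[OF wp_conj[OF sample_spec(1)[OF c s5] tmS]])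
    fix s1 :: st assume h: "((\<forall>x. x \<notin> {5, 14, 17} \<longrightarrow> vr s1 x = vr s x) \<and> mm s1 = mm s \<and> vr s1 5 \<le> 1 \<and>
      (vr s1 5 \<noteq> 0 \<longrightarrow> vr s 5 \<noteq> 0 \<or> has_triangle G)) \<and> tm s1 \<le> tm s + (6 * l * q ^ 5 + 1) * clen sample"
    then have "core s1" using c by (auto simp: core_def)
    moreover have "vr s1 6 = n * n" "vr s1 7 = 0" using h v by auto
    moreover have "tm s1 + XR * E + (TT + 1) * D \<le> Tot" using h time by linarith
    ultimately have "Inv (0 + XR) s1"
      unfolding Inv_def using h mem space by simp
    then show "?R s1" using h v by blast
  qed
  show "wp w (sample ;; rounds A ;; Asg 0 (Vr 5)) (\<lambda>s'. tm s' \<le> Tot + 2) s"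
    unfolding wp_simps(4) wp_simps(2)
  proof (rule wp_mono[OF smp])
    fix s1 assume "?R s1"
    then have I: "Inv (0 + XR) s1" by blast
    show "wp w (rounds A) (\<lambda>s'. tm (tick (elen (Vr 5) + 1) (asg 0 (aval w (Vr 5) s') s')) \<le> Tot + 2) s1"
      by (rule wp_mono[OF rounds_any(1)[OF I]]) (simp add: Inv_def)
  qed
  have "wex w sample (wex w (rounds A) (\<lambda>s'. of_bool ((vr s' 5 \<noteq> 0) \<noteq> has_triangle G))) s \<le> ennreal ((1 / 2) ^ (2 * l))"
  proof (cases "has_triangle G")
    case False
    show ?thesis
    proof (rule wex_le, rule wp_mono[OF smp])
      fix s1 assume R: "?R s1"
      then have I: "Inv (0 + XR) s1" and "vr s1 5 = 0" using False by blast+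
      from rounds_no[OF I False this(2)]
      have "wex w (rounds A) (\<lambda>s'. of_bool (vr s' 5 \<noteq> 0)) s1 \<le> of_nat (2 * l * (g * g * g)) * \<delta>" ..
      also note error_no
      finally show "wex w (rounds A) (\<lambda>s'. of_bool ((vr s' 5 \<noteq> 0) \<noteq> has_triangle G)) s1 \<le> ennreal ((1 / 2) ^ (2 * l))"
        using False by simp
    qed
  next
    case True
    then have e: "(\<lambda>s'. of_bool ((vr s' 5 \<noteq> 0) \<noteq> has_triangle G)) = (\<lambda>s'. of_bool (vr s' 5 = 0) :: ennreal)"
      by auto
    obtain x y z where xyz: "{x, y} \<in> edges G" "{y, z} \<in> edges G" "{x, z} \<in> edges G"
      using True unfolding has_triangle_iff by blast
    show ?thesis
    proof (cases "3 * card (triangles G) \<le> q")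
      case few: True
      show ?thesis
        unfolding e
      proof (rule wex_le, rule wp_mono[OF smp])
        fix s1 assume R: "?R s1"
        then have I: "Inv (0 + XR) s1" by blast
        from rounds_yes[OF I xyz few]
        have "wex w (rounds A) (\<lambda>s'. of_bool (vr s' 5 = 0)) s1 \<le> (if vr s1 5 = 0 then ennreal ((1 / 2) ^ (2 * l)) else 0)" ..
        also have "\<dots> \<le> ennreal ((1 / 2) ^ (2 * l))" by simp
        finally show "wex w (rounds A) (\<lambda>s'. of_bool (vr s' 5 = 0)) s1 \<le> ennreal ((1 / 2) ^ (2 * l))" .
      qed
    next
      case False
      have "wex w sample (wex w (rounds A) (\<lambda>s'. of_bool (vr s' 5 = 0))) s \<le> wex w sample (\<lambda>s'. if vr s' 5 = 0 then 1 else 0) s"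
      proof (rule wex_mono, rule wp_mono[OF smp])
        fix s1 assume R: "?R s1"
        then have I: "Inv (0 + XR) s1" by blast
        show "wex w (rounds A) (\<lambda>s'. of_bool (vr s' 5 = 0)) s1 \<le> (if vr s1 5 = 0 then 1 else 0)"
          by (rule rounds_any(2)[OF I])
      qed
      also have "\<dots> \<le> ennreal ((1 - 1 / (3 * real q ^ 5)) ^ (6 * l * q ^ 5))"
        by (rule sample_spec(2)[OF c s5]) (use False in simp)
      also have "\<dots> \<le> ennreal ((1 / 2) ^ (2 * l))" by (rule ennreal_leI[OF sample_error])
      finally show ?thesis unfolding e .
    qed
  qed
  then show "wex w (sample ;; rounds A ;; Asg 0 (Vr 5)) (\<lambda>s'. of_bool ((vr s' 0 \<noteq> 0) \<noteq> has_triangle G)) s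
      \<le> ennreal ((1 / 2) ^ (2 * l))"
    unfolding wex_simps(3) wex_simps(2) by simp
qed

end

section \<open>Start-up: computing \<open>m\<close> and \<open>l\<close>\<close>

lemma square_root_unique:
  fixes a b :: nat
  assumes "a * a \<le> n" "n < (a + 1) * (a + 1)" "b * b \<le> n" "n < (b + 1) * (b + 1)"
  shows "a = b"
proof (rule linorder_cases[of a b])
  assume "a < b"
  then have "(a + 1) * (a + 1) \<le> b * b" by (intro mult_mono) auto
  then show ?thesis using assms by linarith
next
  assume "b < a"
  then have "(b + 1) * (b + 1) \<le> a * a" by (intro mult_mono) auto
  then show ?thesis using assms by linarith
qed

lemma wp_startup:
  assumes v: "vr s = (\<lambda>_. 0)(0 := n)" and m: "m * m \<le> n" "n < (m + 1) * (m + 1)"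
    and l: "m + 2 \<le> 2 ^ l" "2 ^ l < 2 * (m + 2)" and W: "(n + 2) * (n + 2) < 2 ^ w" "ca < 2 ^ w" "ca * l < w" "0 < n"
  shows "wp w (startup ca) (\<lambda>s'. vr s' 0 = n \<and> vr s' 1 = m \<and> vr s' 2 = l \<and> vr s' 3 = 2 ^ l \<and> vr s' 4 = 2 ^ (ca * l) \<and>
     vr s' 6 = n * n \<and> (\<forall>x. x \<notin> {0, 1, 2, 3, 4, 6, 14} \<longrightarrow> vr s' x = 0) \<and> mm s' = mm s \<and>
     tm s' \<le> tm s + (n + m + 5) * clen (startup ca)) s"
proof -
  have small: "x \<le> (n + 2) * (n + 2) \<Longrightarrow> take_bit w x = x" for x
    using W(1) by (simp add: take_bit_nat_eq_self_iff)
  have w1: "take_bit w (Suc 0) = Suc 0" by (rule small) simp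
  have w2: "take_bit w 2 = (2::nat)" by (rule small) simp
  have l2: "2 ^ l < 2 * m + 4" using l(2) by simp
  have mn: "m \<le> n" using m(1) by (metis le_square order_trans)
  let ?b1 = "Ite (Vr 0 \<prec> (Vr 1 \<oplus> Nm 1) \<otimes> (Vr 1 \<oplus> Nm 1)) Skip (Asg 1 (Vr 1 \<oplus> Nm 1))"
  let ?b2 = "Ite (Bn Shl (Nm 1) (Vr 2) \<prec> Vr 1 \<oplus> Nm 2) (Asg 2 (Vr 2 \<oplus> Nm 1)) Skip"
  \<comment> \<open>The second disjunct covers a search still under way. At \<open>k = 0\<close> it
    says that the candidate has reached \<open>n\<close>, and then its successor squared exceeds
    \<open>n\<close> anyway.\<close>
  let ?I1 = "\<lambda>k s' :: st. (\<forall>x. x \<notin> {1, 14} \<longrightarrow> vr s' x = vr s x) \<and> mm s' = mm s \<and> vr s' 1 * vr s' 1 \<le> n \<and>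
     (n < (vr s' 1 + 1) * (vr s' 1 + 1) \<or> n \<le> vr s' 1 + k)"
  have l1: "wp w (For 14 (Vr 0) ?b1) (\<lambda>s1. (\<forall>x. x \<notin> {1, 14} \<longrightarrow> vr s1 x = vr s x) \<and> mm s1 = mm s \<and> vr s1 1 = m) s"
  proof (rule wp_For[where I = ?I1])
    show "?I1 (aval w (Vr 0) s) (tick (elen (Vr 0) + 1) s)" by (simp add: v)
  next
    fix k s' assume I: "?I1 (Suc k) s'"
    define M where "M = vr s' 1"
    have M: "M * M \<le> n" "n < (M + 1) * (M + 1) \<or> n \<le> M + Suc k" using I by (auto simp: M_def)
    have "M \<le> n" using M(1) by (metis le_square order_trans)
    then have "(M + 1) * (M + 1) \<le> (n + 2) * (n + 2)" by (intro mult_mono) auto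
    moreover have "M + 1 \<le> (n + 2) * (n + 2)"
    proof -
      have "n + 2 \<le> (n + 2) * (n + 2)" by simp
      then show ?thesis using \<open>M \<le> n\<close> by linarith
    qed
    ultimately have t: "take_bit w (Suc M) = Suc M" "take_bit w (Suc M * Suc M) = Suc M * Suc M"
      using small by simp_all
    have s0: "vr s' 0 = n" using I v by simp
    show "wp w ?b1 (\<lambda>s'. ?I1 k (tick 2 s')) (tick 3 (asg 14 k s'))"
    proof (cases "n < (M + 1) * (M + 1)")
      case True
      then show ?thesis using I s0 t w1 M by (simp add: M_def[symmetric, simplified] del: mult_Suc mult_Suc_right)
    next
      case False
      then show ?thesis using I s0 t w1 M by (simp add: M_def[symmetric, simplified] del: mult_Suc mult_Suc_right)
    qed
  next
    fix s' assume I: "?I1 0 s'"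
    have "vr s' 1 = m"
    \<comment> \<open>The search establishes two inequalities about its result, which identify it
      with the given \<open>m\<close>.\<close>
    proof (rule square_root_unique[OF _ _ m])
      show "vr s' 1 * vr s' 1 \<le> n" using I by blast
      show "n < (vr s' 1 + 1) * (vr s' 1 + 1)"
      proof (cases "n < (vr s' 1 + 1) * (vr s' 1 + 1)")
        case False
        then have "n \<le> vr s' 1" using I by auto
        then show ?thesis by (simp add: algebra_simps)
      qed
    qed
    then show "(\<forall>x. x \<notin> {1, 14} \<longrightarrow> vr (tick 1 (asg 14 0 s')) x = vr s x) \<and> mm (tick 1 (asg 14 0 s')) = mm s \<and>
        vr (tick 1 (asg 14 0 s')) 1 = m" using I by auto
  qed
  have t1: "wp w (For 14 (Vr 0) ?b1) (\<lambda>s1. tm s1 \<le> tm s + (n + 1) * clen (For 14 (Vr 0) ?b1)) s"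
  proof (rule wp_mono[OF For_tm'], goal_cases)
    case (2 s')
    then show ?case by (simp add: v)
  qed simp
  have l2: "wp w (For 14 (Vr 1 \<oplus> Nm 2) ?b2) (\<lambda>s2. (\<forall>x. x \<notin> {2, 14} \<longrightarrow> vr s2 x = vr s1 x) \<and> mm s2 = mm s1 \<and> vr s2 2 = l \<and>
      tm s2 \<le> tm s1 + (m + 3) * clen (For 14 (Vr 1 \<oplus> Nm 2) ?b2)) s1"
    if s1: "vr s1 1 = m" "vr s1 2 = 0" for s1
  proof -
    have "m + 2 \<le> (n + 2) * (n + 2)" using mn by simp
    then have m2: "take_bit w (Suc (Suc m)) = Suc (Suc m)" using small[of "m + 2"] by simp
    have len: "aval w (Vr 1 \<oplus> Nm 2) s1 = m + 2" using s1 m2 w2 by simp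
    \<comment> \<open>One conjunct says that the candidate is not too large, the other that it is
      large enough or will be after the remaining turns; \<open>2 ^ M > M\<close> closes the case
      \<open>k = 0\<close>.\<close>
    let ?I2 = "\<lambda>k s' :: st. (\<forall>x. x \<notin> {2, 14} \<longrightarrow> vr s' x = vr s1 x) \<and> mm s' = mm s1 \<and>
      (vr s' 2 = 0 \<or> 2 ^ (vr s' 2 - 1) < m + 2) \<and> (m + 2 \<le> 2 ^ vr s' 2 \<or> m + 2 \<le> vr s' 2 + k)"
    have val: "wp w (For 14 (Vr 1 \<oplus> Nm 2) ?b2) (\<lambda>s2. (\<forall>x. x \<notin> {2, 14} \<longrightarrow> vr s2 x = vr s1 x) \<and> mm s2 = mm s1 \<and> vr s2 2 = l) s1"
    proof (rule wp_For[where I = ?I2])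
      show "?I2 (aval w (Vr 1 \<oplus> Nm 2) s1) (tick (elen (Vr 1 \<oplus> Nm 2) + 1) s1)" unfolding len by (simp add: s1)
    next
      fix k s' assume I: "?I2 (Suc k) s'"
      define M where "M = vr s' 2"
      have M: "M = 0 \<or> 2 ^ (M - 1) < m + 2" "m + 2 \<le> 2 ^ M \<or> m + 2 \<le> M + Suc k" using I by (auto simp: M_def)
      have "2 ^ M \<le> 2 * (m + 2)" using M(1) by (cases M) auto
      also have "\<dots> \<le> (n + 2) * (n + 2)" using mn by (intro mult_mono) auto
      finally have b: "2 ^ M \<le> (n + 2) * (n + 2)" .
      have "M < 2 ^ M" by simp
      then have "Suc M \<le> (n + 2) * (n + 2)" using b by linarith
      then have t: "take_bit w (2 ^ M) = (2::nat) ^ M" "take_bit w (Suc M) = Suc M"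
        using small[OF b] small[of "Suc M"] by blast+
      have sh: "take_bit w (push_bit M (Suc 0)) = (2::nat) ^ M" using t(1) by (simp only: push_bit_eq_mult mult_1 One_nat_def[symmetric])
      have v1: "vr s' (Suc 0) = m" using I s1 by (simp flip: One_nat_def)
      show "wp w ?b2 (\<lambda>s'. ?I2 k (tick 2 s')) (tick 3 (asg 14 k s'))"
      proof (cases "2 ^ M < m + 2")
        case True
        then show ?thesis using I v1 t sh w1 w2 m2 M by (simp add: M_def[symmetric])
      next
        case False
        then show ?thesis using I v1 t sh w1 w2 m2 M by (simp add: M_def[symmetric])
      qed
    next
      fix s' assume I: "?I2 0 s'"
      define M where "M = vr s' 2"
      have M: "M = 0 \<or> 2 ^ (M - 1) < m + 2" "m + 2 \<le> 2 ^ M \<or> m + 2 \<le> M" using I by (auto simp: M_def)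
      have M2: "m + 2 \<le> 2 ^ M" using M(2) less_exp[of M] by linarith
      have "l \<le> M"
      proof (rule ccontr)
        assume "\<not> l \<le> M"
        then have "2 * 2 ^ M \<le> (2 :: nat) ^ l" using power_increasing[of "Suc M" l "2::nat"] by simp
        then show False using M2 l2 by linarith
      qed
      moreover have "M \<le> l"
      proof (rule ccontr)
        assume "\<not> M \<le> l"
        then have "M \<noteq> 0" "l \<le> M - 1" by auto
        then have "2 ^ l \<le> (2 :: nat) ^ (M - 1)" by (intro power_increasing) auto
        then show False using M(1) l(1) \<open>M \<noteq> 0\<close> by linarith
      qed
      ultimately have "vr s' 2 = l" by (simp add: M_def)
      then show "(\<forall>x. x \<notin> {2, 14} \<longrightarrow> vr (tick 1 (asg 14 0 s')) x = vr s1 x) \<and> mm (tick 1 (asg 14 0 s')) = mm s1 \<and>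
        vr (tick 1 (asg 14 0 s')) 2 = l" using I by auto
    qed
    have cost: "wp w (For 14 (Vr 1 \<oplus> Nm 2) ?b2) (\<lambda>s2. tm s2 \<le> tm s1 + (m + 2 + 1) * clen (For 14 (Vr 1 \<oplus> Nm 2) ?b2)) s1"
    proof (rule wp_mono[OF For_tm'], goal_cases)
      case (2 s')
      then show ?case unfolding len .
    qed simp
    have "m + 2 + 1 = m + 3" by simp
    then show ?thesis using wp_conj[OF val cost] by (simp only: conj_assoc)
  qed
  have b: "2 ^ l \<le> (n + 2) * (n + 2)"
  proof -
    have "2 ^ l \<le> 2 * (m + 2)" using l(2) by simp
    also have "\<dots> \<le> (n + 2) * (n + 2)" using mn by (intro mult_mono) auto
    finally show ?thesis .
  qed
  have sh: "take_bit w (push_bit l (Suc 0)) = 2 ^ l" using small[OF b] by (simp only: push_bit_eq_mult mult_1 One_nat_def[symmetric])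
  have "l < 2 ^ l" by simp
  have cal: "ca * l < 2 ^ w" using W(3) less_exp[of w] by linarith
  have tb: "take_bit w (ca * l) = ca * l" using cal by (simp add: take_bit_nat_eq_self_iff)
  have "(2::nat) ^ (ca * l) < 2 ^ w" using W(3) by simp
  then have "take_bit w ((2::nat) ^ (ca * l)) = 2 ^ (ca * l)" by (simp only: take_bit_nat_eq_self_iff)
  then have sh': "take_bit w (push_bit (take_bit w (ca * l)) (Suc 0)) = 2 ^ (ca * l)"
    unfolding tb by (simp only: push_bit_eq_mult mult_1 One_nat_def[symmetric])
  have ca: "take_bit w ca = ca" using W(2) by (simp add: take_bit_nat_eq_self_iff)
  have nn: "take_bit w (n * n) = n * n" by (rule small) simp
  show ?thesis
    unfolding startup_def wp_simps(4)
  proof (rule wp_mono[OF wp_conj[OF l1 t1]])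
    fix s1 :: st assume h1: "((\<forall>x. x \<notin> {1, 14} \<longrightarrow> vr s1 x = vr s x) \<and> mm s1 = mm s \<and> vr s1 1 = m) \<and>
      tm s1 \<le> tm s + (n + 1) * clen (For 14 (Vr 0) ?b1)"
    have s1: "vr s1 1 = m" "vr s1 2 = 0" using h1 v by auto
    show "wp w (For 14 (Vr 1 \<oplus> Nm 2) ?b2) (wp w (Asg 3 (Bn Shl (Nm 1) (Vr 2))) (wp w (Asg 4 (Bn Shl (Nm 1) (Nm ca \<otimes> Vr 2)))
      (wp w (Asg 6 (Vr 0 \<otimes> Vr 0)) (\<lambda>s'. vr s' 0 = n \<and> vr s' 1 = m \<and> vr s' 2 = l \<and> vr s' 3 = 2 ^ l \<and> vr s' 4 = 2 ^ (ca * l) \<and>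
     vr s' 6 = n * n \<and> (\<forall>x. x \<notin> {0, 1, 2, 3, 4, 6, 14} \<longrightarrow> vr s' x = 0) \<and> mm s' = mm s \<and>
     tm s' \<le> tm s + (n + m + 5) * clen (For 14 (Vr 0) ?b1 ;; For 14 (Vr 1 \<oplus> Nm 2) ?b2 ;; Asg 3 (Bn Shl (Nm 1) (Vr 2)) ;; Asg 4 (Bn Shl (Nm 1) (Nm ca \<otimes> Vr 2)) ;; Asg 6 (Vr 0 \<otimes> Vr 0)))))) s1"
    proof (rule wp_mono[OF l2[OF s1]])
      fix s2 :: st assume h2: "(\<forall>x. x \<notin> {2, 14} \<longrightarrow> vr s2 x = vr s1 x) \<and> mm s2 = mm s1 \<and> vr s2 2 = l \<and>
        tm s2 \<le> tm s1 + (m + 3) * clen (For 14 (Vr 1 \<oplus> Nm 2) ?b2)"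
      have v2: "vr s2 0 = n" "vr s2 (Suc 0) = m" "vr s2 2 = l" "\<And>x. x \<notin> {0, 1, 2, 14} \<Longrightarrow> vr s2 x = 0" "mm s2 = mm s"
        using h1 h2 v by auto
      have t2: "tm s2 \<le> tm s + (n + 1) * clen (For 14 (Vr 0) ?b1) + (m + 3) * clen (For 14 (Vr 1 \<oplus> Nm 2) ?b2)"
        using h1 h2 by linarith
      show "wp w (Asg 3 (Bn Shl (Nm 1) (Vr 2))) (wp w (Asg 4 (Bn Shl (Nm 1) (Nm ca \<otimes> Vr 2)))
      (wp w (Asg 6 (Vr 0 \<otimes> Vr 0)) (\<lambda>s'. vr s' 0 = n \<and> vr s' 1 = m \<and> vr s' 2 = l \<and> vr s' 3 = 2 ^ l \<and> vr s' 4 = 2 ^ (ca * l) \<and>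
     vr s' 6 = n * n \<and> (\<forall>x. x \<notin> {0, 1, 2, 3, 4, 6, 14} \<longrightarrow> vr s' x = 0) \<and> mm s' = mm s \<and>
     tm s' \<le> tm s + (n + m + 5) * clen (For 14 (Vr 0) ?b1 ;; For 14 (Vr 1 \<oplus> Nm 2) ?b2 ;; Asg 3 (Bn Shl (Nm 1) (Vr 2)) ;; Asg 4 (Bn Shl (Nm 1) (Nm ca \<otimes> Vr 2)) ;; Asg 6 (Vr 0 \<otimes> Vr 0))))) s2"
        using v2 t2 w1 ca sh sh' nn by (simp add: algebra_simps)
    qed
  qed
qed

context reduction_run
begin

section \<open>Resource bounds\<close>

lemma XR_le: "XR \<le> 1000 * l\<^sup>2 * g ^ 3"
proof -
  have l: "4 \<le> l" and g: "1 \<le> g" using q(4) q_ge by auto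
  have lg: "4 \<le> l * g" "4 \<le> l * g ^ 2" "4 \<le> l * g ^ 3"
    using mult_mono[OF l g] mult_mono[OF l one_le_power[OF g, of 2]] mult_mono[OF l one_le_power[OF g, of 3]]
    by (simp_all only: mult_1_right)
  have "480 * l + 6 \<le> 482 * l" using l by simp
  then have "g * (480 * l + 4 + 2) \<le> g * (482 * l)" by (intro mult_left_mono) auto
  also have "g * (482 * l) = 482 * (l * g)" by (simp only: ac_simps)
  finally have "XK + 2 \<le> 482 * (l * g) + 4" by (simp add: XK_def)
  also have "482 * (l * g) + 4 \<le> 483 * (l * g)" using lg(1) by linarith
  finally have 1: "XK + 2 \<le> 483 * (l * g)" .
  have 2: "XJ + 2 \<le> 484 * (l * g ^ 2)"
  proof -
    have "g * (XK + 2) \<le> g * (483 * (l * g))" by (rule mult_left_mono[OF 1]) simp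
    also have "\<dots> = 483 * (l * g ^ 2)" by (simp add: power2_eq_square)
    finally have "XJ + 2 \<le> 483 * (l * g ^ 2) + 4" by (simp add: XJ_def)
    also have "4 \<le> l * g ^ 2" using lg(2) .
    then have "483 * (l * g ^ 2) + 4 \<le> 484 * (l * g ^ 2)" by linarith
    finally show ?thesis .
  qed
  have 3: "XI + 1 + 2 \<le> 486 * (l * g ^ 3)"
  proof -
    have "g * (XJ + 2) \<le> g * (484 * (l * g ^ 2))" by (rule mult_left_mono[OF 2]) simp
    also have "\<dots> = 484 * (l * g ^ 3)" by (simp add: power2_eq_square power3_eq_cube)
    finally have "XI + 1 + 2 \<le> 484 * (l * g ^ 3) + 5" by (simp add: XI_def)
    also have "484 * (l * g ^ 3) + 5 \<le> 486 * (l * g ^ 3)" using lg(3) by linarith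
    finally show ?thesis .
  qed
  have "2 * l * (XI + 1 + 2) \<le> 2 * l * (486 * (l * g ^ 3))" by (rule mult_left_mono[OF 3]) simp
  also have "\<dots> = 972 * (l\<^sup>2 * g ^ 3)" by (simp add: power2_eq_square)
  finally have "XR \<le> 972 * (l\<^sup>2 * g ^ 3) + 2" by (simp add: XR_def)
  also have "2 \<le> l\<^sup>2 * g ^ 3"
  proof -
    have "4 \<le> l * (l * g ^ 3)" using mult_mono[of 1 l 4 "l * g ^ 3"] l lg(3) by linarith
    then show ?thesis by (simp only: power2_eq_square mult.assoc)
  qed
  then have "972 * (l\<^sup>2 * g ^ 3) + 2 \<le> 1000 * l\<^sup>2 * g ^ 3" by simp
  finally show ?thesis .
qed

text \<open>The number of fresh regions is polynomial in \<open>q\<close>, so words of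
  \<open>O(log n)\<close> bits can address all of them, although most cells are never
  touched.\<close>

lemma XR_pow: "XR + 1 \<le> 2 ^ (23 + 5 * l)"
proof -
  have "l \<le> 2 ^ l" by simp
  then have "1000 * l\<^sup>2 * g ^ 3 \<le> 2 ^ 10 * (2 ^ l)\<^sup>2 * (2 ^ 4 * 2 ^ l) ^ 3"
    unfolding q(1) by (intro mult_mono power_mono) auto
  also have "\<dots> = 2 ^ (22 + 5 * l)"
  proof -
    have "(2::nat) ^ (22 + 5 * l) = 2 ^ 22 * (2 ^ l) ^ 5"
      by (simp only: power_add power_mult[symmetric] mult.commute[of l])
    moreover have "2 ^ 10 * x\<^sup>2 * (2 ^ 4 * x) ^ 3 = 2 ^ 22 * x ^ 5" for x :: nat
      by (simp add: power_mult_distrib)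
    ultimately show ?thesis by (simp only:)
  qed
  finally have "XR \<le> 2 ^ (22 + 5 * l)" using XR_le by linarith
  moreover have "(1::nat) \<le> 2 ^ (22 + 5 * l)" by simp
  moreover have "(2::nat) ^ (23 + 5 * l) = 2 ^ (22 + 5 * l) + 2 ^ (22 + 5 * l)"
  proof -
    have "23 + 5 * l = Suc (22 + 5 * l)" by simp
    then show ?thesis by (simp only: power_Suc mult_2)
  qed
  ultimately show ?thesis by linarith
qed

end

text \<open>Beyond the additive constant: start-up, sampling, the credits (with \<open>XR\<close>
  replaced by its closed bound) at \<open>E\<close> steps each, and at most \<open>TT + 1\<close>
  brute-force searches.\<close>

definition run_time :: "program \<Rightarrow> nat \<Rightarrow> nat \<Rightarrow> nat \<Rightarrow> nat \<Rightarrow> nat \<Rightarrow> nat" where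
  "run_time A ca n m l TT = 10 + (n + m + 5) * clen (startup ca) + (6 * l * (2 ^ l) ^ 5 + 1) * clen sample
     + 1000 * l\<^sup>2 * (16 * 2 ^ l) ^ 3 * (clen (trial A) * (m * m + TT + 5) + 20)
     + (TT + 1) * (clen (trial A) * (m * m * m + 1))"

definition init_state :: "nat \<Rightarrow> nat graph \<Rightarrow> st" where
  "init_state n G = \<lparr>vr = (\<lambda>_. 0)(0 := n), mm = mem (input_config n G), tm = 0\<rparr>"

text \<open>In the word size, \<open>ca\<close> provides for one region of
  \<open>2 ^ (ca * l)\<close> cells, \<open>max_pc A\<close> for program positions, and 40 for the
  number of regions, the input matrix and the products formed by the program.\<close>

lemma reduction_correct:
  assumes ca: "2 \<le> ca" and n: "49 \<le> n" and G: "simple_graph G" "verts G = {..<n}"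
    and m: "m * m \<le> n" "n < (m + 1) * (m + 1)"
    and l: "m + 2 \<le> 2 ^ l" "2 ^ l < 2 * (m + 2)" and lam: "l \<le> b" "n + 2 \<le> 2 ^ b"
    and w: "w = (40 + ca + max_pc A) * b"
    and sol: "\<And>a i j k. odd a \<Longrightarrow> a < 2 ^ l * 2 ^ l \<Longrightarrow> i < 16 * 2 ^ l \<Longrightarrow> j < i \<Longrightarrow> k < j \<Longrightarrow>
      card (triangles (piece G n m (2 ^ l * 2 ^ l) (2 ^ l div 16) a (i, j, k))) \<le> 1 \<Longrightarrow>
      solves A (ca * l) TT m (piece G n m (2 ^ l * 2 ^ l) (2 ^ l div 16) a (i, j, k))"
  shows "wp w (reduction A ca) (\<lambda>s'. tm s' \<le> run_time A ca n m l TT) (init_state n G)"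
    and "wex w (reduction A ca) (\<lambda>s'. of_bool ((vr s' 0 \<noteq> 0) \<noteq> has_triangle G)) (init_state n G) \<le> ennreal (1 / real n)"
proof -
  have m7: "7 \<le> m"
  proof (rule ccontr)
    assume "\<not> 7 \<le> m"
    then have "(m + 1) * (m + 1) \<le> 7 * 7" by (intro mult_mono) auto
    then show False using m(2) n by simp
  qed
  have l4: "4 \<le> l"
  proof (rule ccontr)
    assume "\<not> 4 \<le> l"
    then have "2 ^ l \<le> (2::nat) ^ 3" by (intro power_increasing) auto
    then show False using l(1) m7 by simp
  qed
  have lam4: "4 \<le> b" using l4 lam(1) by simp
  \<comment> \<open>The constant \<open>a\<close> is absorbed by the surplus
    \<open>(c - e) * b\<close>, because \<open>b >= 4\<close>.\<close>
  have pow_le: "(2::nat) ^ (a + e * l) \<le> 2 ^ (c * b)" if "a + e * 4 \<le> c * 4" "e \<le> c" for a e c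
  proof (rule power_increasing)
    have "e * l \<le> e * b" using lam(1) by simp
    moreover have "a \<le> (c - e) * b"
    proof -
      have "a \<le> (c - e) * 4" using that by (simp add: diff_mult_distrib)
      also have "\<dots> \<le> (c - e) * b" using lam4 by simp
      finally show ?thesis .
    qed
    moreover have "c * b = (c - e) * b + e * b" using that(2) by (simp add: diff_mult_distrib)
    ultimately show "a + e * l \<le> c * b" by linarith
  qed simp
  have cw: "c * b < w" if "c < 40 + ca + max_pc A" for c
    unfolding w using that lam4 by simp
  have pw: "(2::nat) ^ (c * b) < 2 ^ w" if "c < 40 + ca + max_pc A" for c
    using cw[OF that] by simp
  have wge: "40 + ca + max_pc A \<le> w" unfolding w using lam4 by simp
  have n2: "(n + 2) * (n + 2) < 2 ^ w"
  proof -
    have "(n + 2) * (n + 2) \<le> 2 ^ b * 2 ^ b" using lam(2) by (intro mult_mono) auto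
    also have "\<dots> = 2 ^ (2 * b)" by (simp flip: power_add add: mult_2)
    also have "\<dots> < 2 ^ w" by (rule pw) simp
    finally show ?thesis .
  qed
  have cal: "ca * l < w"
  proof -
    have "ca * l \<le> ca * b" using lam(1) by simp
    also have "\<dots> < w" by (rule cw) simp
    finally show ?thesis .
  qed
  define S where "S = (2::nat) ^ (ca * l)"
  define TS where "TS = 4 + (n + m + 5) * clen (startup ca)"
  define q where "q = (2::nat) ^ l"
  interpret sim: simulator A w "ca * l" S
  proof
    show "0 < ca * l" "ca * l \<le> w" "S = 2 ^ (ca * l)" using ca l4 cal by (simp_all add: S_def)
    have "max_pc A + 1 < w" using wge by simp
    also have "w < 2 ^ w" by simp
    finally show "max_pc A + 1 < 2 ^ w" .
  qed
  define Tot where "Tot = run_time A ca n m l TT - 6"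
  interpret R: reduction_run A w "ca * l" S n m l q TT Tot G
  proof
    show "simple_graph G" "verts G = {..<n}" "0 < n" "m * m \<le> n" "n < (m + 1) * (m + 1)" using G n m by auto
    show "q = 2 ^ l" "m + 2 \<le> q" "q < 2 * (m + 2)" "4 \<le> l" using l l4 by (simp_all add: q_def)
    have "m \<le> 2 ^ l" using l(1) by simp
    then have "m * m \<le> 2 ^ l * 2 ^ l" by (intro mult_mono) auto
    also have "\<dots> = 2 ^ (2 * l)" by (simp flip: power_add add: mult_2)
    also have "\<dots> \<le> S" unfolding S_def using ca by (intro power_increasing) auto
    finally show "m * m \<le> S" .
    have "64 * q ^ 7 = 2 ^ (6 + 7 * l)" unfolding q_def by (simp add: power_add flip: power_mult)
    also have "\<dots> \<le> 2 ^ (9 * b)" by (rule pow_le) simp_all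
    also have "\<dots> < 2 ^ w" by (rule pw) simp
    finally show "64 * q ^ 7 < 2 ^ w" .
    have "6 * l \<le> 6 * b" using lam(1) by simp
    then show "6 * l \<le> w" using cw[of 6] by simp
    fix a i j k assume "odd a" "a < q * q" "i < 16 * q" "j < i" "k < j"
      "card (triangles (piece G n m (q * q) (q div 16) a (i, j, k))) \<le> 1"
    then show "solves A (ca * l) TT m (piece G n m (q * q) (q div 16) a (i, j, k))"
      unfolding q_def by (rule sol)
  qed
  have space: "n * n + (R.XR + 1) * S \<le> 2 ^ w"
  proof -
    have "n * n \<le> 2 ^ b * 2 ^ b" using lam(2) by (intro mult_mono) auto
    also have "\<dots> = 2 ^ (2 * b)" by (simp flip: power_add add: mult_2)
    also have "\<dots> \<le> 2 ^ ((38 + ca) * b)" by (intro power_increasing) auto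
    finally have 1: "n * n \<le> 2 ^ ((38 + ca) * b)" .
    have "(R.XR + 1) * S \<le> 2 ^ (23 + 5 * l) * 2 ^ (ca * l)"
      unfolding S_def by (rule mult_right_mono[OF R.XR_pow]) simp
    also have "\<dots> = 2 ^ (23 + (5 + ca) * l)" by (simp add: power_add[symmetric] algebra_simps)
    also have "\<dots> \<le> 2 ^ ((38 + ca) * b)" by (rule pow_le) simp_all
    finally have "n * n + (R.XR + 1) * S \<le> 2 * 2 ^ ((38 + ca) * b)" using 1 by simp
    also have "\<dots> = 2 ^ Suc ((38 + ca) * b)" by simp
    also have "\<dots> \<le> 2 ^ w" using cw[of "38 + ca"] by (intro power_increasing) auto
    finally show ?thesis .
  qed
  have wc: "ca < 2 ^ w" using wge less_exp[of w] by linarith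
  let ?s = "init_state n G"
  define s1 where "s1 = tick 4 ?s"
  have t49: "take_bit w 49 = (49::nat)"
  proof -
    have "(49::nat) < 2 ^ 6" by simp
    also have "\<dots> \<le> 2 ^ w" using wge by (intro power_increasing) auto
    finally show ?thesis by (simp add: take_bit_nat_eq_self_iff)
  qed
  have cond: "aval w (Vr 0 \<prec> Nm 49) ?s = 0" using n t49 by (simp add: init_state_def)
  have st: "wp w (startup ca) (\<lambda>s' :: st. R.core s' \<and> vr s' 5 = 0 \<and> vr s' 7 = 0 \<and> vr s' 6 = n * n \<and>
      (\<forall>x\<ge>n * n. mm s' x = 0) \<and> tm s' \<le> TS) s1"
  proof (rule wp_mono[OF wp_startup[of s1 n m l w ca]])
    show "vr s1 = (\<lambda>_. 0)(0 := n)" by (simp add: s1_def init_state_def)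
    fix s' :: st assume h: "vr s' 0 = n \<and> vr s' 1 = m \<and> vr s' 2 = l \<and> vr s' 3 = 2 ^ l \<and> vr s' 4 = 2 ^ (ca * l) \<and>
       vr s' 6 = n * n \<and> (\<forall>x. x \<notin> {0, 1, 2, 3, 4, 6, 14} \<longrightarrow> vr s' x = 0) \<and> mm s' = mm s1 \<and>
       tm s' \<le> tm s1 + (n + m + 5) * clen (startup ca)"
    have "mm s' = mem (input_config n G)" "tm s1 = 4" using h by (simp_all add: s1_def init_state_def)
    then show "R.core s' \<and> vr s' 5 = 0 \<and> vr s' 7 = 0 \<and> vr s' 6 = n * n \<and> (\<forall>x\<ge>n * n. mm s' x = 0) \<and> tm s' \<le> TS"
    proof (intro conjI)
      show "R.core s'"
        unfolding R.core_def
      proof (intro conjI allI impI)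
        show "vr s' (18 + r) = 0" for r using h by simp
        show "mm s' x = R.inp x" if "x < n * n" for x
          using that \<open>mm s' = _\<close> by (simp add: input_config_def R.inp_def)
      qed (use h q_def S_def in simp_all)
      show "vr s' 5 = 0" "vr s' 7 = 0" "vr s' 6 = n * n" using h by simp_all
      show "\<forall>x\<ge>n * n. mm s' x = 0" using \<open>mm s' = _\<close> by (simp add: input_config_def)
      show "tm s' \<le> TS" using h \<open>tm s1 = 4\<close> by (simp add: TS_def)
    qed
  qed (use m l n2 wc cal n in auto)
  have time: "TS + (6 * l * q ^ 5 + 1) * clen sample + R.XR * R.E + (TT + 1) * R.D \<le> Tot"
  proof -
    have "R.XR * R.E \<le> 1000 * l\<^sup>2 * (16 * q) ^ 3 * R.E" by (rule mult_right_mono[OF R.XR_le]) simp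
    then show ?thesis
      by (simp add: Tot_def run_time_def TS_def q_def R.E_def R.D_def R.P_def)
  qed
  have fin: "wp w (sample ;; rounds A ;; Asg 0 (Vr 5)) (\<lambda>s'. tm s' \<le> Tot + 2) s2 \<and>
      wex w (sample ;; rounds A ;; Asg 0 (Vr 5)) (\<lambda>s'. of_bool ((vr s' 0 \<noteq> 0) \<noteq> has_triangle G)) s2
        \<le> ennreal ((1 / 2) ^ (2 * l))"
    if h: "R.core s2 \<and> vr s2 5 = 0 \<and> vr s2 7 = 0 \<and> vr s2 6 = n * n \<and> (\<forall>x\<ge>n * n. mm s2 x = 0) \<and> tm s2 \<le> TS" for s2
  proof -
    have "tm s2 + (6 * l * q ^ 5 + 1) * clen sample + R.XR * R.E + (TT + 1) * R.D \<le> Tot"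
      using h time by linarith
    then show ?thesis using h space by (intro conjI R.main_part) blast+
  qed
  have s1': "tick (elen (Vr 0 \<prec> Nm 49) + 1) ?s = s1" by (simp add: s1_def eval_nat_numeral)
  have Tot: "Tot + 2 \<le> run_time A ca n m l TT" by (simp add: Tot_def run_time_def)
  show "wp w (reduction A ca) (\<lambda>s'. tm s' \<le> run_time A ca n m l TT) ?s"
    unfolding reduction_def wp_simps(5) cond s1' wp_simps(4)[of w "startup ca"]
    using wp_mono[OF st wp_mono[OF conjunct1[OF fin]]] Tot by (simp del: wp_simps)
  have "wex w (startup ca) (wex w (sample ;; rounds A ;; Asg 0 (Vr 5)) (\<lambda>s'. of_bool ((vr s' 0 \<noteq> 0) \<noteq> has_triangle G))) s1
      \<le> ennreal ((1 / 2) ^ (2 * l))"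
    by (rule wex_le, rule wp_mono[OF st]) (use fin in blast)
  also have "\<dots> \<le> ennreal (1 / real n)"
  proof (rule ennreal_leI)
    have "n \<le> q * q" using R.n_le_p .
    also have "\<dots> = 2 ^ (2 * l)" by (rule R.p_pow)
    finally have "real n \<le> real (2 ^ (2 * l))" by (rule of_nat_mono)
    then show "(1 / 2) ^ (2 * l) \<le> 1 / real n" using n by (simp add: power_one_over frac_le)
  qed
  finally show "wex w (reduction A ca) (\<lambda>s'. of_bool ((vr s' 0 \<noteq> 0) \<noteq> has_triangle G)) ?s \<le> ennreal (1 / real n)"
    unfolding reduction_def wex_simps(4) cond s1' wex_simps(3)[of w "startup ca"] by simp
qed

text \<open>As \<open>q <= 4 * m\<close>, each summand is
  \<open>O(l ^ 2 * (m ^ 5 + m ^ 3 * TT))\<close>. The constant 7168 is \<open>7 * 4 ^ 5\<close>, and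
  262144000 is \<open>1000 * 64 ^ 3\<close> from \<open>16 * q <= 64 * m\<close>.\<close>

lemma run_time_le:
  assumes m: "7 \<le> m" "n < (m + 1) * (m + 1)" and l: "1 \<le> l" "2 ^ l < 2 * (m + 2)"
  shows "run_time A ca n m l TT \<le> (10 + 2 * clen (startup ca) + 7168 * clen sample + 262144000 * (6 * clen (trial A) + 20)
    + 4 * clen (trial A)) * l\<^sup>2 * (m ^ 5 + m ^ 3 * TT)"
proof -
  let ?F = "l\<^sup>2 * (m ^ 5 + m ^ 3 * TT)"
  define q where "q = (2::nat) ^ l"
  have q: "q \<le> 4 * m" using l(2) m(1) by (simp add: q_def)
  have m0: "1 \<le> m" using m(1) by simp
  have l2: "1 \<le> l\<^sup>2" using l(1) by simp
  have F5: "l\<^sup>2 * m ^ 5 \<le> ?F" by simp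
  have m5: "m ^ 5 \<le> ?F"
  proof -
    have "1 * m ^ 5 \<le> l\<^sup>2 * m ^ 5" by (rule mult_right_mono[OF l2]) simp
    then show ?thesis using F5 by (simp only: mult_1 order_trans)
  qed
  have m35: "m ^ 3 * (m * m + TT) = m ^ 5 + m ^ 3 * TT" by (simp add: algebra_simps eval_nat_numeral)
  have 0: "10 \<le> 10 * ?F"
  proof -
    have "1 \<le> m ^ 5" using m0 by simp
    then show ?thesis using m5 by linarith
  qed
  have 1: "(n + m + 5) * clen (startup ca) \<le> 2 * clen (startup ca) * ?F"
  proof -
    have "n + m + 5 \<le> m * m + 3 * m + 5" using m(2) by (simp add: algebra_simps)
    also have "3 * m + 5 \<le> m * m"
    proof -
      have "7 * m \<le> m * m" using m(1) by (rule mult_right_mono) simp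
      then show ?thesis using m(1) by linarith
    qed
    then have "m * m + 3 * m + 5 \<le> 2 * m ^ 2" by (simp add: power2_eq_square)
    also have "m ^ 2 \<le> m ^ 5" using m0 by (intro power_increasing) auto
    finally have "n + m + 5 \<le> 2 * ?F" using m5 by linarith
    then have "(n + m + 5) * clen (startup ca) \<le> (2 * ?F) * clen (startup ca)" by (rule mult_right_mono) simp
    then show ?thesis by (simp add: ac_simps)
  qed
  have 2: "(6 * l * q ^ 5 + 1) * clen sample \<le> 7168 * clen sample * ?F"
  proof -
    have "q ^ 5 \<le> (4 * m) ^ 5" by (rule power_mono[OF q]) simp
    then have "q ^ 5 \<le> 1024 * m ^ 5" by (simp add: power_mult_distrib)
    moreover have "l \<le> l\<^sup>2" by (simp add: power2_eq_square)
    ultimately have "6 * l * q ^ 5 \<le> 6 * l\<^sup>2 * (1024 * m ^ 5)" by (intro mult_mono) auto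
    then have "6 * l * q ^ 5 \<le> 6144 * (l\<^sup>2 * m ^ 5)" by simp
    then have "6 * l * q ^ 5 + 1 \<le> 7168 * ?F" using F5 0 by linarith
    then have "(6 * l * q ^ 5 + 1) * clen sample \<le> (7168 * ?F) * clen sample" by (rule mult_right_mono) simp
    then show ?thesis by (simp add: ac_simps)
  qed
  have mm1: "1 \<le> m * m + TT" using m0 by (simp add: Suc_le_eq)
  have 3: "1000 * l\<^sup>2 * (16 * q) ^ 3 * (clen (trial A) * (m * m + TT + 5) + 20)
      \<le> 262144000 * (6 * clen (trial A) + 20) * ?F"
  proof -
    have "(16 * q) ^ 3 \<le> (16 * (4 * m)) ^ 3" using q by (intro power_mono) auto
    then have a: "(16 * q) ^ 3 \<le> 262144 * m ^ 3" by (simp add: power_mult_distrib)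
    have "U + 5 \<le> 6 * U" if "1 \<le> U" for U :: nat using that by simp
    from this[OF mm1] have "m * m + TT + 5 \<le> 6 * (m * m + TT)" .
    then have "clen (trial A) * (m * m + TT + 5) \<le> clen (trial A) * (6 * (m * m + TT))" by (rule mult_left_mono) simp
    moreover have "20 \<le> 20 * (m * m + TT)" using mm1 by simp
    ultimately have b: "clen (trial A) * (m * m + TT + 5) + 20 \<le> (6 * clen (trial A) + 20) * (m * m + TT)"
      by (simp add: algebra_simps)
    have "1000 * l\<^sup>2 * (16 * q) ^ 3 * (clen (trial A) * (m * m + TT + 5) + 20)
      \<le> 1000 * l\<^sup>2 * (262144 * m ^ 3) * ((6 * clen (trial A) + 20) * (m * m + TT))"
      by (intro mult_mono a b) auto
    also have "\<dots> = 262144000 * (6 * clen (trial A) + 20) * (l\<^sup>2 * (m ^ 3 * (m * m + TT)))" by (simp add: ac_simps)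
    finally show ?thesis unfolding m35 .
  qed
  have 4: "(TT + 1) * (clen (trial A) * (m * m * m + 1)) \<le> 4 * clen (trial A) * ?F"
  proof -
    have "m * m * m + 1 \<le> 2 * m ^ 3" using m0 by (simp add: power3_eq_cube Suc_le_eq)
    moreover have "TT + 1 \<le> m * m + TT" using m0 by (simp add: Suc_le_eq)
    ultimately have "(TT + 1) * (clen (trial A) * (m * m * m + 1)) \<le> (m * m + TT) * (clen (trial A) * (2 * m ^ 3))"
      by (intro mult_mono) auto
    also have "\<dots> = 2 * clen (trial A) * (m ^ 3 * (m * m + TT))" by (simp add: ac_simps)
    also have "\<dots> \<le> 2 * clen (trial A) * (l\<^sup>2 * (m ^ 3 * (m * m + TT)))"
    proof -
      have "1 * (m ^ 3 * (m * m + TT)) \<le> l\<^sup>2 * (m ^ 3 * (m * m + TT))" by (rule mult_right_mono[OF l2]) simp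
      then show ?thesis by (intro mult_left_mono) auto
    qed
    finally show ?thesis unfolding m35 by simp
  qed
  have "run_time A ca n m l TT \<le> 10 * ?F + 2 * clen (startup ca) * ?F + 7168 * clen sample * ?F
     + 262144000 * (6 * clen (trial A) + 20) * ?F + 4 * clen (trial A) * ?F"
    unfolding run_time_def q_def[symmetric] by (intro add_mono 0 1 2 3 4)
  then show ?thesis by (simp only: distrib_right mult.assoc)
qed

lemma floor_sqrt_bounds:
  defines "r n \<equiv> nat \<lfloor>sqrt (real n)\<rfloor>"
  shows "r n * r n \<le> n" "n < (r n + 1) * (r n + 1)"
proof -
  have "real (r n) \<le> sqrt (real n)" by (simp add: r_def)
  then have "real (r n) ^ 2 \<le> sqrt (real n) ^ 2" by (intro power_mono) auto
  then have "real (r n * r n) \<le> real n" by (simp add: power2_eq_square)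
  then show "r n * r n \<le> n" by (simp only: of_nat_le_iff)
  have "sqrt (real n) < real (r n + 1)" unfolding r_def by (simp add: add.commute) linarith
  then have "sqrt (real n) ^ 2 < real (r n + 1) ^ 2" by (intro power_strict_mono) auto
  then have "real n < real ((r n + 1) * (r n + 1))" by (simp add: power2_eq_square algebra_simps)
  then show "n < (r n + 1) * (r n + 1)" by (simp only: of_nat_less_iff)
qed

section \<open>Transfer to the machine and the soft-O bound\<close>

lemma triangle_detection_compiled:
  assumes c: "2 \<le> c" and wf: "wfc R"
    and cor: "\<And>n G. simple_graph G \<Longrightarrow> verts G = {..<n} \<Longrightarrow> Q G \<Longrightarrow>
      wp (word_size c n) R (\<lambda>s'. tm s' \<le> t n) (init_state n G) \<and>
      wex (word_size c n) R (\<lambda>s'. of_bool ((vr s' 0 \<noteq> 0) \<noteq> has_triangle G)) (init_state n G) \<le> ennreal (\<epsilon> n)"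
    and \<epsilon>: "\<And>n. 0 \<le> \<epsilon> n"
  shows "triangle_detection Q t (\<lambda>n. 1 - \<epsilon> n)"
  unfolding triangle_detection_def
proof (intro exI[of _ "ccode 0 R"] exI[of _ c] conjI allI impI c)
  fix n and G :: "nat graph" assume h: "simple_graph G \<and> verts G = {..<n} \<and> Q G"
  define w where "w = word_size c n"
  let ?s = "init_state n G" and ?cfg = "input_config n G"
  define D where "D = run w (ccode 0 R) (t n) ?cfg"
  have pos: "2 \<le> w"
  proof -
    have "1 \<le> ceillog2 (n + 2)" by (subst ceillog2_ge_iff) auto
    then have "2 * 1 \<le> c * ceillog2 (n + 2)" using c by (intro mult_mono) auto
    then show ?thesis by (simp add: w_def word_size_def)
  qed
  have "n + 2 \<le> 2 ^ ceillog2 (n + 2)" by (rule le_two_power_ceillog2)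
  also have "\<dots> \<le> 2 ^ w" using c by (intro power_increasing) (auto simp: w_def word_size_def)
  finally have "n < 2 ^ w" by simp
  moreover have "1 < (2::nat) ^ w" using pos by (intro one_less_power) auto
  ultimately have words: "words w ?s" by (auto simp: words_def init_state_def input_config_def)
  have time: "tm s' \<le> t n" if "s' \<in> set_pmf (sem w R ?s)" for s'
    using cor[of G n] h that by (simp add: wp_def w_def)
  have eq: "map_pmf (\<lambda>cfg. (pc cfg, regs cfg 0)) D = map_pmf (\<lambda>s. (clen R, vr s 0)) (sem w R ?s)"
    unfolding D_def
  proof (rule run_compiled[OF wf words])
    show "tm ?s = 0" "pc ?cfg = 0" "mem ?cfg = mm ?s" by (simp_all add: init_state_def input_config_def)
    show "regs ?cfg (2 * x) = vr ?s x" for x by (simp add: init_state_def input_config_def)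
  qed (rule time)
  have "halted (ccode 0 R) cfg" if "cfg \<in> set_pmf D" for cfg
  proof -
    have "(pc cfg, regs cfg 0) \<in> set_pmf (map_pmf (\<lambda>cfg. (pc cfg, regs cfg 0)) D)" using that by auto
    then have "pc cfg = clen R" unfolding eq by auto
    then show ?thesis by (simp add: halted_def)
  qed
  moreover have "1 - \<epsilon> n \<le> measure_pmf.prob D {s. answer s \<longleftrightarrow> has_triangle G}"
  proof -
    let ?W = "{s. (vr s 0 \<noteq> 0) \<noteq> has_triangle G}"
    have "emeasure (sem w R ?s) ?W = (\<integral>\<^sup>+s. indicator ?W s \<partial>measure_pmf (sem w R ?s))" by simp
    also have "\<dots> = wex w R (\<lambda>s'. of_bool ((vr s' 0 \<noteq> 0) \<noteq> has_triangle G)) ?s"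
      unfolding wex_def by (rule nn_integral_cong) (simp add: indicator_def)
    also have "\<dots> \<le> ennreal (\<epsilon> n)" using cor[of G n] h by (simp add: w_def)
    finally have "measure_pmf.prob (sem w R ?s) ?W \<le> \<epsilon> n"
      unfolding measure_pmf.emeasure_eq_measure using \<epsilon> by (simp add: ennreal_le_iff)
    moreover have "measure_pmf.prob (sem w R ?s) {s. (vr s 0 \<noteq> 0) = has_triangle G} = 1 - measure_pmf.prob (sem w R ?s) ?W"
    proof -
      have "{s. (vr s 0 \<noteq> 0) = has_triangle G} = space (measure_pmf (sem w R ?s)) - ?W" by auto
      then show ?thesis using measure_pmf.prob_compl[of ?W "sem w R ?s"] by simp
    qed
    moreover have "measure_pmf.prob D {s. answer s \<longleftrightarrow> has_triangle G} =
        measure_pmf.prob (map_pmf (\<lambda>cfg. (pc cfg, regs cfg 0)) D) {(a, b). (b \<noteq> 0) = has_triangle G}"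
      by (simp add: vimage_def answer_def)
    moreover have "\<dots> = measure_pmf.prob (sem w R ?s) {s. (vr s 0 \<noteq> 0) = has_triangle G}"
      unfolding eq by (simp add: vimage_def)
    ultimately show ?thesis by simp
  qed
  ultimately show "let D = run (word_size c n) (ccode 0 R) (t n) (input_config n G)
      in (\<forall>s\<in>set_pmf D. halted (ccode 0 R) s) \<and> 1 - \<epsilon> n \<le> measure_pmf.prob D {s. answer s = has_triangle G}"
    unfolding Let_def D_def w_def by blast
qed

definition total_time :: "program \<Rightarrow> nat \<Rightarrow> (nat \<Rightarrow> nat) \<Rightarrow> nat \<Rightarrow> nat" where
  "total_time A ca T n = (let m = nat \<lfloor>sqrt (real n)\<rfloor> in run_time A ca n m (ceillog2 (m + 2)) (T m))"

text \<open>\<open>m <= sqrt n\<close> turns \<open>m ^ 5\<close> and \<open>m ^ 3\<close> into the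
  two powers of \<open>n\<close>. From \<open>2 ^ l <= 4 * m <= m * m <= n\<close> and
  \<open>ln 2 >= 1 / 2\<close> follows \<open>l <= 2 * ln n\<close>, so two logarithmic factors
  suffice.\<close>

lemma total_time_soft_O:
  "(\<lambda>n. real (total_time A ca T n)) \<in> soft_O (\<lambda>n. real n powr (5 / 2)
     + real n powr (3 / 2) * real (T (nat \<lfloor>sqrt (real n)\<rfloor>)))"
proof -
  define K where "K = 10 + 2 * clen (startup ca) + 7168 * clen sample + 262144000 * (6 * clen (trial A) + 20)
    + 4 * clen (trial A)"
  let ?g = "\<lambda>n. real n powr (5 / 2) + real n powr (3 / 2) * real (T (nat \<lfloor>sqrt (real n)\<rfloor>))"
  have "(\<lambda>n. real (total_time A ca T n)) \<in> O(\<lambda>n. ?g n * ln (real n) ^ 2)"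
  proof (rule bigoI[where c = "4 * real K"])
    show "\<forall>\<^sub>F n in at_top. norm (real (total_time A ca T n)) \<le> 4 * real K * norm (?g n * ln (real n) ^ 2)"
    proof (rule eventually_at_top_linorderI[of 49])
      fix n :: nat assume n: "49 \<le> n"
      define m where "m = nat \<lfloor>sqrt (real n)\<rfloor>"
      define l where "l = ceillog2 (m + 2)"
      note mb = floor_sqrt_bounds[of n, folded m_def]
      have m7: "7 \<le> m"
      proof (rule ccontr)
        assume "\<not> 7 \<le> m"
        then have "(m + 1) * (m + 1) \<le> 7 * 7" by (intro mult_mono) auto
        then show False using mb(2) n by simp
      qed
      have l1: "1 \<le> l" unfolding l_def by (subst ceillog2_ge_iff) auto
      have l2: "2 ^ l < 2 * (m + 2)" unfolding l_def by (rule two_power_ceillog2_gt) simp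
      have rt: "total_time A ca T n \<le> K * l\<^sup>2 * (m ^ 5 + m ^ 3 * T m)"
        using run_time_le[OF m7 mb(2) l1 l2, of A ca "T m"] unfolding total_time_def Let_def m_def[symmetric] l_def[symmetric] K_def .
      have ms: "real m \<le> sqrt (real n)" by (simp add: m_def)
      have sp: "sqrt (real n) ^ j = real n powr (real j / 2)" for j
        using n by (simp add: powr_half_sqrt[symmetric] powr_realpow[symmetric] powr_powr)
      have m5: "real m ^ 5 \<le> real n powr (5 / 2)"
        using power_mono[OF ms, of 5] sp[of 5] by simp
      have m3: "real m ^ 3 \<le> real n powr (3 / 2)"
        using power_mono[OF ms, of 3] sp[of 3] by simp
      have "2 ^ l \<le> n"
      proof -
        have "2 ^ l \<le> 4 * m" using l2 m7 by simp
        also have "\<dots> \<le> m * m" using m7 by (intro mult_right_mono) auto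
        also have "\<dots> \<le> n" by (rule mb(1))
        finally show ?thesis .
      qed
      then have "real (2 ^ l) \<le> real n" by (rule of_nat_mono)
      then have "ln ((2::real) ^ l) \<le> ln (real n)" by (subst ln_le_cancel_iff) (use n in auto)
      then have "real l * ln 2 \<le> ln (real n)" by (simp add: ln_realpow)
      moreover have "real l * (1 / 2) \<le> real l * ln 2"
        using ln_2_less_1 ln2_ge_two_thirds by (intro mult_left_mono) auto
      ultimately have "real l \<le> 2 * ln (real n)" by simp
      then have "real l ^ 2 \<le> (2 * ln (real n)) ^ 2" by (intro power_mono) auto
      then have ll: "real l ^ 2 \<le> 4 * ln (real n) ^ 2" by (simp add: power_mult_distrib)
      have "real (total_time A ca T n) \<le> real (K * l\<^sup>2 * (m ^ 5 + m ^ 3 * T m))" using rt by (rule of_nat_mono)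
      also have "\<dots> = real K * real l ^ 2 * (real m ^ 5 + real m ^ 3 * real (T m))" by simp
      also have "\<dots> \<le> real K * (4 * ln (real n) ^ 2) * ?g n"
        unfolding m_def[symmetric]
        by (intro mult_mono add_mono mult_left_mono ll m5 m3) auto
      also have "\<dots> \<le> 4 * real K * norm (?g n * ln (real n) ^ 2)"
        by (simp add: abs_mult)
      finally show "norm (real (total_time A ca T n)) \<le> 4 * real K * norm (?g n * ln (real n) ^ 2)" by simp
    qed
  qed
  then show ?thesis unfolding soft_O_def by blast
qed

theorem theorem3p1:
  fixes H :: "'a graph"
  assumes "simple_graph H" and "k_colorable 3 H" and "card (triangles H) \<le> 1"
  shows "\<exists>Hp :: nat graph.
           simple_graph Hp \<and> k_colorable 3 Hp \<and> card (triangles Hp) = card (triangles H) \<and>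
           (\<forall>T :: nat \<Rightarrow> nat.
              triangle_detection (free_of Hp) T (\<lambda>_. 2 / 3) \<longrightarrow>
              (\<exists>(t :: nat \<Rightarrow> nat) (\<epsilon> :: nat \<Rightarrow> real).
                 (\<lambda>n. real (t n)) \<in> soft_O (\<lambda>n. real n powr (5 / 2)
                     + real n powr (3 / 2) * real (T (nat \<lfloor>sqrt (real n)\<rfloor>))) \<and>
                 \<epsilon> \<in> O(\<lambda>n. 1 / real n) \<and>
                 triangle_detection (induced_free_of H) t (\<lambda>n. 1 - \<epsilon> n)))"
proof -
  note aug = simple_augment[OF assms(1)]
  have "finite (verts (augment H))" using aug by (simp add: simple_graph_def)
  then obtain h :: "'a + 'a set \<times> bool \<Rightarrow> nat" where h: "inj_on h (verts (augment H))"
    using finite_imp_inj_to_nat_seg by blast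
  define Hp where "Hp = map_graph h (augment H)"
  have "\<exists>(t :: nat \<Rightarrow> nat) (\<epsilon> :: nat \<Rightarrow> real).
      (\<lambda>n. real (t n)) \<in> soft_O (\<lambda>n. real n powr (5 / 2) + real n powr (3 / 2) * real (T (nat \<lfloor>sqrt (real n)\<rfloor>))) \<and>
      \<epsilon> \<in> O(\<lambda>n. 1 / real n) \<and> triangle_detection (induced_free_of H) t (\<lambda>n. 1 - \<epsilon> n)"
    if "triangle_detection (free_of Hp) T (\<lambda>_. 2 / 3)" for T
  proof -
    obtain A ca where ca: "2 \<le> ca" and A: "\<And>n G. simple_graph G \<Longrightarrow> verts G = {..<n} \<Longrightarrow> free_of Hp G \<Longrightarrow>
        solves A (word_size ca n) (T n) n G"
      using \<open>triangle_detection (free_of Hp) T (\<lambda>_. 2 / 3)\<close> unfolding triangle_detection_def solves_def by blast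
    define c where "c = 40 + ca + max_pc A"
    \<comment> \<open>Below 49 the graph is not inspected, so no error bound better than 1 is
      claimed there.\<close>
    define \<epsilon> :: "nat \<Rightarrow> real" where "\<epsilon> n = (if n < 49 then 1 else 1 / real n)" for n
    have "triangle_detection (induced_free_of H) (total_time A ca T) (\<lambda>n. 1 - \<epsilon> n)"
    proof (rule triangle_detection_compiled[where c = c and R = "reduction A ca"])
      fix n and G :: "nat graph" assume G: "simple_graph G" "verts G = {..<n}" "induced_free_of H G"
      define m where "m = nat \<lfloor>sqrt (real n)\<rfloor>"
      define l where "l = ceillog2 (m + 2)"
      note mb = floor_sqrt_bounds[of n, folded m_def]
      have tt: "total_time A ca T n = run_time A ca n m l (T m)"
        by (simp add: total_time_def m_def l_def Let_def)
      show "wp (word_size c n) (reduction A ca) (\<lambda>s'. tm s' \<le> total_time A ca T n) (init_state n G) \<and>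
        wex (word_size c n) (reduction A ca) (\<lambda>s'. of_bool ((vr s' 0 \<noteq> 0) \<noteq> has_triangle G)) (init_state n G) \<le> ennreal (\<epsilon> n)"
      proof (cases "n < 49")
        case True
        let ?w = "word_size c n"
        have "1 \<le> ceillog2 (n + 2)" by (subst ceillog2_ge_iff) auto
        then have "c * 1 \<le> ?w" unfolding word_size_def by (rule mult_left_mono) simp
        then have "0 < ?w" "(2::nat) ^ 6 \<le> 2 ^ ?w" by (simp add: c_def) (use \<open>c * 1 \<le> ?w\<close> in \<open>intro power_increasing; simp add: c_def\<close>)
        then have small: "take_bit ?w 49 = (49::nat)" "take_bit ?w (Suc 0) = Suc 0"
          by (simp_all add: take_bit_nat_eq_self_iff del: ceillog2_2)
        have "aval ?w (Vr 0 \<prec> Nm 49) (init_state n G) \<noteq> 0"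
          using True small by (simp add: init_state_def)
        then have "wp ?w (reduction A ca) (\<lambda>s'. tm s' \<le> 10) (init_state n G)"
          by (simp add: reduction_def init_state_def)
        moreover have "10 \<le> total_time A ca T n" unfolding tt by (simp add: run_time_def)
        moreover have "wex ?w (reduction A ca) (\<lambda>s'. of_bool ((vr s' 0 \<noteq> 0) \<noteq> has_triangle G)) (init_state n G) \<le> 1"
          by (rule wex_le) (simp add: wp_def)
        ultimately show ?thesis using True by (auto simp: \<epsilon>_def elim: wp_mono)
      next
        case False
        then have n: "49 \<le> n" by simp
        have "m \<le> n" using le_square mb(1) by (rule order_trans)
        then have "m + 2 \<le> n + 2" by simp
        then have lam: "l \<le> ceillog2 (n + 2)" unfolding l_def by (rule ceillog2_mono)
        have l: "m + 2 \<le> 2 ^ l" "2 ^ l < 2 * (m + 2)"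
          unfolding l_def by (rule le_two_power_ceillog2) (rule two_power_ceillog2_gt, simp)
        have "4 \<le> l"
        proof -
          have "7 * 7 < (m + 1) * (m + 1)" using mb(2) n by simp
          then have "\<not> m + 1 \<le> 7" using mult_le_mono[of "m + 1" 7 "m + 1" 7] by linarith
          then show ?thesis unfolding l_def by (subst ceillog2_ge_iff) auto
        qed
        note L_bounds = block_size[OF this l(2)]
        \<comment> \<open>\<open>ca * l\<close> is exactly the word size which the given algorithm
          expects on \<open>m\<close> vertices, so its guarantee can be used for the pieces with
          bound \<open>T m\<close>.\<close>
        have sol: "solves A (ca * l) (T m) m (piece G n m (2 ^ l * 2 ^ l) (2 ^ l div 16) a (i, j, k))"
          if b: "odd a" "a < 2 ^ l * 2 ^ l" "i < 16 * 2 ^ l" "j < i" "k < j"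
            and one: "card (triangles (piece G n m (2 ^ l * 2 ^ l) (2 ^ l div 16) a (i, j, k))) \<le> 1" for a i j k
        proof -
          have pw: "(2::nat) ^ l * 2 ^ l = 2 ^ (2 * l)" by (simp flip: power_add add: mult_2)
          have g_mult_L: "16 * 2 ^ l * (2 ^ l div 16) = (2::nat) ^ (2 * l)"
            unfolding pw[symmetric] using L_bounds(1) by (metis mult.assoc mult.commute)
          have "free_of Hp (piece G n m (2 ^ (2 * l)) (2 ^ l div 16) a (i, j, k))"
            unfolding Hp_def
            by (rule piece_free[OF assms(1) h b(1,3) _ _ _ _ _ g_mult_L G(1,2) _ L_bounds(3) G(3) one[unfolded pw]])
              (use b n in auto)
          from A[OF simple_piece[OF G(1) L_bounds(3)] verts_piece this]
          have "solves A (ca * l) (T m) m (piece G n m (2 ^ (2 * l)) (2 ^ l div 16) a (i, j, k))"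
            by (simp only: word_size_def l_def)
          then show ?thesis unfolding pw .
        qed
        have w: "word_size c n = (40 + ca + max_pc A) * ceillog2 (n + 2)" by (simp add: word_size_def c_def)
        show ?thesis
          using reduction_correct[OF ca n G(1,2) mb l lam le_two_power_ceillog2 w sol] False
          unfolding tt by (simp add: \<epsilon>_def)
      qed
    qed (auto simp: c_def \<epsilon>_def wfc_reduction)
    moreover have "\<epsilon> \<in> O(\<lambda>n. 1 / real n)"
      by (rule bigoI[where c = 1], rule eventually_at_top_linorderI[of 49]) (simp add: \<epsilon>_def)
    ultimately show ?thesis using total_time_soft_O by blast
  qed
  then show ?thesis
    using simple_map_graph[OF h aug] k_colorable_map_graph[OF h aug k_colorable_augment[OF assms(1,2)]]
      card_triangles_map_graph[OF h aug] card_triangles_augment[OF assms(1)]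
    unfolding Hp_def by (intro exI[of _ "map_graph h (augment H)"]) simp
qed

end
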